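(* Let $(M,J)$ be a compact complex manifold and let $g=g(t)$ be a solution of the HCF on $M$. Then the Chern curvature $\Omega=\Omega_{i\bar j}{}^{\bar lk}(t)$ of $g(t)$, viewed as a section of $\mathrm{Sym}^{1,1}(\mathrm{End}(T^{1,0}M))$, satisfies $$\partial_t\Omega=\Delta^T\Omega+\Omega^2+\Omega^\#+D(\nabla T)+\mathrm{ad}_v\Omega,$$ where (a) $D(\nabla T)_{i\bar j}{}^{\bar lk}=\frac12 g^{m\bar n}g^{p\bar s}\,\nabla_iT^k_{mp}\,\nabla_{\bar j}T^{\bar l}_{\bar n\bar s}$; (b) $v=v_a^b\,e_b\otimes\epsilon^a\in\mathrm{End}(T^{1,0}M)$ with $v_a^b=\frac12S^{(4)}_{a\bar s}g^{b\bar s}$.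
   Context: Einstein summation is used. Hermitian metric: a $J$-invariant Riemannian metric $g$, with components $g_{i\bar j}$ on $T^{1,0}M$ and inverse $g^{i\bar j}$. Chern connection $\nabla$: the unique connection on $TM$ with $\nabla g=0$, $\nabla J=0$, and torsion $T(X,Y)=\nabla_XY-\nabla_YX-[X,Y]$ satisfying $T(X,JY)=T(JX,Y)$. In holomorphic coordinates $T_{ij}^k=g^{k\bar l}(\partial_i g_{j\bar l}-\partial_j g_{i\bar l})$, $T_{ij\bar l}=T_{ij}^kg_{k\bar l}$, $T_{\bar i\bar j}^{\bar k}=\overline{T_{ij}^k}$, $T_{\bar i\bar j l}=\overline{T_{ij\bar l}}$; the Chern curvature is $\Omega_{i\bar jk\bar l}=-\partial_i\partial_{\bar j}g_{k\bar l}+g^{p\bar s}\partial_{\bar j}g_{p\bar l}\,\partial_ig_{k\bar s}$. Also $S^{(2)}_{i\bar j}=g^{m\bar n}\Omega_{m\bar ni\bar j}$ and $S^{(4)}_{i\bar j}=g^{m\bar n}\Omega_{i\bar nm\bar j}$. HCF: $\partial_t g_{i\bar j}=-S^{(2)}_{i\bar j}-Q_{i\bar j}$ for a smooth family of Hermitian metrics $g(t)$, with $Q_{i\bar j}=\frac12 g^{m\bar n}g^{p\bar s}T_{mp\bar j}T_{\bar n\bar s i}$. With a local frame $\{e_i\}$ of $T^{1,0}M$ and dual frame $\{\epsilon^i\}$, $\Omega$ is regarded as $\Omega_{i\bar j}{}^{\bar lk}(e_k\otimes\epsilon^i)\otimes\overline{(e_l\otimes\epsilon^j)}$, where $\Omega_{i\bar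 j}{}^{\bar lk}=\Omega_{i\bar jm\bar n}g^{m\bar l}g^{k\bar n}$. $\mathrm{Sym}^{1,1}(W)$ denotes the real span of the elements $w\otimes\bar w$ in $W\otimes\overline W$. Torsion-twisted connection: $\nabla^T_XY=\nabla_XY-T(X,Y)$ on $TM$, extended to all associated tensor bundles. Its Laplacian at $m$ is $\Delta^T=\frac12\sum_i(\nabla^T_{e_i}\nabla^T_{\bar e_i}+\nabla^T_{\bar e_i}\nabla^T_{e_i})$, where $e_i$ are local holomorphic vector fields forming a unitary frame at $m$. Operations on $\mathrm{Sym}^{1,1}(\mathfrak g)$, $\mathfrak g=\mathrm{End}(T^{1,0}_mM)$: $\mathrm{ad}_v(u\otimes\bar u)=[v,u]\otimes\bar u+u\otimes\overline{[v,u]}$, extended $\mathbb{R}$-linearly, with $[v,u]=vu-uv$. $\Omega^2$: if $\Omega=\sum_i\lambda_iv_i\otimes\bar v_i$ with $\{v_i\}$ an orthonormal basis of $\mathfrak g$ for the Hermitian product induced by $g$, then $\Omega^2=\sum_i\lambda_i^2v_i\otimes\bar v_i$. $\Omega^\#=\frac12\Omega\#\Omega$, where $\#$ is the bilinear operation determined by $(v_1\otimes\bar w_1)\#(v_2\otimes\bar w_2)=[v_1,v_2]\otimes\overline{[w_1,w_2]}$. *)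

theory Defs
  imports "HOL-Analysis.Analysis"
begin

section \<open>Smooth and holomorphic maps\<close>

text \<open>
  Derivatives are taken within \<open>S\<close>.  This is only used for open \<open>S\<close> and for
  \<open>S = I \<times> U\<close> with \<open>U\<close> open and \<open>I\<close> a nondegenerate interval; derivatives are unique
  there, and one-sided in time at an endpoint of \<open>I\<close>.
\<close>

primrec Ck_on :: "nat \<Rightarrow> 'a::real_normed_vector set \<Rightarrow> ('a \<Rightarrow> 'b::real_normed_vector) \<Rightarrow> bool" where
  "Ck_on 0 S f \<longleftrightarrow> continuous_on S f"
| "Ck_on (Suc k) S f \<longleftrightarrow>
     (\<exists>f'. (\<forall>x\<in>S. (f has_derivative f' x) (at x within S)) \<and> (\<forall>v. Ck_on k S (\<lambda>x. f' x v)))"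

definition smooth_on :: "'a::real_normed_vector set \<Rightarrow> ('a \<Rightarrow> 'b::real_normed_vector) \<Rightarrow> bool" where
  "smooth_on S f \<longleftrightarrow> (\<forall>k. Ck_on k S f)"

text \<open>
  In a holomorphic chart a real tangent vector \<open>\<Sum>i. a i * \<partial>/\<partial>x_i + b i * \<partial>/\<partial>y_i\<close> is written as
  the vector in \<open>complex^'n\<close> with entries \<open>a i + \<i> * b i\<close>, so that \<open>J\<close> is multiplication by \<open>\<i>\<close>.
  The space of type (1,0) vectors is identified with it by \<open>X \<mapsto> (X - \<i> J X) / 2\<close>;
  in particular \<open>axis i 1\<close> corresponds to \<open>\<partial>_i = (\<partial>/\<partial>x_i - \<i> \<partial>/\<partial>y_i) / 2\<close>.
\<close>

definition Jst :: "complex^'n \<Rightarrow> complex^'n" where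
  "Jst v = \<i> *s v"

definition holo_on :: "(complex^'n) set \<Rightarrow> (complex^'n \<Rightarrow> complex^'m) \<Rightarrow> bool" where
  "holo_on S f \<longleftrightarrow>
     (\<forall>x\<in>S. \<exists>f'. (f has_derivative f') (at x) \<and> (\<forall>v. f' (Jst v) = Jst (f' v)))"

section \<open>Complex manifolds\<close>

type_synonym ('m, 'n) chart = "'m set \<times> ('m \<Rightarrow> complex^'n)"

definition coords :: "('m, 'n) chart \<Rightarrow> (complex^'n) set" where
  "coords c = snd c ` fst c"

definition overlap :: "('m, 'n) chart \<Rightarrow> ('m, 'n) chart \<Rightarrow> (complex^'n) set" where
  "overlap c d = snd c ` (fst c \<inter> fst d)"

definition trans_map :: "('m, 'n) chart \<Rightarrow> ('m, 'n) chart \<Rightarrow> complex^'n \<Rightarrow> complex^'n" where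
  "trans_map c d = snd d \<circ> inv_into (fst c) (snd c)"

definition complex_atlas :: "('m::topological_space, 'n::finite) chart set \<Rightarrow> bool" where
  "complex_atlas \<A> \<longleftrightarrow>
     (\<forall>c\<in>\<A>. open (fst c) \<and> open (coords c) \<and> (\<exists>\<psi>. homeomorphism (fst c) (coords c) (snd c) \<psi>)) \<and>
     (\<Union>c\<in>\<A>. fst c) = UNIV \<and>
     (\<forall>c\<in>\<A>. \<forall>d\<in>\<A>. holo_on (overlap c d) (trans_map c d))"

section \<open>Hermitian metrics\<close>

text \<open>
  A tensor field on the manifold is given by its expressions in all charts, which have to be
  related by the transition maps.
\<close>

type_synonym 'n local_metric = "complex^'n \<Rightarrow> complex^'n \<Rightarrow> complex^'n \<Rightarrow> real"
type_synonym 'n local_field = "complex^'n \<Rightarrow> complex^'n"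

definition hermitian_metric ::
  "('m, 'n::finite) chart set \<Rightarrow> (('m, 'n) chart \<Rightarrow> 'n local_metric) \<Rightarrow> bool" where
  "hermitian_metric \<A> g \<longleftrightarrow>
     (\<forall>c\<in>\<A>. (\<forall>u v. smooth_on (coords c) (\<lambda>x. g c x u v)) \<and>
        (\<forall>x\<in>coords c. bilinear (g c x) \<and>
           (\<forall>u v. g c x u v = g c x v u) \<and>
           (\<forall>u. u \<noteq> 0 \<longrightarrow> g c x u u > 0) \<and>
           (\<forall>u v. g c x (Jst u) (Jst v) = g c x u v))) \<and>
     (\<forall>c\<in>\<A>. \<forall>d\<in>\<A>. \<forall>x\<in>overlap c d. \<forall>u v.
        let D = frechet_derivative (trans_map c d) (at x)
        in g c x u v = g d (trans_map c d x) (D u) (D v))"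

definition smooth_metric_family ::
  "('m, 'n::finite) chart set \<Rightarrow> real set \<Rightarrow> (real \<Rightarrow> ('m, 'n) chart \<Rightarrow> 'n local_metric) \<Rightarrow> bool" where
  "smooth_metric_family \<A> I g \<longleftrightarrow>
     (\<forall>t\<in>I. hermitian_metric \<A> (g t)) \<and>
     (\<forall>c\<in>\<A>. \<forall>u v. smooth_on (I \<times> coords c) (\<lambda>(t, x). g t c x u v))"

text \<open>
  The entry \<open>(i, j)\<close> of \<open>g_comp h x\<close> is \<open>g_{i jbar}\<close>, the complex bilinear extension of \<open>h x\<close>
  evaluated at \<open>\<partial>_i = (u - \<i> J u) / 2\<close> and at the conjugate of \<open>\<partial>_j = (v - \<i> J v) / 2\<close>.
\<close>

definition g_comp :: "'n::finite local_metric \<Rightarrow> complex^'n \<Rightarrow> complex^'n^'n" where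
  "g_comp h x = (\<chi> i j. let u = axis i 1; v = axis j 1 in
     (of_real (h x u v) + of_real (h x (Jst u) (Jst v))
       + \<i> * of_real (h x u (Jst v)) - \<i> * of_real (h x (Jst u) v)) / 4)"

text \<open>
  \<open>g_inv G x i j\<close> is \<open>g^{i jbar}\<close>, normalised by \<open>\<Sum>j. g^{i jbar} * g_{k jbar} = \<delta>^i_k\<close>; hence the
  transposition.
\<close>

definition g_inv :: "(complex^'n \<Rightarrow> complex^'n^'n) \<Rightarrow> complex^'n \<Rightarrow> 'n::finite \<Rightarrow> 'n \<Rightarrow> complex" where
  "g_inv G x i j = matrix_inv (G x) $ j $ i"

section \<open>Chern torsion and curvature in holomorphic coordinates\<close>

definition dz :: "'n::finite \<Rightarrow> (complex^'n \<Rightarrow> complex) \<Rightarrow> complex^'n \<Rightarrow> complex" where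
  "dz i f x = (frechet_derivative f (at x) (axis i 1)
                - \<i> * frechet_derivative f (at x) (Jst (axis i 1))) / 2"

definition dzbar :: "'n::finite \<Rightarrow> (complex^'n \<Rightarrow> complex) \<Rightarrow> complex^'n \<Rightarrow> complex" where
  "dzbar i f x = (frechet_derivative f (at x) (axis i 1)
                   + \<i> * frechet_derivative f (at x) (Jst (axis i 1))) / 2"

text \<open>\<open>T_up G x i j k\<close> is \<open>T_{ij}^k\<close> and \<open>T_low G x i j l\<close> is \<open>T_{ij lbar}\<close>.\<close>

definition T_up :: "(complex^'n \<Rightarrow> complex^'n^'n) \<Rightarrow> complex^'n \<Rightarrow> 'n::finite \<Rightarrow> 'n \<Rightarrow> 'n \<Rightarrow> complex" where
  "T_up G x i j k =
     (\<Sum>l\<in>UNIV. g_inv G x k l * (dz i (\<lambda>y. G y $ j $ l) x - dz j (\<lambda>y. G y $ i $ l) x))"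

definition T_low :: "(complex^'n \<Rightarrow> complex^'n^'n) \<Rightarrow> complex^'n \<Rightarrow> 'n::finite \<Rightarrow> 'n \<Rightarrow> 'n \<Rightarrow> complex" where
  "T_low G x i j l = (\<Sum>k\<in>UNIV. T_up G x i j k * G x $ k $ l)"

text \<open>\<open>chern_curv G x i j k l\<close> is \<open>\<Omega>_{i jbar k lbar}\<close>.\<close>

definition chern_curv ::
  "(complex^'n \<Rightarrow> complex^'n^'n) \<Rightarrow> complex^'n \<Rightarrow> 'n::finite \<Rightarrow> 'n \<Rightarrow> 'n \<Rightarrow> 'n \<Rightarrow> complex" where
  "chern_curv G x i j k l =
     - dz i (dzbar j (\<lambda>y. G y $ k $ l)) x
     + (\<Sum>p\<in>UNIV. \<Sum>s\<in>UNIV. g_inv G x p s * dzbar j (\<lambda>y. G y $ p $ l) x * dz i (\<lambda>y. G y $ k $ s) x)"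

definition S2 :: "(complex^'n \<Rightarrow> complex^'n^'n) \<Rightarrow> complex^'n \<Rightarrow> 'n::finite \<Rightarrow> 'n \<Rightarrow> complex" where
  "S2 G x i j = (\<Sum>m\<in>UNIV. \<Sum>n\<in>UNIV. g_inv G x m n * chern_curv G x m n i j)"

definition S4 :: "(complex^'n \<Rightarrow> complex^'n^'n) \<Rightarrow> complex^'n \<Rightarrow> 'n::finite \<Rightarrow> 'n \<Rightarrow> complex" where
  "S4 G x i j = (\<Sum>m\<in>UNIV. \<Sum>n\<in>UNIV. g_inv G x m n * chern_curv G x i n m j)"

definition Q :: "(complex^'n \<Rightarrow> complex^'n^'n) \<Rightarrow> complex^'n \<Rightarrow> 'n::finite \<Rightarrow> 'n \<Rightarrow> complex" where
  "Q G x i j = 1/2 * (\<Sum>m\<in>UNIV. \<Sum>n\<in>UNIV. \<Sum>p\<in>UNIV. \<Sum>s\<in>UNIV.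
     g_inv G x m n * g_inv G x p s * T_low G x m p j * cnj (T_low G x n s i))"

definition HCF_solution ::
  "('m, 'n::finite) chart set \<Rightarrow> real set \<Rightarrow> (real \<Rightarrow> ('m, 'n) chart \<Rightarrow> 'n local_metric) \<Rightarrow> bool" where
  "HCF_solution \<A> I g \<longleftrightarrow> smooth_metric_family \<A> I g \<and>
     (\<forall>c\<in>\<A>. \<forall>t\<in>I. \<forall>x\<in>coords c. \<forall>i j.
        ((\<lambda>s. g_comp (g s c) x $ i $ j) has_vector_derivative
           - S2 (g_comp (g t c)) x i j - Q (g_comp (g t c)) x i j) (at t within I))"

section \<open>The Chern connection\<close>

text \<open>
  A connection on the real tangent bundle is given in each chart by coefficients
  \<open>\<Gamma> c x u v\<close>, the value at \<open>x\<close> of the covariant derivative of the constant field \<open>v\<close> in the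
  direction \<open>u\<close>, with the usual inhomogeneous transformation law.
\<close>

type_synonym 'n coeffs = "complex^'n \<Rightarrow> complex^'n \<Rightarrow> complex^'n \<Rightarrow> complex^'n"

definition tm_connection ::
  "('m, 'n::finite) chart set \<Rightarrow> (('m, 'n) chart \<Rightarrow> 'n coeffs) \<Rightarrow> bool" where
  "tm_connection \<A> \<Gamma> \<longleftrightarrow>
     (\<forall>c\<in>\<A>. (\<forall>u v. smooth_on (coords c) (\<lambda>x. \<Gamma> c x u v)) \<and> (\<forall>x\<in>coords c. bilinear (\<Gamma> c x))) \<and>
     (\<forall>c\<in>\<A>. \<forall>d\<in>\<A>. \<forall>x\<in>overlap c d. \<forall>u v.
        let \<psi> = trans_map c d; D = (\<lambda>y. frechet_derivative \<psi> (at y))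
        in D x (\<Gamma> c x u v) =
             frechet_derivative (\<lambda>y. D y v) (at x) u + \<Gamma> d (\<psi> x) (D x u) (D x v))"

definition cov_deriv :: "'n::finite coeffs \<Rightarrow> 'n local_field \<Rightarrow> 'n local_field \<Rightarrow> 'n local_field" where
  "cov_deriv \<Gamma> X Y x = frechet_derivative Y (at x) (X x) + \<Gamma> x (X x) (Y x)"

definition lie_bracket :: "'n::finite local_field \<Rightarrow> 'n local_field \<Rightarrow> 'n local_field" where
  "lie_bracket X Y x = frechet_derivative Y (at x) (X x) - frechet_derivative X (at x) (Y x)"

definition torsion :: "'n::finite coeffs \<Rightarrow> 'n local_field \<Rightarrow> 'n local_field \<Rightarrow> 'n local_field" where
  "torsion \<Gamma> X Y x = cov_deriv \<Gamma> X Y x - cov_deriv \<Gamma> Y X x - lie_bracket X Y x"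

definition chern_connection ::
  "('m, 'n::finite) chart set \<Rightarrow> (('m, 'n) chart \<Rightarrow> 'n local_metric) \<Rightarrow>
     (('m, 'n) chart \<Rightarrow> 'n coeffs) \<Rightarrow> bool" where
  "chern_connection \<A> g \<Gamma> \<longleftrightarrow> tm_connection \<A> \<Gamma> \<and>
     (\<forall>c\<in>\<A>. \<forall>X Y Z. smooth_on (coords c) X \<longrightarrow> smooth_on (coords c) Y \<longrightarrow> smooth_on (coords c) Z \<longrightarrow>
        (\<forall>x\<in>coords c.
           frechet_derivative (\<lambda>y. g c y (Y y) (Z y)) (at x) (X x) =
             g c x (cov_deriv (\<Gamma> c) X Y x) (Z x) + g c x (Y x) (cov_deriv (\<Gamma> c) X Z x) \<and>
           cov_deriv (\<Gamma> c) X (\<lambda>y. Jst (Y y)) x = Jst (cov_deriv (\<Gamma> c) X Y x) \<and>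
           torsion (\<Gamma> c) X (\<lambda>y. Jst (Y y)) x = torsion (\<Gamma> c) (\<lambda>y. Jst (X y)) Y x))"

definition twisted_deriv :: "'n::finite coeffs \<Rightarrow> 'n local_field \<Rightarrow> 'n local_field \<Rightarrow> 'n local_field" where
  "twisted_deriv \<Gamma> X Y x = cov_deriv \<Gamma> X Y x - torsion \<Gamma> X Y x"

text \<open>
  For a \<open>J\<close>-linear connection: the matrix \<open>\<omega>(u)\<close> of connection forms on the (1,0) tangent bundle in
  the frame \<open>\<partial>_j\<close>, with \<open>\<nabla>_u \<partial>_j = (\<Sum>k. \<omega>(u) $ k $ j * \<partial>_k)\<close> for a real direction \<open>u\<close>.
\<close>

definition conn_matrix ::
  "('n::finite local_field \<Rightarrow> 'n local_field \<Rightarrow> 'n local_field) \<Rightarrow> complex^'n \<Rightarrow> complex^'n \<Rightarrow> complex^'n^'n" where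
  "conn_matrix nab x u = (\<chi> k j. nab (\<lambda>_. u) (\<lambda>_. axis j 1) x $ k)"

section \<open>The algebra of \<open>End \<otimes> conj End\<close>\<close>

text \<open>
  \<open>v_a^b e_b \<otimes> \<epsilon>^a\<close> in \<open>End(T^{1,0})\<close> is the matrix with entry \<open>v_a^b\<close> in row \<open>b\<close> and
  column \<open>a\<close>, acting on column vectors.  The coefficient of
  \<open>(e_k \<otimes> \<epsilon>^i) \<otimes> conj (e_l \<otimes> \<epsilon>^j)\<close> is stored at the index \<open>((k, i), (l, j))\<close>.
\<close>

type_synonym 'n tens = "complex^(('n \<times> 'n) \<times> ('n \<times> 'n))"

definition tensor_conj :: "complex^'n^'n \<Rightarrow> complex^'n^'n \<Rightarrow> 'n::finite tens" where
  "tensor_conj v w = (\<chi> a. case a of ((k, i), (l, j)) \<Rightarrow> v $ k $ i * cnj (w $ l $ j))"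

definition Sym11 :: "'n::finite tens set" where
  "Sym11 = span (range (\<lambda>w. tensor_conj w w))"

definition commutator :: "complex^'n^'n \<Rightarrow> complex^'n^'n \<Rightarrow> complex^'n^'n::finite" where
  "commutator v u = v ** u - u ** v"

text \<open>
  The map \<open>L\<close> is determined only on \<open>Sym11\<close>, so \<open>ad_sym v A\<close> is meaningful for \<open>A \<in> Sym11\<close>.
\<close>

definition ad_sym :: "complex^'n^'n \<Rightarrow> 'n::finite tens \<Rightarrow> 'n tens" where
  "ad_sym v A = (THE B. \<exists>L. linear L \<and>
     (\<forall>u. L (tensor_conj u u) = tensor_conj (commutator v u) u + tensor_conj u (commutator v u)) \<and>
     B = L A)"

text \<open>
  The Hermitian product on \<open>End(T^{1,0})\<close> induced by \<open>g\<close> at \<open>x\<close>.  An orthonormal family indexed by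
  \<open>'n \<times> 'n\<close> is automatically a basis.
\<close>

definition end_inner ::
  "(complex^'n \<Rightarrow> complex^'n^'n) \<Rightarrow> complex^'n \<Rightarrow> complex^'n^'n \<Rightarrow> complex^'n^'n::finite \<Rightarrow> complex" where
  "end_inner G x u v = (\<Sum>k\<in>UNIV. \<Sum>l\<in>UNIV. \<Sum>i\<in>UNIV. \<Sum>j\<in>UNIV.
     G x $ k $ l * g_inv G x i j * (u $ k $ i) * cnj (v $ l $ j))"

definition end_orthonormal ::
  "(complex^'n \<Rightarrow> complex^'n^'n) \<Rightarrow> complex^'n \<Rightarrow> ('n::finite \<times> 'n \<Rightarrow> complex^'n^'n) \<Rightarrow> bool" where
  "end_orthonormal G x v \<longleftrightarrow> (\<forall>a b. end_inner G x (v a) (v b) = (if a = b then 1 else 0))"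

definition square ::
  "(complex^'n \<Rightarrow> complex^'n^'n) \<Rightarrow> complex^'n \<Rightarrow> 'n::finite tens \<Rightarrow> 'n tens" where
  "square G x A = (THE B. \<exists>(v :: 'n \<times> 'n \<Rightarrow> complex^'n^'n) (r :: 'n \<times> 'n \<Rightarrow> real).
     end_orthonormal G x v \<and>
     A = (\<Sum>a\<in>UNIV. r a *\<^sub>R tensor_conj (v a) (v a)) \<and>
     B = (\<Sum>a\<in>UNIV. (r a)\<^sup>2 *\<^sub>R tensor_conj (v a) (v a)))"

definition sharp_prod :: "'n::finite tens \<Rightarrow> 'n tens \<Rightarrow> 'n tens" where
  "sharp_prod = (THE F. bilinear F \<and>
     (\<forall>v1 w1 v2 w2. F (tensor_conj v1 w1) (tensor_conj v2 w2) =
        tensor_conj (commutator v1 v2) (commutator w1 w2)))"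

definition sharp :: "'n::finite tens \<Rightarrow> 'n tens" where
  "sharp A = (1/2) *\<^sub>R sharp_prod A A"

section \<open>Covariant derivatives of tensors and the twisted Laplacian\<close>

text \<open>
  The infinitesimal action of \<open>\<omega>\<close> on \<open>End \<otimes> conj End\<close>, by which a connection with connection
  matrix \<open>\<omega>\<close> is extended to this bundle.
\<close>

definition end_act :: "complex^'n^'n \<Rightarrow> 'n::finite tens \<Rightarrow> 'n tens" where
  "end_act \<omega> A = (\<chi> a. case a of ((k, i), (l, j)) \<Rightarrow>
     (\<Sum>q\<in>UNIV. \<omega> $ k $ q * A $ ((q, i), (l, j)) - \<omega> $ q $ i * A $ ((k, q), (l, j))
        + cnj (\<omega> $ l $ q) * A $ ((k, i), (q, j)) - cnj (\<omega> $ q $ j) * A $ ((k, i), (l, q))))"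

definition tens_deriv ::
  "('n::finite local_field \<Rightarrow> 'n local_field \<Rightarrow> 'n local_field) \<Rightarrow> 'n local_field \<Rightarrow>
     (complex^'n \<Rightarrow> 'n tens) \<Rightarrow> complex^'n \<Rightarrow> 'n tens" where
  "tens_deriv nab X A x =
     frechet_derivative A (at x) (X x) + end_act (conn_matrix nab x (X x)) (A x)"

text \<open>
  The derivatives in the directions of the complex vector field \<open>e = (E - \<i> J E) / 2\<close> of
  type (1,0) and of its conjugate.
\<close>

definition tens_deriv10 ::
  "('n::finite local_field \<Rightarrow> 'n local_field \<Rightarrow> 'n local_field) \<Rightarrow> 'n local_field \<Rightarrow>
     (complex^'n \<Rightarrow> 'n tens) \<Rightarrow> complex^'n \<Rightarrow> 'n tens" where
  "tens_deriv10 nab E A x =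
     (1/2) *s (tens_deriv nab E A x - \<i> *s tens_deriv nab (\<lambda>y. Jst (E y)) A x)"

definition tens_deriv01 ::
  "('n::finite local_field \<Rightarrow> 'n local_field \<Rightarrow> 'n local_field) \<Rightarrow> 'n local_field \<Rightarrow>
     (complex^'n \<Rightarrow> 'n tens) \<Rightarrow> complex^'n \<Rightarrow> 'n tens" where
  "tens_deriv01 nab E A x =
     (1/2) *s (tens_deriv nab E A x + \<i> *s tens_deriv nab (\<lambda>y. Jst (E y)) A x)"

definition holo_unitary_frame ::
  "(complex^'n \<Rightarrow> complex^'n^'n) \<Rightarrow> complex^'n \<Rightarrow> ('n::finite \<Rightarrow> 'n local_field) \<Rightarrow> bool" where
  "holo_unitary_frame G x e \<longleftrightarrow>
     (\<exists>V. open V \<and> x \<in> V \<and> (\<forall>i. holo_on V (e i))) \<and>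
     (\<forall>i j. (\<Sum>k\<in>UNIV. \<Sum>l\<in>UNIV. G x $ k $ l * (e i x $ k) * cnj (e j x $ l)) = (if i = j then 1 else 0))"

text \<open>The value does not depend on the choice of the frame.\<close>

definition twisted_laplacian ::
  "(complex^'n \<Rightarrow> complex^'n^'n) \<Rightarrow> 'n::finite coeffs \<Rightarrow> (complex^'n \<Rightarrow> 'n tens) \<Rightarrow> complex^'n \<Rightarrow> 'n tens" where
  "twisted_laplacian G \<Gamma> A x = (THE B. \<exists>e. holo_unitary_frame G x e \<and>
     (let nab = twisted_deriv \<Gamma> in
      B = (1/2) *s (\<Sum>i\<in>UNIV. tens_deriv10 nab (e i) (tens_deriv01 nab (e i) A) x
                             + tens_deriv01 nab (e i) (tens_deriv10 nab (e i) A) x)))"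

text \<open>\<open>nabla_T G \<Gamma> x i m p k\<close> is \<open>\<nabla>_i T_{mp}^k\<close> for the Chern connection.\<close>

definition nabla_T_real ::
  "(complex^'n \<Rightarrow> complex^'n^'n) \<Rightarrow> 'n::finite coeffs \<Rightarrow> complex^'n \<Rightarrow> complex^'n \<Rightarrow> 'n \<Rightarrow> 'n \<Rightarrow> 'n \<Rightarrow> complex" where
  "nabla_T_real G \<Gamma> x u m p k =
     (let \<omega> = conn_matrix (cov_deriv \<Gamma>) x u in
      frechet_derivative (\<lambda>y. T_up G y m p k) (at x) u
      + (\<Sum>q\<in>UNIV. \<omega> $ k $ q * T_up G x m p q - \<omega> $ q $ m * T_up G x q p k - \<omega> $ q $ p * T_up G x m q k))"

definition nabla_T ::
  "(complex^'n \<Rightarrow> complex^'n^'n) \<Rightarrow> 'n::finite coeffs \<Rightarrow> complex^'n \<Rightarrow> 'n \<Rightarrow> 'n \<Rightarrow> 'n \<Rightarrow> 'n \<Rightarrow> complex" where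
  "nabla_T G \<Gamma> x i m p k =
     (nabla_T_real G \<Gamma> x (axis i 1) m p k - \<i> * nabla_T_real G \<Gamma> x (Jst (axis i 1)) m p k) / 2"

section \<open>The terms of the evolution equation\<close>

definition Omega :: "(complex^'n \<Rightarrow> complex^'n^'n) \<Rightarrow> complex^'n \<Rightarrow> 'n::finite tens" where
  "Omega G x = (\<chi> a. case a of ((k, i), (l, j)) \<Rightarrow>
     (\<Sum>m\<in>UNIV. \<Sum>n\<in>UNIV. chern_curv G x i j m n * g_inv G x m l * g_inv G x k n))"

text \<open>\<open>\<nabla>_{jbar} T_{nbar sbar}^{lbar}\<close> is the complex conjugate of \<open>\<nabla>_j T_{ns}^l\<close>.\<close>

definition D_nabla_T ::
  "(complex^'n \<Rightarrow> complex^'n^'n) \<Rightarrow> 'n::finite coeffs \<Rightarrow> complex^'n \<Rightarrow> 'n tens" where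
  "D_nabla_T G \<Gamma> x = (\<chi> a. case a of ((k, i), (l, j)) \<Rightarrow>
     1/2 * (\<Sum>m\<in>UNIV. \<Sum>n\<in>UNIV. \<Sum>p\<in>UNIV. \<Sum>s\<in>UNIV.
       g_inv G x m n * g_inv G x p s * nabla_T G \<Gamma> x i m p k * cnj (nabla_T G \<Gamma> x j n s l)))"

definition v_end :: "(complex^'n \<Rightarrow> complex^'n^'n) \<Rightarrow> complex^'n \<Rightarrow> complex^'n^'n::finite" where
  "v_end G x = (\<chi> b a. 1/2 * (\<Sum>s\<in>UNIV. S4 G x a s * g_inv G x b s))"

end

theory Submission
  imports Defs
begin

text \<open>
  Let \<open>h = g^{-1}\<close>.  Differentiating \<open>\<Omega> = \<partial>_i \<partial>_{jbar} h - \<partial>_i h g \<partial>_{jbar} h\<close> in time gives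
  \<open>\<partial>_t \<Omega>_{i jbar} = D_i D_{jbar} F + \<Omega>_{i jbar} g F\<close> with \<open>F = \<partial>_t h = S^{(2)} + Q\<close> (indices raised), where
  \<open>D\<close> is the Chern connection in the values \<open>k\<close>, \<open>lbar\<close> while the form indices \<open>i\<close>, \<open>jbar\<close> are kept as labels in
  holomorphic coordinates.  For this \<open>D\<close> the second Bianchi identity is torsion free,
  \<open>D_m \<Omega>_{i jbar} = D_i \<Omega>_{m jbar}\<close>.  Hence \<open>D_i D_{jbar} S^{(2)}\<close> equals \<open>h^{m nbar} D_{nbar} D_m \<Omega>_{i jbar}\<close> up to
  quadratic terms in \<open>\<Omega>\<close> and first order terms containing the Christoffel symbols, and the choice of \<open>Q\<close>
  contributes exactly the terms which turn \<open>D\<close> into the torsion-twisted connection, together with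
  \<open>D(\<nabla>T)\<close> and the second half of \<open>\<Omega>^#\<close>.  The terms of order zero that remain are \<open>ad_v \<Omega>\<close>.
\<close>

text \<open>Why the twisted connection appears: the contraction of m, nbar with \<open>h\<close> is
  not parallel for a derivative that treats lower indices as labels. Differentiating
  \<open>h m n\<close> in direction i produces \<open>B i m p\<close>, and for the label i in
  direction m this is the order of lower indices of the twisted connection, not of the Chern
  connection. The torsion terms on the upper indices come from Q through both Bianchi identities.
  Why v carries a factor 1/2: each order of the two traced twisted derivatives differs from the
  common expression by a trace of \<Omega>, acting on the unbarred indices for one order and on the
  barred ones for the other; the Laplacian takes the mean. The computation needs only the Leibniz
  rule, commuting derivations and the inverse relation. It is therefore made in an abstract algebra,
  where time is one more derivation and barred identities are duals of unbarred ones. Analysis has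
  to show that smooth functions on \<open>I \<times> U\<close> form such an algebra, also at the
  endpoints of \<open>I\<close>.\<close>

abbreviation sum_UNIV :: "('i \<Rightarrow> 'c::comm_monoid_add) \<Rightarrow> 'c" (binder "\<Oplus>" 10) where
  "sum_UNIV f \<equiv> sum f UNIV"

section \<open>The evolution equation in a ring of functions with commuting derivations\<close>

locale derivation_algebra =
  fixes sm :: "('s \<Rightarrow> complex) \<Rightarrow> bool"
    and der :: "'v \<Rightarrow> ('s \<Rightarrow> complex) \<Rightarrow> 's \<Rightarrow> complex"
  assumes sm_const [simp]: "sm (\<lambda>_. c)"
    and sm_add [simp]: "sm f \<Longrightarrow> sm f' \<Longrightarrow> sm (\<lambda>x. f x + f' x)"
    and sm_mult [simp]: "sm f \<Longrightarrow> sm f' \<Longrightarrow> sm (\<lambda>x. f x * f' x)"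
    and sm_der [simp]: "sm f \<Longrightarrow> sm (der v f)"
    and der_const [simp]: "der v (\<lambda>_. c) x = 0"
    and der_add [simp]: "sm f \<Longrightarrow> sm f' \<Longrightarrow> der v (\<lambda>x. f x + f' x) x = der v f x + der v f' x"
    and der_mult [simp]:
      "sm f \<Longrightarrow> sm f' \<Longrightarrow> der v (\<lambda>x. f x * f' x) x = der v f x * f' x + f x * der v f' x"
    and der_comm: "sm f \<Longrightarrow> der v (der w f) = der w (der v f)"
begin

lemma sm_uminus [simp]: "sm f \<Longrightarrow> sm (\<lambda>x. - f x)"
  using sm_mult[of "\<lambda>_. -1" f] by simp

lemma sm_divide_const [simp]: "sm f \<Longrightarrow> sm (\<lambda>x. f x / c)"
  using sm_mult[of f "\<lambda>_. inverse c"] by (simp add: divide_inverse)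

lemma sm_diff [simp]: "sm f \<Longrightarrow> sm f' \<Longrightarrow> sm (\<lambda>x. f x - f' x)"
  using sm_add[of f "\<lambda>x. - f' x"] by simp

lemma sm_sum [simp]: "(\<And>i. i \<in> A \<Longrightarrow> sm (f i)) \<Longrightarrow> sm (\<lambda>x. \<Sum>i\<in>A. f i x)"
  by (induction A rule: infinite_finite_induct) auto

lemma der_uminus [simp]: "sm f \<Longrightarrow> der v (\<lambda>x. - f x) x = - der v f x"
  using der_mult[of "\<lambda>_. -1" f] by simp

lemma der_diff [simp]:
  "sm f \<Longrightarrow> sm f' \<Longrightarrow> der v (\<lambda>x. f x - f' x) x = der v f x - der v f' x"
  using der_add[of f "\<lambda>x. - f' x"] by simp

lemma der_sum [simp]:
  "(\<And>i. i \<in> A \<Longrightarrow> sm (f i)) \<Longrightarrow> der v (\<lambda>x. \<Sum>i\<in>A. f i x) x = (\<Sum>i\<in>A. der v (f i) x)"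
  by (induction A rule: infinite_finite_induct) auto

end

text \<open>
  \<open>h k l\<close> stands for \<open>g^{k lbar}\<close>, and \<open>a i\<close>, \<open>b i\<close> for the directions \<open>\<partial>_i\<close>, \<open>\<partial>_{ibar}\<close>.  No conjugation
  occurs: \<open>h\<close> need not be Hermitian, and complex conjugation is replaced by the duality that transposes
  \<open>h\<close> and swaps \<open>a\<close> with \<open>b\<close>.  Then \<open>B m p k = - \<Gamma>_{mp}^k\<close> and \<open>Om i j k l = \<Omega>_{i jbar}^{lbar k}\<close>.
  The derivative \<open>D m\<close> is the Chern derivative in the upper indices only, the lower indices of its argument
  being mere labels; \<open>N m\<close> is the torsion-twisted derivative, in all four indices.
  A final \<open>b\<close> in a name marks the conjugate counterpart.
\<close>

locale inverse_metric = derivation_algebra sm der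
  for sm :: "('s \<Rightarrow> complex) \<Rightarrow> bool"
    and der :: "'v \<Rightarrow> ('s \<Rightarrow> complex) \<Rightarrow> 's \<Rightarrow> complex" +
  fixes a b :: "'n::finite \<Rightarrow> 'v" and h g :: "'n \<Rightarrow> 'n \<Rightarrow> 's \<Rightarrow> complex"
  assumes sm_h [simp]: "sm (h k l)" and sm_g [simp]: "sm (g k l)"
    and hg: "(\<Oplus>q. h k q x * g p q x) = (if k = p then 1 else 0)"
    and gh: "(\<Oplus>p. h p l x * g p q x) = (if l = q then 1 else 0)"
begin

lemma hg_contract: "(\<Oplus>p. (\<Oplus>q. f q * g p q x) * h p l x) = f l"
proof -
  have "(\<Oplus>p. (\<Oplus>q. f q * g p q x) * h p l x)
      = (\<Oplus>q. f q * (\<Oplus>p. h p l x * g p q x))"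
    by (simp add: sum_distrib_left sum_distrib_right mult_ac) (rule sum.swap)
  then show ?thesis by (simp add: gh if_distrib cong: if_cong)
qed

section \<open>The Chern connection expressed through the inverse metric\<close>

definition B :: "'n \<Rightarrow> 'n \<Rightarrow> 'n \<Rightarrow> 's \<Rightarrow> complex" where
  "B m p k = (\<lambda>x. \<Oplus>q. der (a m) (h k q) x * g p q x)"

definition Om :: "'n \<Rightarrow> 'n \<Rightarrow> 'n \<Rightarrow> 'n \<Rightarrow> 's \<Rightarrow> complex" where
  "Om i j k l = (\<lambda>x. der (a i) (der (b j) (h k l)) x - (\<Oplus>p. B i p k x * der (b j) (h p l) x))"

definition T :: "'n \<Rightarrow> 'n \<Rightarrow> 'n \<Rightarrow> 's \<Rightarrow> complex" where
  "T m p k = (\<lambda>x. B p m k x - B m p k x)"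

definition D :: "'n \<Rightarrow> ('n \<Rightarrow> 'n \<Rightarrow> 's \<Rightarrow> complex) \<Rightarrow> 'n \<Rightarrow> 'n \<Rightarrow> 's \<Rightarrow> complex" where
  "D m X k l = (\<lambda>x. der (a m) (X k l) x - (\<Oplus>p. B m p k x * X p l x))"

text \<open>Twisting swaps the lower indices of the Christoffel symbols, hence
  \<open>B p m k\<close> and \<open>B i m p\<close> where the Chern connection would have
  \<open>B m p k\<close> and \<open>B m i p\<close>. The indices j and l contribute nothing: on the
  conjugate bundle the connection acts by the conjugate matrix, whose (1,0) part vanishes.\<close>

definition N :: "'n \<Rightarrow> ('n \<Rightarrow> 'n \<Rightarrow> 'n \<Rightarrow> 'n \<Rightarrow> 's \<Rightarrow> complex) \<Rightarrow> 'n \<Rightarrow> 'n \<Rightarrow> 'n \<Rightarrow> 'n \<Rightarrow> 's \<Rightarrow> complex" where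
  "N m X i j k l = (\<lambda>x. der (a m) (X i j k l) x
     + (\<Oplus>p. - B p m k x * X i j p l x + B i m p x * X p j k l x))"

lemma sm_B [simp]: "sm (B m p k)" by (simp add: B_def)
lemma sm_Om [simp]: "sm (Om i j k l)" by (simp add: Om_def)
lemma sm_T [simp]: "sm (T m p k)" by (simp add: T_def)
lemma sm_D [simp]: "(\<And>k l. sm (X k l)) \<Longrightarrow> sm (D m X k l)" by (simp add: D_def)
lemma sm_N [simp]: "(\<And>i j k l. sm (X i j k l)) \<Longrightarrow> sm (N m X i j k l)" by (simp add: N_def)

lemma der_h: "der (a m) (h k l) x = (\<Oplus>p. B m p k x * h p l x)"
  by (simp add: B_def hg_contract)

text \<open>Differentiate \<open>hg\<close> and contract with \<open>g\<close>. The direction is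
  arbitrary because the variation of the curvature needs the time direction too.\<close>

lemma der_g_general: "der v (g p q) x = - (\<Oplus>c. (\<Oplus>e. der v (h c e) x * g p e x) * g c q x)"
proof -
  have *: "(\<Oplus>e. der v (h c e) x * g p e x) = - (\<Oplus>e. h c e x * der v (g p e) x)" for c
  proof -
    have "der v (\<lambda>x. \<Oplus>e. h c e x * g p e x) x = 0"
      by (subst hg) simp
    then show ?thesis by (simp add: sum.distrib eq_neg_iff_add_eq_0)
  qed
  have "(\<Oplus>c. (\<Oplus>e. der v (g p e) x * h c e x) * g c q x)
      = (\<Oplus>e. der v (g p e) x * (\<Oplus>c. h c e x * g c q x))"
    by (simp add: sum_distrib_left sum_distrib_right mult_ac) (rule sum.swap)
  also have "\<dots> = der v (g p q) x"
    by (simp add: gh if_distrib cong: if_cong)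
  finally show ?thesis unfolding * by (simp add: sum_negf mult.commute)
qed

lemma der_g: "der (a m) (g p q) x = - (\<Oplus>c. B m p c x * g c q x)"
  by (simp add: der_g_general B_def)

lemma der_B: "der (a m) (B i p k) x
    = (\<Oplus>q. der (a m) (der (a i) (h k q)) x * g p q x) - (\<Oplus>c. B i c k x * B m p c x)"
proof -
  have "(\<Oplus>q. der (a i) (h k q) x * (\<Oplus>c. B m p c x * g c q x))
      = (\<Oplus>c. B i c k x * B m p c x)"
    by (simp add: B_def[of i] sum_distrib_left sum_distrib_right mult_ac) (rule sum.swap)
  then show ?thesis
    by (simp add: B_def[of i] der_g sum.distrib sum_subtractf)
qed

text \<open>This is the vanishing of the (2,0) part of the Chern curvature: the only second
  derivatives in \<open>der_B\<close> are those of \<open>h\<close>, and they commute.\<close>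

lemma der_B_sym: "der (a m) (B i p k) x + (\<Oplus>c. B i c k x * B m p c x)
    = der (a i) (B m p k) x + (\<Oplus>c. B m c k x * B i p c x)"
  by (simp add: der_B der_comm[of _ "a m" "a i"])


section \<open>Conjugate counterparts\<close>

definition Bb :: "'n \<Rightarrow> 'n \<Rightarrow> 'n \<Rightarrow> 's \<Rightarrow> complex" where
  "Bb n q l = (\<lambda>x. \<Oplus>p. der (b n) (h p l) x * g p q x)"

definition Tb :: "'n \<Rightarrow> 'n \<Rightarrow> 'n \<Rightarrow> 's \<Rightarrow> complex" where
  "Tb n s l = (\<lambda>x. Bb s n l x - Bb n s l x)"

definition nabla :: "'n \<Rightarrow> ('n \<Rightarrow> 'n \<Rightarrow> 'n \<Rightarrow> 's \<Rightarrow> complex) \<Rightarrow> 'n \<Rightarrow> 'n \<Rightarrow> 'n \<Rightarrow> 's \<Rightarrow> complex" where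
  "nabla i Y m p k = (\<lambda>x. der (a i) (Y m p k) x + (\<Oplus>q. - B i q k x * Y m p q x
     + B i m q x * Y q p k x + B i p q x * Y m q k x))"

definition nablab :: "'n \<Rightarrow> ('n \<Rightarrow> 'n \<Rightarrow> 'n \<Rightarrow> 's \<Rightarrow> complex) \<Rightarrow> 'n \<Rightarrow> 'n \<Rightarrow> 'n \<Rightarrow> 's \<Rightarrow> complex" where
  "nablab j Y n s l = (\<lambda>x. der (b j) (Y n s l) x + (\<Oplus>q. - Bb j q l x * Y n s q x
     + Bb j n q x * Y q s l x + Bb j s q x * Y n q l x))"

definition Db :: "'n \<Rightarrow> ('n \<Rightarrow> 'n \<Rightarrow> 's \<Rightarrow> complex) \<Rightarrow> 'n \<Rightarrow> 'n \<Rightarrow> 's \<Rightarrow> complex" where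
  "Db n X k l = (\<lambda>x. der (b n) (X k l) x - (\<Oplus>q. Bb n q l x * X k q x))"

definition Nb :: "'n \<Rightarrow> ('n \<Rightarrow> 'n \<Rightarrow> 'n \<Rightarrow> 'n \<Rightarrow> 's \<Rightarrow> complex) \<Rightarrow> 'n \<Rightarrow> 'n \<Rightarrow> 'n \<Rightarrow> 'n \<Rightarrow> 's \<Rightarrow> complex" where
  "Nb n X i j k l = (\<lambda>x. der (b n) (X i j k l) x
     + (\<Oplus>q. - Bb q n l x * X i j k q x + Bb j n q x * X i q k l x))"

text \<open>The curvature as an endomorphism of the holomorphic tangent space; \<open>Rb\<close> is
  the same for its conjugate. In this shape it is the mixed derivative of the connection
  coefficients and acts in commutators.\<close>

definition R :: "'n \<Rightarrow> 'n \<Rightarrow> 'n \<Rightarrow> 'n \<Rightarrow> 's \<Rightarrow> complex" where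
  "R i j k p = (\<lambda>x. \<Oplus>q. Om i j k q x * g p q x)"

definition Rb :: "'n \<Rightarrow> 'n \<Rightarrow> 'n \<Rightarrow> 'n \<Rightarrow> 's \<Rightarrow> complex" where
  "Rb i j l q = (\<lambda>x. \<Oplus>p. Om i j p l x * g p q x)"

lemma sm_Bb [simp]: "sm (Bb n q l)" by (simp add: Bb_def)
lemma sm_Tb [simp]: "sm (Tb n s l)" by (simp add: Tb_def)
lemma sm_R [simp]: "sm (R i j k p)" by (simp add: R_def)
lemma sm_Rb [simp]: "sm (Rb i j k p)" by (simp add: Rb_def)
lemma sm_Db [simp]: "(\<And>k l. sm (X k l)) \<Longrightarrow> sm (Db m X k l)" by (simp add: Db_def)
lemma sm_Nb [simp]: "(\<And>i j k l. sm (X i j k l)) \<Longrightarrow> sm (Nb m X i j k l)" by (simp add: Nb_def)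
lemma sm_nabla [simp]: "(\<And>m p k. sm (Y m p k)) \<Longrightarrow> sm (nabla i Y m p k)" by (simp add: nabla_def)
lemma sm_nablab [simp]: "(\<And>m p k. sm (Y m p k)) \<Longrightarrow> sm (nablab i Y m p k)" by (simp add: nablab_def)

text \<open>Both forms of the correction term are the product of \<partial>_i \<open>h\<close>,
  \<open>g\<close> and \<partial>_jbar \<open>h\<close>, bracketed differently. Hence
  \<open>Om\<close> is its own dual.\<close>

lemma Om_alt: "Om i j k l x = der (b j) (der (a i) (h k l)) x - (\<Oplus>q. Bb j q l x * der (a i) (h k q) x)"
proof -
  have "(\<Oplus>p. B i p k x * der (b j) (h p l) x) = (\<Oplus>q. Bb j q l x * der (a i) (h k q) x)"
    by (simp add: B_def Bb_def sum_distrib_left sum_distrib_right mult_ac) (rule sum.swap)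
  then show ?thesis by (simp add: Om_def der_comm[of _ "a i" "b j"])
qed

lemma inverse_metric_dual: "inverse_metric sm der (\<lambda>k l. h l k) (\<lambda>k l. g l k)"
  by unfold_locales (use gh hg in \<open>simp_all add: mult.commute eq_commute\<close>)

end

section \<open>Duality, Bianchi identities and the variation of the curvature\<close>

context inverse_metric
begin

interpretation dual: inverse_metric sm der b a "\<lambda>k l. h l k" "\<lambda>k l. g l k"
  by (rule inverse_metric_dual)

lemma dual_B: "dual.B = Bb" by (intro ext) (simp add: dual.B_def Bb_def)
lemma dual_Bb: "dual.Bb = B" by (intro ext) (simp add: dual.Bb_def B_def)
lemma dual_T: "dual.T = Tb" by (intro ext) (simp add: dual.T_def Tb_def dual_B)
lemma dual_Tb: "dual.Tb = T" by (intro ext) (simp add: dual.Tb_def T_def dual_Bb)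
lemma dual_Om: "dual.Om j i l k = Om i j k l"
  by (intro ext) (simp add: Om_alt dual.Om_def dual_B)
lemma dual_D: "dual.D n X l k = Db n (\<lambda>k l. X l k) k l"
  by (intro ext) (simp add: dual.D_def dual_B Db_def)
lemma dual_Db: "dual.Db n X l k = D n (\<lambda>k l. X l k) k l"
  by (intro ext) (simp add: dual.Db_def dual_Bb D_def)
lemma dual_N: "dual.N n X j i l k = Nb n (\<lambda>i j k l. X j i l k) i j k l"
  by (intro ext) (simp add: dual.N_def dual_B Nb_def)
lemma dual_Nb: "dual.Nb n X j i l k = N n (\<lambda>i j k l. X j i l k) i j k l"
  by (intro ext) (simp add: dual.Nb_def dual_Bb N_def)
lemma dual_nabla: "dual.nabla = nablab"
  by (intro ext) (simp add: dual.nabla_def dual_B nablab_def)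
lemma dual_nablab: "dual.nablab = nabla"
  by (intro ext) (simp add: dual.nablab_def dual_Bb nabla_def)
lemma dual_R: "dual.R j i l q = Rb i j l q"
  by (intro ext) (simp add: dual.R_def Rb_def dual_Om)
lemma dual_Rb: "dual.Rb j i l q = R i j l q"
  by (intro ext) (simp add: dual.Rb_def R_def dual_Om)

text \<open>Rewriting with these turns a fact about the dual metric into the conjugate fact in the
  original notation.\<close>

lemmas dual_simps = dual_B dual_Bb dual_T dual_Tb dual_Om dual_D dual_Db dual_N dual_Nb
  dual_nabla dual_nablab dual_R dual_Rb

lemma derb_h: "der (b n) (h k l) x = (\<Oplus>q. Bb n q l x * h k q x)"
  using dual.der_h[of n k l x] unfolding dual_simps .

lemma derb_g: "der (b n) (g p q) x = - (\<Oplus>c. Bb n q c x * g p c x)"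
  using dual.der_g[of n p q x] unfolding dual_simps .

text \<open>The (1,1) curvature is dbar of the connection form; there is no sign because
  \<open>B\<close> is minus the Christoffel symbol. As an equation of functions it can be used under
  further derivatives.\<close>

lemma derb_B: "der (b j) (B m p k) = R m j k p"
proof
  fix x
  have "(\<Oplus>q. der (a m) (h k q) x * (\<Oplus>c. Bb j q c x * g p c x))
    = (\<Oplus>q. (\<Oplus>c. Bb j c q x * der (a m) (h k c) x) * g p q x)"
    by (simp add: sum_distrib_left sum_distrib_right mult_ac) (rule sum.swap)
  then show "der (b j) (B m p k) x = R m j k p x"
    by (simp add: B_def R_def Om_alt derb_g sum_subtractf algebra_simps)
qed

lemma der_Bb: "der (a i) (Bb n q l) = Rb i n l q"
  using inverse_metric.derb_B[OF inverse_metric_dual, where a=b and b=a and j=i and m=n and p=q and k=l]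
  unfolding dual_simps .

text \<open>The first Bianchi identity of the Chern connection.\<close>

lemma derb_T: "der (b j) (T m p k) x = R p j k m x - R m j k p x"
  by (simp add: T_def derb_B)

lemma der_Tb: "der (a i) (Tb n s l) x = Rb i s l n x - Rb i n l s x"
  by (simp add: Tb_def der_Bb)

text \<open>The second Bianchi identity. \<open>Om i j\<close> is \<open>D i\<close> applied to
  \<partial>_jbar \<open>h\<close>, and \<open>D m\<close> commutes with \<open>D i\<close> because
  the (2,0) curvature vanishes. No torsion arises since i and m are only labels.\<close>

lemma D_Om: "D m (Om i j) k l = D i (Om m j) k l"
proof
  fix x
  \<comment> \<open>Once derivatives commute, only the last sum is not visibly symmetric in m and i;
    its bracket is symmetric by \<open>der_B_sym\<close>.\<close>
  have e: "D m (Om i j) k l x = der (a m) (der (a i) (der (b j) (h k l))) x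
     - (\<Oplus>p. B i p k x * der (a m) (der (b j) (h p l)) x + B m p k x * der (a i) (der (b j) (h p l)) x)
     - (\<Oplus>p. (der (a m) (B i p k) x - (\<Oplus>c. B m c k x * B i p c x)) * der (b j) (h p l) x)" for m i
  proof -
    have "(\<Oplus>p c. B m p k x * (B i c p x * der (b j) (h c l) x)) 
       = (\<Oplus>p c. B m c k x * (B i p c x * der (b j) (h p l) x))"
      by (rule sum.swap)
    then show ?thesis
      by (simp add: D_def Om_def sum.distrib sum_subtractf sum_distrib_left sum_distrib_right algebra_simps)
  qed
  have "der (a m) (B i p k) x - (\<Oplus>c. B m c k x * B i p c x)
     = der (a i) (B m p k) x - (\<Oplus>c. B i c k x * B m p c x)" for p
    using der_B_sym[of m i p k x] by (simp add: algebra_simps)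
  then show "D m (Om i j) k l x = D i (Om m j) k l x"
    unfolding e[of m i] e[of i m] by (simp add: der_comm[of _ "a m" "a i"] add.commute)
qed

lemma Db_Om: "Db n (Om i j) k l = Db j (Om i n) k l"
  using inverse_metric.D_Om[OF inverse_metric_dual, where a=b and b=a and i=j and m=n and j=i and k=l and l=k]
  unfolding dual_simps .

text \<open>The Ricci identity for the upper indices alone: one curvature term for k, one for l,
  none for labels.\<close>

lemma D_Db:
  assumes [simp]: "\<And>k l. sm (X k l)"
  shows "D m (Db n X) k l x = Db n (D m X) k l x
    + (\<Oplus>p. R m n k p x * X p l x) - (\<Oplus>q. Rb m n l q x * X k q x)"
proof -
  have "(\<Oplus>p q. B m p k x * (Bb n q l x * X p q x))
    = (\<Oplus>q p. B m p k x * (Bb n q l x * X p q x))"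
    by (rule sum.swap)
  then show ?thesis
    by (simp add: D_def Db_def derb_B der_Bb der_comm[of _ "a m" "b n"]
        sum.distrib sum_subtractf sum_distrib_left sum_distrib_right algebra_simps)
qed

text \<open>Holds for every direction, independently of the flow. \<open>D i\<close> also
  differentiates the coefficient \<open>Bb\<close> inside \<open>Db j F\<close>, which has no
  counterpart in the derivative of \<open>Om\<close>; the term with \<open>Rb\<close> compensates
  this.\<close>

lemma der_Om:
  assumes [simp]: "\<And>k l. sm (F k l)" and F: "\<And>k l. der v (h k l) = F k l"
  shows "der v (Om i j k l) x = D i (Db j F) k l x + (\<Oplus>q. Rb i j l q x * F k q x)"
proof -
  have B: "der v (B i p k) x = (\<Oplus>q. der (a i) (F k q) x * g p q x)
      - (\<Oplus>c. B i c k x * (\<Oplus>e. F c e x * g p e x))" for p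
  proof -
    have "(\<Oplus>q. der (a i) (h k q) x * (\<Oplus>c. f c * g c q x))
       = (\<Oplus>c. (\<Oplus>q. der (a i) (h k q) x * g c q x) * f c)" for f
      by (simp add: sum_distrib_left sum_distrib_right mult_ac) (rule sum.swap)
    then show ?thesis
      by (simp add: B_def der_comm[of _ v "a i"] F der_g_general sum_subtractf)
  qed
  have 1: "(\<Oplus>p. (\<Oplus>q. f q * g p q x) * der (b j) (h p l) x) = (\<Oplus>q. Bb j q l x * f q)" for f
    by (simp add: Bb_def sum_distrib_left sum_distrib_right mult_ac) (rule sum.swap)
  have 2: "(\<Oplus>p. (\<Oplus>c. B i c k x * (\<Oplus>e. F c e x * g p e x)) * der (b j) (h p l) x)
     = (\<Oplus>c. B i c k x * (\<Oplus>q. Bb j q l x * F c q x))"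
  proof -
    have "(\<Oplus>p. (\<Oplus>c. B i c k x * f c p) * der (b j) (h p l) x)
      = (\<Oplus>c. B i c k x * (\<Oplus>p. f c p * der (b j) (h p l) x))" for f
      by (simp add: sum_distrib_left sum_distrib_right mult_ac) (rule sum.swap)
    then show ?thesis by (simp add: 1)
  qed
  have "der v (Om i j k l) x = der (a i) (der (b j) (F k l)) x
     - (\<Oplus>q. Bb j q l x * der (a i) (F k q) x)
     + (\<Oplus>c. B i c k x * (\<Oplus>q. Bb j q l x * F c q x))
     - (\<Oplus>p. B i p k x * der (b j) (F p l) x)"
    by (simp add: Om_def der_comm[of _ v "a i"] der_comm[of _ v "b j"] F B left_diff_distrib sum_subtractf sum.distrib 1 2)
  then show ?thesis
    by (simp add: D_def Db_def der_Bb sum.distrib sum_subtractf right_diff_distrib left_diff_distrib algebra_simps)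
qed


section \<open>The velocity of the inverse metric and its second covariant derivatives\<close>

definition S2_up :: "'n \<Rightarrow> 'n \<Rightarrow> 's \<Rightarrow> complex" where
  "S2_up k l = (\<lambda>x. \<Oplus>m n. h m n x * Om m n k l x)"

definition Q_up :: "'n \<Rightarrow> 'n \<Rightarrow> 's \<Rightarrow> complex" where
  "Q_up k l = (\<lambda>x. 1/2 * (\<Oplus>m p n s. h m n x * h p s x * T m p k x * Tb n s l x))"

lemma sm_S2_up [simp]: "sm (S2_up k l)" by (simp add: S2_up_def)
lemma sm_Q_up [simp]: "sm (Q_up k l)" by (simp add: Q_up_def)

lemma D_sum: "(\<And>c k l. sm (X c k l)) \<Longrightarrow>
    D i (\<lambda>k l x. \<Sum>c\<in>A. X c k l x) k l x = (\<Sum>c\<in>A. D i (X c) k l x)"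
  using sum.swap[of "\<lambda>p c. B i p k x * X c p l x" A UNIV]
  by (simp add: D_def sum_distrib_left sum_subtractf)

lemma D_mult: "sm f \<Longrightarrow> (\<And>k l. sm (X k l)) \<Longrightarrow>
    D i (\<lambda>k l x. f x * X k l x) k l x = der (a i) f x * X k l x + f x * D i X k l x"
  by (simp add: D_def sum_distrib_left algebra_simps)

lemma D_add: "(\<And>k l. sm (X k l)) \<Longrightarrow> (\<And>k l. sm (Y k l)) \<Longrightarrow>
    D i (\<lambda>k l x. X k l x + Y k l x) k l x = D i X k l x + D i Y k l x"
  by (simp add: D_def sum.distrib algebra_simps)

lemma Db_sum: "(\<And>c k l. sm (X c k l)) \<Longrightarrow>
    Db i (\<lambda>k l x. \<Sum>c\<in>A. X c k l x) k l x = (\<Sum>c\<in>A. Db i (X c) k l x)"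
  using sum.swap[of "\<lambda>p c. Bb i p l x * X c k p x" A UNIV]
  by (simp add: Db_def sum_distrib_left sum_subtractf)

lemma Db_mult: "sm f \<Longrightarrow> (\<And>k l. sm (X k l)) \<Longrightarrow>
    Db i (\<lambda>k l x. f x * X k l x) k l x = der (b i) f x * X k l x + f x * Db i X k l x"
  by (simp add: Db_def sum_distrib_left algebra_simps)

lemma Db_add: "(\<And>k l. sm (X k l)) \<Longrightarrow> (\<And>k l. sm (Y k l)) \<Longrightarrow>
    Db i (\<lambda>k l x. X k l x + Y k l x) k l x = Db i X k l x + Db i Y k l x"
  by (simp add: Db_def sum.distrib algebra_simps)

text \<open>The Bianchi identity hands the derivative from j to the summation index n, the first
  half of building a Laplacian. The derivative of \<open>h\<close> survives because m and n are
  labels for \<open>Db\<close>.\<close>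

lemma Db_S2: "Db j S2_up = (\<lambda>k l x. \<Oplus>m n. der (b j) (h m n) x * Om m n k l x + h m n x * Db n (Om m j) k l x)"
  unfolding S2_up_def by (intro ext) (simp add: Db_sum Db_mult Db_Om[of j])

text \<open>After commuting \<open>D i\<close> with \<open>Db n\<close>, the Bianchi identity trades
  i for m. Of the two commutator terms, the one with \<open>R\<close> becomes \<Omega>^2 and the one
  with \<open>Rb\<close> is cancelled by Q.\<close>

lemma D_Db_S2: "D i (Db j S2_up) k l x = (\<Oplus>m n. der (a i) (der (b j) (h m n)) x * Om m n k l x + der (b j) (h m n) x * D m (Om i n) k l x
    + der (a i) (h m n) x * Db n (Om m j) k l x
    + h m n x * (Db n (D m (Om i j)) k l x
      + (\<Oplus>p. R i n k p x * Om m j p l x) - (\<Oplus>q. Rb i n l q x * Om m j k q x)))"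
proof -
  have e: "D m (Om i j) = D i (Om m j)" for m by (intro ext) (simp add: D_Om)
  show ?thesis unfolding Db_S2
    by (simp add: D_sum D_add D_mult D_Db D_Om[of i _ _] e sum.distrib sum_subtractf algebra_simps)
qed

text \<open>\<open>D\<close> ignores the contracted indices m and p, but the derivatives of the two
  factors \<open>h\<close> are, by \<open>der_h\<close>, exactly the connection terms that complete
  \<open>D\<close> to the Chern derivative \<open>nabla\<close>.\<close>

lemma raise_indices: 
  assumes [simp]: "\<And>m p k. sm (Y m p k)"
  shows "D i (\<lambda>k l x. \<Oplus>m p. h m n x * h p s x * Y m p k x) k l x
    = (\<Oplus>m p. h m n x * h p s x * nabla i Y m p k x)"
proof -
  have 1: "(\<Oplus>m p. der (a i) (h m n) x * h p s x * Y m p k x)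
     = (\<Oplus>m p. h m n x * h p s x * (\<Oplus>q. B i m q x * Y q p k x))"
  proof -
    have "(\<Oplus>m p. h m n x * h p s x * (\<Oplus>q. B i m q x * Y q p k x))
        = (\<Oplus>m q p. h m n x * h p s x * (B i m q x * Y q p k x))"
      unfolding sum_distrib_left by (subst (2) sum.swap) simp
    also have "\<dots> = (\<Oplus>q m p. h m n x * h p s x * (B i m q x * Y q p k x))"
      by (rule sum.swap)
    also have "\<dots> = (\<Oplus>q p m. h m n x * h p s x * (B i m q x * Y q p k x))"
      by (subst (2) sum.swap) simp
    finally show ?thesis
      by (simp add: der_h sum_distrib_left sum_distrib_right mult_ac)
  qed
  have 2: "(\<Oplus>m p. h m n x * der (a i) (h p s) x * Y m p k x)
     = (\<Oplus>m p. h m n x * h p s x * (\<Oplus>q. B i p q x * Y m q k x))"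
    unfolding der_h sum_distrib_left sum_distrib_right
    by (rule sum.cong[OF refl], subst sum.swap) (simp add: mult_ac)
  have 3: "(\<Oplus>p. B i p k x * (\<Oplus>m pa. h m n x * h pa s x * Y m pa p x))
    = (\<Oplus>m p. h m n x * h p s x * (\<Oplus>q. B i q k x * Y m p q x))"
    unfolding sum_distrib_left
    by (subst sum.swap, rule sum.cong[OF refl], subst sum.swap) (simp add: mult_ac)
  have "D i (\<lambda>k l x. \<Oplus>m p. h m n x * h p s x * Y m p k x) k l x
    = (\<Oplus>m p. h m n x * h p s x * der (a i) (Y m p k) x)
      + (\<Oplus>m p. der (a i) (h m n) x * h p s x * Y m p k x)
      + (\<Oplus>m p. h m n x * der (a i) (h p s) x * Y m p k x)
      - (\<Oplus>p. B i p k x * (\<Oplus>m pa. h m n x * h pa s x * Y m pa p x))"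
    by (simp add: D_def sum.distrib ring_distribs)
  then show ?thesis
    unfolding 1 2 3
    by (simp add: nabla_def sum.distrib sum_negf sum_subtractf right_diff_distrib distrib_left)
qed

end

context inverse_metric
begin

interpretation dual: inverse_metric sm der b a "\<lambda>k l. h l k" "\<lambda>k l. g l k"
  by (rule inverse_metric_dual)

lemma raise_indices_bar:
  assumes [simp]: "\<And>n s l. sm (Y n s l)"
  shows "Db j (\<lambda>k l x. \<Oplus>n s. h m n x * h p s x * Y n s l x) k l x
    = (\<Oplus>n s. h m n x * h p s x * nablab j Y n s l x)"
  using dual.raise_indices[of Y j m p l k x] unfolding dual_simps by simp

lemma sum_swap4: "(\<Sum>m\<in>A. \<Sum>p\<in>A'. \<Sum>n\<in>C. \<Sum>s\<in>C'. f m p n s)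
    = (\<Sum>n\<in>C. \<Sum>s\<in>C'. \<Sum>m\<in>A. \<Sum>p\<in>A'. f m p n s)"
  for f :: "_ \<Rightarrow> _ \<Rightarrow> _ \<Rightarrow> _ \<Rightarrow> complex"
proof -
  have *: "(\<Sum>m\<in>A. \<Sum>p\<in>A'. \<Sum>n\<in>M. F m p n) = (\<Sum>n\<in>M. \<Sum>m\<in>A. \<Sum>p\<in>A'. F m p n)"
    for F :: "_ \<Rightarrow> _ \<Rightarrow> _ \<Rightarrow> complex" and M
    by (simp only: sum.swap[of _ M A'] sum.swap[of _ M A])
  show ?thesis unfolding * by (rule refl)
qed

text \<open>Grouped so that \<open>T\<close>, which has no barred index, is a scalar for
  \<open>Db\<close>, while \<open>raise_indices_bar\<close> applies to the inner sum.\<close>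

lemma Q_up_alt: "Q_up k l x = 1/2 * (\<Oplus>m p. T m p k x * (\<Oplus>n s. h m n x * h p s x * Tb n s l x))"
  by (simp add: Q_up_def sum_distrib_left mult_ac)

lemma Db_Q: "Db j Q_up k l x = 1/2 * (\<Oplus>n s. Tb n s l x * (\<Oplus>m p. h m n x * h p s x * der (b j) (T m p k) x)
  + nablab j Tb n s l x * (\<Oplus>m p. h m n x * h p s x * T m p k x))"
proof -
  have "Db j Q_up k l x = 1/2 * (\<Oplus>m p. der (b j) (T m p k) x * (\<Oplus>n s. h m n x * h p s x * Tb n s l x)
      + T m p k x * (\<Oplus>n s. h m n x * h p s x * nablab j Tb n s l x))"
  proof -
    have "Db j (\<lambda>k l x. T m p k x * (\<Oplus>n s. h m n x * h p s x * Tb n s l x)) k l x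
       = der (b j) (T m p k) x * (\<Oplus>n s. h m n x * h p s x * Tb n s l x)
      + T m p k x * (\<Oplus>n s. h m n x * h p s x * nablab j Tb n s l x)" for m p
    proof -
      \<comment> \<open>Hiding the contraction in \<open>U\<close> stops the product rule from
        expanding it.\<close>
      define U where "U l = (\<lambda>x. \<Oplus>n s. h m n x * h p s x * Tb n s l x)" for l
      have [simp]: "sm (U l)" for l by (simp add: U_def)
      have "Db j (\<lambda>k l. U l) k l x = (\<Oplus>n s. h m n x * h p s x * nablab j Tb n s l x)"
        unfolding U_def by (rule raise_indices_bar) simp
      then show ?thesis unfolding U_def[symmetric, THEN fun_cong]
        by (simp add: Db_def sum_distrib_left algebra_simps)
    qed
    then show ?thesis
      unfolding Q_up_alt[abs_def] by (simp add: Db_mult[of "\<lambda>_. 1/2", simplified] Db_sum)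
  qed
  moreover have "(\<Oplus>m p. t m p * (\<Oplus>n s. h m n x * h p s x * u n s))
     = (\<Oplus>n s. u n s * (\<Oplus>m p. h m n x * h p s x * t m p))" for t u
    by (simp add: sum_distrib_left mult_ac) (rule sum_swap4)
  ultimately show ?thesis
    by (simp add: sum.distrib)
qed

text \<open>The third of the four terms is already D(\<nabla>T). The first and last will give the
  torsion terms of the twisted Laplacian, the second a product of two curvatures.\<close>

lemma D_Db_Q: "D i (Db j Q_up) k l x = 1/2 * (\<Oplus>n s. Tb n s l x * (\<Oplus>m p. h m n x * h p s x * nabla i (\<lambda>m p k. der (b j) (T m p k)) m p k x)
  + der (a i) (Tb n s l) x * (\<Oplus>m p. h m n x * h p s x * der (b j) (T m p k) x)
  + nablab j Tb n s l x * (\<Oplus>m p. h m n x * h p s x * nabla i T m p k x)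
  + der (a i) (nablab j Tb n s l) x * (\<Oplus>m p. h m n x * h p s x * T m p k x))"
proof -
  have e: "Db j Q_up = (\<lambda>k l x. 1/2 * (\<Oplus>n s. Tb n s l x * (\<Oplus>m p. h m n x * h p s x * der (b j) (T m p k) x)
  + nablab j Tb n s l x * (\<Oplus>m p. h m n x * h p s x * T m p k x)))"
    by (intro ext) (rule Db_Q)
  have *: "D i (\<lambda>k l x. Z n s l x * (\<Oplus>m p. h m n x * h p s x * Y m p k x)) k l x
     = der (a i) (Z n s l) x * (\<Oplus>m p. h m n x * h p s x * Y m p k x)
      + Z n s l x * (\<Oplus>m p. h m n x * h p s x * nabla i Y m p k x)"
    if [simp]: "\<And>m p k. sm (Y m p k)" "\<And>n s l. sm (Z n s l)" for Y Z n s
  proof -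
    define U where "U k = (\<lambda>x. \<Oplus>m p. h m n x * h p s x * Y m p k x)" for k
    have [simp]: "sm (U k)" for k by (simp add: U_def)
    have "D i (\<lambda>k l. U k) k l x = (\<Oplus>m p. h m n x * h p s x * nabla i Y m p k x)"
      unfolding U_def by (rule raise_indices) simp
    then show ?thesis unfolding U_def[symmetric, THEN fun_cong]
      by (simp add: D_def sum_distrib_left algebra_simps)
  qed
  have **: "D i (\<lambda>k l x. Z n s l x * (\<Oplus>m p. h m n x * h p s x * Y m p k x)
       + Z' n s l x * (\<Oplus>m p. h m n x * h p s x * Y' m p k x)) k l x
     = der (a i) (Z n s l) x * (\<Oplus>m p. h m n x * h p s x * Y m p k x)
      + Z n s l x * (\<Oplus>m p. h m n x * h p s x * nabla i Y m p k x)
      + (der (a i) (Z' n s l) x * (\<Oplus>m p. h m n x * h p s x * Y' m p k x)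
      + Z' n s l x * (\<Oplus>m p. h m n x * h p s x * nabla i Y' m p k x))"
    if [simp]: "\<And>m p k. sm (Y m p k)" "\<And>n s l. sm (Z n s l)"
     "\<And>m p k. sm (Y' m p k)" "\<And>n s l. sm (Z' n s l)" for Y Z Y' Z' n s
    by (simp add: D_add *)
  show ?thesis
    unfolding e
    by (subst D_mult[of "\<lambda>_. 1/2"]) (simp_all add: D_sum
      **[where Y = "\<lambda>m p k. der (b j) (T m p k)" and Z = Tb and Y' = T and Z' = "nablab j Tb"] add_ac)
qed

end

section \<open>Evaluation of the torsion terms by the Bianchi identities\<close>

context inverse_metric
begin

interpretation dual: inverse_metric sm der b a "\<lambda>k l. h l k" "\<lambda>k l. g l k"
  by (rule inverse_metric_dual)

lemma contract_Rb: "(\<Oplus>n. h m n x * Rb i j l n x) = Om i j m l x"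
proof -
  have "(\<Oplus>n. h m n x * Rb i j l n x) = (\<Oplus>p. Om i j p l x * (\<Oplus>q. h m q x * g p q x))"
    by (simp add: Rb_def sum_distrib_left sum_distrib_right mult_ac) (rule sum.swap)
  then show ?thesis by (simp add: hg if_distrib cong: if_cong)
qed

lemma contract_R: "(\<Oplus>m. h m n x * R i j k m x) = Om i j k n x"
  using inverse_metric.contract_Rb[OF inverse_metric_dual, where a=b and b=a and m=n and i=j and j=i and l=k and x=x]
  unfolding dual_simps .

text \<open>Raising p commutes with the Chern derivative, so \<open>R\<close> becomes
  \<open>Om\<close> and the second Bianchi identity exchanges i and m. What remains is the
  connection term of m, which \<open>D\<close> treats as a label.\<close>

lemma contract_nabla_R: "(\<Oplus>p. h p s x * nabla i (\<lambda>m p k. R m j k p) m p k x)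
   = D m (Om i j) k s x + (\<Oplus>q. B i m q x * Om q j k s x)"
proof -
  have 1: "der (a i) (Om m j k s) x = (\<Oplus>p. der (a i) (h p s) x * R m j k p x)
      + (\<Oplus>p. h p s x * der (a i) (R m j k p) x)"
    unfolding contract_R[of s _ m j k, abs_def, symmetric] by (simp add: sum.distrib)
  have 2: "(\<Oplus>p. der (a i) (h p s) x * R m j k p x)
     = (\<Oplus>p. h p s x * (\<Oplus>q. B i p q x * R m j k q x))"
    unfolding der_h sum_distrib_left sum_distrib_right
    by (subst sum.swap) (simp add: mult_ac)
  have 3: "(\<Oplus>p. h p s x * (\<Oplus>q. f q * R (u q) j (v q) p x))
     = (\<Oplus>q. f q * Om (u q) j (v q) s x)" for f u v
    unfolding contract_R[of s _ _ j, symmetric] sum_distrib_left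
    by (subst sum.swap) (simp add: mult_ac)
  have "(\<Oplus>p. h p s x * nabla i (\<lambda>m p k. R m j k p) m p k x) = 
     (\<Oplus>p. h p s x * der (a i) (R m j k p) x) - (\<Oplus>p. h p s x * (\<Oplus>q. B i q k x * R m j q p x))
     + (\<Oplus>p. h p s x * (\<Oplus>q. B i m q x * R q j k p x))
     + (\<Oplus>p. h p s x * (\<Oplus>q. B i p q x * R m j k q x))"
    by (simp add: nabla_def sum.distrib sum_negf ring_distribs sum_subtractf)
  then show ?thesis
    using 1 unfolding 2[symmetric] D_Om[of m i] 3[of "\<lambda>q. B i q k x" "\<lambda>_. m" "\<lambda>q. q"] 3[of "\<lambda>q. B i m q x" "\<lambda>q. q" "\<lambda>_. k"]
    by (simp add: D_def)
qed

text \<open>Exchanging (n, m) with (s, p) shows that both halves of the antisymmetrised factor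
  contribute equally. The resulting 2 cancels the 1/2 in the definition of Q.\<close>

lemma antisym_contract:
  assumes "\<And>n s. t n s = - t s n"
  shows "(\<Oplus>n s. t n s * (\<Oplus>m p. h m n x * h p s x * (z p m - z m p)))
    = - 2 * (\<Oplus>n s. t n s * (\<Oplus>m. h m n x * (\<Oplus>p. h p s x * z m p)))"
proof -
  have "(\<Oplus>n s. t n s * (\<Oplus>m p. h m n x * h p s x * z p m))
    = (\<Oplus>s n. t n s * (\<Oplus>m p. h m n x * h p s x * z p m))"
    by (rule sum.swap)
  also have "\<dots> = (\<Oplus>n s. t s n * (\<Oplus>p m. h m s x * h p n x * z p m))"
    by (subst sum.swap[of _ "UNIV::'n set" "UNIV::'n set"]) (rule refl)
  also have "\<dots> = - (\<Oplus>n s. t n s * (\<Oplus>p m. h p n x * h m s x * z p m))"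
    by (subst assms) (simp add: sum_negf mult_ac)
  finally show ?thesis
    by (simp add: ring_distribs sum_subtractf sum_distrib_left mult_ac)
qed

lemma Tb_antisym: "Tb n s l x = - Tb s n l x" by (simp add: Tb_def)
lemma T_antisym: "T n s l x = - T s n l x" by (simp add: T_def)

lemma nabla_derb_T: "nabla i (\<lambda>m p k. der (b j) (T m p k)) m p k x
   = nabla i (\<lambda>m p k. R m j k p) p m k x - nabla i (\<lambda>m p k. R m j k p) m p k x"
  by (simp add: nabla_def derb_T[abs_def] sum.distrib sum_negf ring_distribs sum_subtractf)

text \<open>The first Bianchi identity turns \<partial>_jbar \<open>T\<close> into curvature and the
  second one rotates its indices. This is the part of the twisted Laplacian in which the torsion
  acts on l.\<close>

lemma Q_term1: "(\<Oplus>n s. Tb n s l x * (\<Oplus>m p. h m n x * h p s x * nabla i (\<lambda>m p k. der (b j) (T m p k)) m p k x))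
   = - 2 * (\<Oplus>m n. h m n x * (\<Oplus>s. Tb n s l x *
      (D m (Om i j) k s x + (\<Oplus>q. B i m q x * Om q j k s x))))"
proof -
  have "(\<Oplus>n s. Tb n s l x * (\<Oplus>m. h m n x * f s m))
    = (\<Oplus>m n. h m n x * (\<Oplus>s. Tb n s l x * f s m))" for f
    unfolding sum_distrib_left 
    by (subst sum.swap[of _ "UNIV::'n set" "UNIV::'n set"], subst sum.swap[of _ "UNIV::'n set" "UNIV::'n set"]) (simp add: mult_ac)
  then show ?thesis
  unfolding nabla_derb_T by (simp add: antisym_contract[of "\<lambda>n s. Tb n s l x", OF Tb_antisym] contract_nabla_R)
qed

lemma Q_term4: "(\<Oplus>m p. T m p k x * (\<Oplus>n s. h m n x * h p s x * nablab j (\<lambda>n s l. der (a i) (Tb n s l)) n s l x))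
   = - 2 * (\<Oplus>n m. h m n x * (\<Oplus>p. T m p k x *
      (Db n (Om i j) p l x + (\<Oplus>q. Bb j n q x * Om i q p l x))))"
  using inverse_metric.Q_term1[OF inverse_metric_dual, where a=b and b=a and i=j and j=i and l=k and k=l and x=x]
  unfolding dual_simps by (simp del: mult_minus_left)


text \<open>Both factors are antisymmetrised curvatures by the first Bianchi identity. One product
  cancels a commutator term of \<open>D_Db_S2\<close>, the other is the second half of
  \<Omega>^#.\<close>

lemma Q_term2: "(\<Oplus>n s. der (a i) (Tb n s l) x * (\<Oplus>m p. h m n x * h p s x * der (b j) (T m p k) x))
   = 2 * (\<Oplus>m n. h m n x * (\<Oplus>q. Rb i n l q x * Om m j k q x))
   - 2 * (\<Oplus>m q. Om m j k q x * Om i q m l x)"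
proof -
  have 0: "(\<Oplus>n s. der (a i) (Tb n s l) x * (\<Oplus>m p. h m n x * h p s x * der (b j) (T m p k) x))
    = - 2 * (\<Oplus>n s. (Rb i s l n x - Rb i n l s x) * (\<Oplus>m. h m n x * Om m j k s x))"
    unfolding derb_T der_Tb
    by (subst antisym_contract[where t = "\<lambda>n s. Rb i s l n x - Rb i n l s x" and z = "\<lambda>m p. R m j k p x"])
       (simp_all add: contract_R)
  have 1: "(\<Oplus>n s. Rb i s l n x * (\<Oplus>m. h m n x * Om m j k s x))
     = (\<Oplus>m q. Om m j k q x * Om i q m l x)"
  proof -
    have "(\<Oplus>n s. Rb i s l n x * (\<Oplus>m. h m n x * Om m j k s x))
      = (\<Oplus>m s n. Om m j k s x * (h m n x * Rb i s l n x))"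
    proof -
      have "(\<Oplus>n s. Rb i s l n x * (\<Oplus>m. h m n x * Om m j k s x))
        = (\<Oplus>s n m. Om m j k s x * (h m n x * Rb i s l n x))"
        unfolding sum_distrib_left by (subst sum.swap) (simp add: mult_ac)
      also have "\<dots> = (\<Oplus>s m n. Om m j k s x * (h m n x * Rb i s l n x))"
        by (rule sum.cong[OF refl], rule sum.swap)
      also have "\<dots> = (\<Oplus>m s n. Om m j k s x * (h m n x * Rb i s l n x))"
        by (rule sum.swap)
      finally show ?thesis .
    qed
    then show ?thesis by (simp add: contract_Rb flip: sum_distrib_left)
  qed
  have 2: "(\<Oplus>n s. Rb i n l s x * (\<Oplus>m. h m n x * Om m j k s x))
     = (\<Oplus>m n. h m n x * (\<Oplus>q. Rb i n l q x * Om m j k q x))"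
  proof -
    have "(\<Oplus>n s. Rb i n l s x * (\<Oplus>m. h m n x * Om m j k s x))
      = (\<Oplus>n m s. Rb i n l s x * (h m n x * Om m j k s x))"
      unfolding sum_distrib_left by (rule sum.cong[OF refl], rule sum.swap)
    also have "\<dots> = (\<Oplus>m n s. Rb i n l s x * (h m n x * Om m j k s x))"
      by (rule sum.swap)
    finally show ?thesis by (simp add: sum_distrib_left mult_ac)
  qed
  show ?thesis unfolding 0
    by (simp add: left_diff_distrib sum_subtractf 1 2)
qed

text \<open>Moving \<partial>_i inside hits the coefficients \<open>Bb\<close> and leaves one
  curvature term for each index of \<open>Tb\<close>. The one for l later cancels the Q part of the
  last term of \<open>der_Om\<close>; the other two are equal after contraction.\<close>

lemma der_nablab_Tb: "der (a i) (nablab j Tb n s l) x = nablab j (\<lambda>n s l. der (a i) (Tb n s l)) n s l x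
   - (\<Oplus>q. Rb i j l q x * Tb n s q x)
   + (\<Oplus>q. Rb i j q n x * Tb q s l x) + (\<Oplus>q. Rb i j q s x * Tb n q l x)"
  by (simp add: nablab_def der_Bb der_comm[of _ "a i" "b j"] sum.distrib sum_negf sum_subtractf algebra_simps)

lemma TT_contract: "(\<Oplus>m p. T m p k x * (\<Oplus>n s. h m n x * h p s x *
     (\<Oplus>q. Rb i j q n x * Tb q s l x)))
   = (\<Oplus>m n. h m n x * (\<Oplus>p q. T m p k x * Tb n q l x * Om i j p q x))"
proof -
  have 1: "(\<Oplus>n s. h m n x * h p s x * (\<Oplus>q. Rb i j q n x * Tb q s l x))
    = (\<Oplus>s q. h p s x * Om i j m q x * Tb q s l x)" for m p
  proof -
    have "(\<Oplus>n s. h m n x * h p s x * (\<Oplus>q. Rb i j q n x * Tb q s l x))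
      = (\<Oplus>s n q. h p s x * Tb q s l x * (h m n x * Rb i j q n x))"
      by (subst sum.swap) (simp add: sum_distrib_left mult_ac)
    also have "\<dots> = (\<Oplus>s q n. h p s x * Tb q s l x * (h m n x * Rb i j q n x))"
      by (rule sum.cong[OF refl], rule sum.swap)
    also have "\<dots> = (\<Oplus>s q. h p s x * Tb q s l x * (\<Oplus>n. h m n x * Rb i j q n x))"
      by (simp only: sum_distrib_left)
    finally show ?thesis by (simp add: contract_Rb mult_ac)
  qed
  have "(\<Oplus>m p. T m p k x * (\<Oplus>s q. h p s x * Om i j m q x * Tb q s l x))
     = (\<Oplus>p m s q. T m p k x * (h p s x * Om i j m q x * Tb q s l x))"
    unfolding sum_distrib_left by (rule sum.swap)
  also have "\<dots> = (\<Oplus>p s m q. T m p k x * (h p s x * Om i j m q x * Tb q s l x))"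
    by (rule sum.cong[OF refl], rule sum.swap)
  \<comment> \<open>Both torsions are reversed, so the signs cancel.\<close>
  also have "\<dots> = (\<Oplus>p s. h p s x * (\<Oplus>m q. T p m k x * Tb s q l x * Om i j m q x))"
    unfolding sum_distrib_left
    by (subst T_antisym, subst Tb_antisym) (simp add: mult_ac)
  finally show ?thesis unfolding 1 .
qed

text \<open>Everything built from \<open>B\<close>, \<open>Bb\<close>, \<open>T\<close> and
  \<open>Tb\<close> that separates \<open>Nb n (N m Om)\<close> from
  \<open>Db n (D m (Om i j))\<close>, apart from curvature times \<open>Om\<close>. It is what the
  derivatives of \<open>h\<close> in the S2 part and the torsion terms of the Q part have to add up
  to.\<close>

definition M :: "'n \<Rightarrow> 'n \<Rightarrow> 'n \<Rightarrow> 'n \<Rightarrow> 'n \<Rightarrow> 'n \<Rightarrow> 's \<Rightarrow> complex" where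
  "M m n i j k l x =
     (\<Oplus>p. B i m p x * Db n (Om p j) k l x) + (\<Oplus>q. Bb j n q x * D m (Om i q) k l x)
   - (\<Oplus>p. T m p k x * (Db n (Om i j) p l x + (\<Oplus>q. Bb j n q x * Om i q p l x)))
   - (\<Oplus>q. Tb n q l x * (D m (Om i j) k q x + (\<Oplus>p. B i m p x * Om p j k q x)))
   + (\<Oplus>p q. T m p k x * Tb n q l x * Om i j p q x)
   + (\<Oplus>p q. B i m p x * Bb j n q x * Om p q k l x)"

lemma D_Db_Q_expand: "D i (Db j Q_up) k l x = 
    - (\<Oplus>m n. h m n x * (\<Oplus>q. Tb n q l x *
      (D m (Om i j) k q x + (\<Oplus>p. B i m p x * Om p j k q x))))
    - (\<Oplus>m n. h m n x * (\<Oplus>p. T m p k x *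
      (Db n (Om i j) p l x + (\<Oplus>q. Bb j n q x * Om i q p l x))))
    + (\<Oplus>m n. h m n x * (\<Oplus>p q. T m p k x * Tb n q l x * Om i j p q x))
    + (\<Oplus>m n. h m n x * (\<Oplus>q. Rb i n l q x * Om m j k q x))
    - (\<Oplus>m q. Om m j k q x * Om i q m l x)
    + 1/2 * (\<Oplus>n s. nablab j Tb n s l x * (\<Oplus>m p. h m n x * h p s x * nabla i T m p k x))
    - (\<Oplus>q. Rb i j l q x * Q_up k q x)"
proof -
  have sw: "(\<Oplus>n s. u n s * (\<Oplus>m p. h m n x * h p s x * t m p))
    = (\<Oplus>m p. t m p * (\<Oplus>n s. h m n x * h p s x * u n s))" for t u
    by (simp add: sum_distrib_left mult_ac) (rule sum_swap4)
  \<comment> \<open>The factor 2 undoes the 1/2 in \<open>Q_up\<close>.\<close>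
  have b: "(\<Oplus>n s. (\<Oplus>q. Rb i j l q x * Tb n s q x) *
      (\<Oplus>m p. h m n x * h p s x * T m p k x)) = 2 * (\<Oplus>q. Rb i j l q x * Q_up k q x)"
  proof -
    have "(\<Oplus>q. Rb i j l q x * (\<Oplus>n s. Tb n s q x * V n s))
      = (\<Oplus>n s. (\<Oplus>q. Rb i j l q x * Tb n s q x) * V n s)" for V
      unfolding sum_distrib_left sum_distrib_right
      by (subst sum.swap, rule sum.cong[OF refl], subst sum.swap) (simp add: mult_ac)
    then show ?thesis unfolding Q_up_alt sw[of "\<lambda>n s. Tb n s _ x", symmetric]
      by (simp flip: sum_divide_distrib)
  qed
  have c: "(\<Oplus>n s. (\<Oplus>q. Rb i j q n x * Tb q s l x) *
      (\<Oplus>m p. h m n x * h p s x * T m p k x))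
    = (\<Oplus>m n. h m n x * (\<Oplus>p q. T m p k x * Tb n q l x * Om i j p q x))"
    unfolding sw by (rule TT_contract)
  \<comment> \<open>Exchanging n and s reverses both torsions and reduces this to
    \<open>c\<close>.\<close>
  have d: "(\<Oplus>n s. (\<Oplus>q. Rb i j q s x * Tb n q l x) *
      (\<Oplus>m p. h m n x * h p s x * T m p k x))
    = (\<Oplus>m n. h m n x * (\<Oplus>p q. T m p k x * Tb n q l x * Om i j p q x))"
  proof -
    have "(\<Oplus>q. Rb i j q s x * Tb n q l x) * (\<Oplus>m p. h m n x * h p s x * T m p k x)
       = (\<Oplus>q. Rb i j q s x * Tb q n l x) * (\<Oplus>m p. h m s x * h p n x * T m p k x)" for n s
    proof -
      have "(\<Oplus>m p. h m n x * h p s x * T m p k x) = (\<Oplus>p m. h m n x * h p s x * T m p k x)"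
        by (rule sum.swap)
      also have "\<dots> = - (\<Oplus>m p. h m s x * h p n x * T m p k x)"
        by (subst T_antisym) (simp add: mult_ac sum_negf)
      finally show ?thesis
        by (subst Tb_antisym) (simp add: sum_negf)
    qed
    then show ?thesis by (subst c[symmetric], subst sum.swap) simp
  qed
  have e: "(\<Oplus>n m. h m n x * (\<Oplus>p. T m p k x *
      (Db n (Om i j) p l x + (\<Oplus>q. Bb j n q x * Om i q p l x))))
    = (\<Oplus>m n. h m n x * (\<Oplus>p. T m p k x *
      (Db n (Om i j) p l x + (\<Oplus>q. Bb j n q x * Om i q p l x))))"
    by (rule sum.swap)
  have 4: "(\<Oplus>n s. der (a i) (nablab j Tb n s l) x * (\<Oplus>m p. h m n x * h p s x * T m p k x))
     = - 2 * (\<Oplus>m n. h m n x * (\<Oplus>p. T m p k x *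
      (Db n (Om i j) p l x + (\<Oplus>q. Bb j n q x * Om i q p l x))))
      - 2 * (\<Oplus>q. Rb i j l q x * Q_up k q x)
      + 2 * (\<Oplus>m n. h m n x * (\<Oplus>p q. T m p k x * Tb n q l x * Om i j p q x))"
    unfolding der_nablab_Tb distrib_right left_diff_distrib sum.distrib sum_subtractf b c d
      sw[of "\<lambda>n s. nablab j (\<lambda>n s l. der (a i) (Tb n s l)) n s l x"] Q_term4 e
    by simp
  show ?thesis
    unfolding D_Db_Q sum.distrib Q_term1 Q_term2 4 by (simp add: field_simps)
qed

text \<open>The second derivative of \<open>h\<close> is \<open>Om\<close> plus a product of
  Christoffel symbols. The \<open>Om\<close> part is the first half of \<Omega>^#, the rest the last
  term of \<open>M\<close>.\<close>

lemma sum_B_Bb: "(\<Oplus>m n. der (a i) (der (b j) (h m n)) x * Om m n k l x)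
  = (\<Oplus>m n. Om i j m n x * Om m n k l x)
  + (\<Oplus>m n. h m n x * (\<Oplus>p q. B i m p x * Bb j n q x * Om p q k l x))"
proof -
  have e: "der (a i) (der (b j) (h m n)) x = Om i j m n x + (\<Oplus>p q. B i p m x * Bb j q n x * h p q x)" for m n
    by (simp add: Om_def derb_h[of j _ n] sum_distrib_left mult_ac)
  have "(\<Oplus>m n. h m n x * (\<Oplus>p q. B i m p x * Bb j n q x * Om p q k l x))
    = (\<Oplus>m n. (\<Oplus>p q. B i p m x * Bb j q n x * h p q x) * Om m n k l x)"
    unfolding sum_distrib_left sum_distrib_right by (subst sum_swap4) (simp add: mult_ac)
  then show ?thesis by (simp add: e distrib_right sum.distrib)
qed

lemma sum_der_h: "(\<Oplus>m n. der (a i) (h m n) x * f m n)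
  = (\<Oplus>m n. h m n x * (\<Oplus>p. B i m p x * f p n))"
proof -
  have "(\<Oplus>m n. der (a i) (h m n) x * f m n)
    = (\<Oplus>n m p. B i p m x * h p n x * f m n)"
    unfolding der_h sum_distrib_right by (rule sum.swap)
  also have "\<dots> = (\<Oplus>n p m. B i p m x * h p n x * f m n)"
    by (rule sum.cong[OF refl], rule sum.swap)
  also have "\<dots> = (\<Oplus>p n m. B i p m x * h p n x * f m n)"
    by (rule sum.swap)
  finally show ?thesis by (simp add: sum_distrib_left mult_ac)
qed

lemma sum_derb_h: "(\<Oplus>m n. der (b j) (h m n) x * f m n)
  = (\<Oplus>m n. h m n x * (\<Oplus>q. Bb j n q x * f m q))"
proof (rule sum.cong[OF refl])
  fix m
  show "(\<Oplus>n. der (b j) (h m n) x * f m n)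
    = (\<Oplus>n. h m n x * (\<Oplus>q. Bb j n q x * f m q))"
    unfolding derb_h sum_distrib_right sum_distrib_left by (subst sum.swap) (simp add: mult_ac)
qed

text \<open>Two cancellations between the S2 and Q parts happen here: the commutator term with
  \<open>Rb i n l q\<close>, and the product of \<open>Rb i j l q\<close> with
  \<open>Q_up\<close>.\<close>

lemma D_Db_F: "D i (Db j S2_up) k l x + D i (Db j Q_up) k l x
   + (\<Oplus>q. Rb i j l q x * (S2_up k q x + Q_up k q x)) =
    (\<Oplus>m n. h m n x * (Db n (D m (Om i j)) k l x + M m n i j k l x))
    + (\<Oplus>m n. h m n x * (\<Oplus>p. R i n k p x * Om m j p l x))
    + (\<Oplus>m n. Om i j m n x * Om m n k l x)
    - (\<Oplus>m q. Om m j k q x * Om i q m l x)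
    + 1/2 * (\<Oplus>n s. nablab j Tb n s l x * (\<Oplus>m p. h m n x * h p s x * nabla i T m p k x))
    + (\<Oplus>q. Rb i j l q x * S2_up k q x)"
  unfolding D_Db_S2 D_Db_Q_expand distrib_left right_diff_distrib sum.distrib sum_subtractf sum_B_Bb
     sum_der_h sum_derb_h M_def
  by simp


section \<open>Twisted second derivatives and the abstract evolution equation\<close>

lemma N_eq: "N m X i j k l x = D m (X i j) k l x
   - (\<Oplus>p. T m p k x * X i j p l x) + (\<Oplus>p. B i m p x * X p j k l x)"
  by (simp add: N_def D_def T_def sum.distrib sum_negf sum_subtractf algebra_simps)

definition S2_act :: "'n \<Rightarrow> 'n \<Rightarrow> 'n \<Rightarrow> 'n \<Rightarrow> 's \<Rightarrow> complex" where
  "S2_act i j k l x = (\<Oplus>m n. h m n x * (\<Oplus>p. R m n k p x * Om i j p l x))"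

text \<open>The half of the action of v on the unbarred indices k and i; \<open>v_actb\<close> is
  the half on l and j. The trace of \<open>Om\<close> is S4 with its second index raised.\<close>

definition v_act :: "'n \<Rightarrow> 'n \<Rightarrow> 'n \<Rightarrow> 'n \<Rightarrow> 's \<Rightarrow> complex" where
  "v_act i j k l x = (\<Oplus>p. (1/2 * (\<Oplus>n. Om p n k n x)) * Om i j p l x
     - (1/2 * (\<Oplus>n. Om i n p n x)) * Om p j k l x)"

definition v_actb :: "'n \<Rightarrow> 'n \<Rightarrow> 'n \<Rightarrow> 'n \<Rightarrow> 's \<Rightarrow> complex" where
  "v_actb i j k l x = (\<Oplus>q. (1/2 * (\<Oplus>n. Om n q n l x)) * Om i j k q x
     - (1/2 * (\<Oplus>n. Om n j n q x)) * Om i q k l x)"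

end

context inverse_metric
begin

interpretation dual: inverse_metric sm der b a "\<lambda>k l. h l k" "\<lambda>k l. g l k"
  by (rule inverse_metric_dual)

lemma Nb_eq: "Nb n X i j k l x = Db n (X i j) k l x
   - (\<Oplus>q. Tb n q l x * X i j k q x) + (\<Oplus>q. Bb j n q x * X i q k l x)"
  using dual.N_eq[of n "\<lambda>j i l k. X i j k l" j i l k x] unfolding dual_simps .

lemma Db_diff: "(\<And>k l. sm (X k l)) \<Longrightarrow> (\<And>k l. sm (Y k l)) \<Longrightarrow>
    Db i (\<lambda>k l x. X k l x - Y k l x) k l x = Db i X k l x - Db i Y k l x"
  by (simp add: Db_def sum_subtractf algebra_simps)

text \<open>The curvature terms arise when \<open>Nb n\<close> differentiates the coefficients of
  \<open>N m\<close>: the torsion acting on k and the symbol \<open>B i m p\<close> acting on i. The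
  direction m itself is a label.\<close>

lemma Nb_N: "Nb n (N m Om) i j k l x = Db n (D m (Om i j)) k l x + M m n i j k l x
   + (\<Oplus>p. (R m n k p x - R p n k m x) * Om i j p l x + R i n p m x * Om p j k l x)"
proof -
  have T: "Db n (\<lambda>k l x. T m p k x * Om i j p l x) k l x
      = der (b n) (T m p k) x * Om i j p l x + T m p k x * Db n (Om i j) p l x" for p
    by (simp add: Db_def sum_distrib_left algebra_simps)
  have 1: "Db n (N m Om i j) k l x = Db n (D m (Om i j)) k l x
     - (\<Oplus>p. der (b n) (T m p k) x * Om i j p l x + T m p k x * Db n (Om i j) p l x)
     + (\<Oplus>p. R i n p m x * Om p j k l x + B i m p x * Db n (Om p j) k l x)"
    unfolding N_eq[abs_def]
    by (simp add: Db_add Db_diff Db_sum Db_mult derb_B T)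
  have s: "(\<Oplus>p. T m p k x * (\<Oplus>q. f q * Z p q)) = (\<Oplus>q. f q * (\<Oplus>p. T m p k x * Z p q))" for f Z
    unfolding sum_distrib_left by (subst sum.swap) (simp add: mult_ac)
  have s': "(\<Oplus>p q. T m p k x * Tb n q l x * Om i j p q x) = (\<Oplus>q. Tb n q l x * (\<Oplus>p. T m p k x * Om i j p q x))"
    unfolding sum_distrib_left by (subst sum.swap) (simp add: mult_ac)
  have s'': "(\<Oplus>p q. B i m p x * Bb j n q x * Om p q k l x) = (\<Oplus>q. Bb j n q x * (\<Oplus>p. B i m p x * Om p q k l x))"
    unfolding sum_distrib_left by (subst sum.swap) (simp add: mult_ac)
  show ?thesis
    unfolding Nb_eq 1 M_def s' s'' derb_T
    unfolding N_eq distrib_left right_diff_distrib left_diff_distrib sum.distrib sum_subtractf s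
    by simp
qed

lemma dual_M: "dual.M n m j i l k x = M m n i j k l x"
proof -
  have 1: "(\<Oplus>p q. Tb n p l x * T m q k x * Om i j q p x)
    = (\<Oplus>p q. T m p k x * Tb n q l x * Om i j p q x)"
    by (subst sum.swap) (simp add: mult_ac)
  have 2: "(\<Oplus>p q. Bb j n p x * B i m q x * Om q p k l x)
    = (\<Oplus>p q. B i m p x * Bb j n q x * Om p q k l x)"
    by (subst sum.swap) (simp add: mult_ac)
  show ?thesis
    unfolding dual.M_def M_def dual_simps 1 2 by simp
qed


text \<open>Of the three traced curvatures, one is S2 acting on k; the other two are S4 traces
  acting on k and i, which is twice v.\<close>

lemma contract_Nb_N: "(\<Oplus>m n. h m n x * Nb n (N m Om) i j k l x)
   = (\<Oplus>m n. h m n x * (Db n (D m (Om i j)) k l x + M m n i j k l x))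
     + S2_act i j k l x - 2 * v_act i j k l x"
proof -
  have *: "(\<Oplus>m n. h m n x * (\<Oplus>p. R (u p) n (v p) m x * f p))
     = (\<Oplus>p. (\<Oplus>n. Om (u p) n (v p) n x) * f p)" for u v f
  proof -
    have "(\<Oplus>m n. h m n x * (\<Oplus>p. R (u p) n (v p) m x * f p))
      = (\<Oplus>n m p. (h m n x * R (u p) n (v p) m x) * f p)"
      unfolding sum_distrib_left by (subst sum.swap) (simp add: mult_ac)
    also have "\<dots> = (\<Oplus>n p m. (h m n x * R (u p) n (v p) m x) * f p)"
      by (rule sum.cong[OF refl], rule sum.swap)
    also have "\<dots> = (\<Oplus>n p. Om (u p) n (v p) n x * f p)"
      unfolding sum_distrib_right[symmetric] contract_R by (rule refl)
    also have "\<dots> = (\<Oplus>p n. Om (u p) n (v p) n x * f p)"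
      by (rule sum.swap)
    finally show ?thesis unfolding sum_distrib_right .
  qed
  show ?thesis
    unfolding Nb_N S2_act_def v_act_def
    unfolding distrib_left left_diff_distrib right_diff_distrib sum.distrib sum_subtractf
      *[of "\<lambda>p. p" "\<lambda>_. k"] *[of "\<lambda>_. i" "\<lambda>p. p"]
    by (simp add: sum_distrib_left sum_distrib_right mult_ac)
qed

text \<open>Both sides contract S2, \<open>g\<close> and \<open>Om\<close>. Thus the term \<Omega> g
  S2 in the variation is the S2 term inside the Laplacian.\<close>

lemma S2_act_alt: "S2_act i j k l x = (\<Oplus>q. Rb i j l q x * S2_up k q x)"
proof -
  have "(\<Oplus>p. R m n k p x * Om i j p l x) = (\<Oplus>q. Rb i j l q x * Om m n k q x)" for m n
    unfolding R_def Rb_def sum_distrib_right by (subst sum.swap) (simp add: mult_ac)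
  then have "S2_act i j k l x = (\<Oplus>m n q. h m n x * (Rb i j l q x * Om m n k q x))"
    by (simp add: S2_act_def sum_distrib_left)
  also have "\<dots> = (\<Oplus>m q n. h m n x * (Rb i j l q x * Om m n k q x))"
    by (rule sum.cong[OF refl], rule sum.swap)
  also have "\<dots> = (\<Oplus>q m n. h m n x * (Rb i j l q x * Om m n k q x))"
    by (rule sum.swap)
  finally show ?thesis by (simp add: S2_up_def sum_distrib_left mult_ac)
qed

lemma dual_v_act: "dual.v_act j i l k x = v_actb i j k l x"
  by (simp add: dual.v_act_def v_actb_def dual_Om)

lemma contract_N_Nb: "(\<Oplus>m n. h m n x * N m (Nb n Om) i j k l x)
   = (\<Oplus>m n. h m n x * (Db n (D m (Om i j)) k l x + M m n i j k l x))
     + S2_act i j k l x - 2 * v_actb i j k l x"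
proof -
  have "(\<Oplus>n m. h m n x * N m (Nb n Om) i j k l x)
   = (\<Oplus>n m. h m n x * (D m (Db n (Om i j)) k l x + M m n i j k l x))
     + dual.S2_act j i l k x - 2 * v_actb i j k l x"
    using inverse_metric.contract_Nb_N[OF inverse_metric_dual, where a=b and b=a and i=j and j=i and k=l and l=k and x=x]
    unfolding dual_simps dual_M dual_v_act .
  moreover have "dual.S2_act j i l k x = (\<Oplus>n m. h m n x * (\<Oplus>q. Rb m n l q x * Om i j k q x))"
    unfolding dual.S2_act_def dual_simps ..
  \<comment> \<open>Duality yields the derivatives in the opposite order with S2 acting on l.
    Commuting them back exchanges this for S2 acting on k, so both orders share the same main
    part.\<close>
  moreover have "(\<Oplus>n m. h m n x * (D m (Db n (Om i j)) k l x + M m n i j k l x))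
    = (\<Oplus>n m. h m n x * (Db n (D m (Om i j)) k l x + M m n i j k l x))
      + (\<Oplus>n m. h m n x * (\<Oplus>p. R m n k p x * Om i j p l x))
      - (\<Oplus>n m. h m n x * (\<Oplus>q. Rb m n l q x * Om i j k q x))"
    by (simp add: D_Db distrib_left right_diff_distrib sum.distrib sum_subtractf)
  moreover have "(\<Oplus>n m. h m n x * (\<Oplus>p. R m n k p x * Om i j p l x)) = S2_act i j k l x"
    unfolding S2_act_def by (rule sum.swap)
  ultimately show ?thesis
    by (simp add: sum.swap[of "\<lambda>m n. h m n x * _ m n" UNIV UNIV])
qed

text \<open>The two orders lack twice \<open>v_act\<close> and twice \<open>v_actb\<close>
  respectively, so their mean lacks each of them once.\<close>

theorem evolution:
  assumes "\<And>k l. der v (h k l) = (\<lambda>x. S2_up k l x + Q_up k l x)"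
  shows "der v (Om i j k l) x =
      1/2 * (\<Oplus>m n. h m n x * (N m (Nb n Om) i j k l x + Nb n (N m Om) i j k l x))
    + (\<Oplus>m n p q. h m n x * g p q x * Om i n k q x * Om m j p l x)
    + ((\<Oplus>m n. Om i j m n x * Om m n k l x)
       - (\<Oplus>m q. Om m j k q x * Om i q m l x))
    + 1/2 * (\<Oplus>m n p s. h m n x * h p s x * nabla i T m p k x * nablab j Tb n s l x)
    + (v_act i j k l x + v_actb i j k l x)"
proof -
  have 1: "der v (Om i j k l) x = D i (Db j S2_up) k l x + D i (Db j Q_up) k l x
     + (\<Oplus>q. Rb i j l q x * (S2_up k q x + Q_up k q x))"
  proof -
    have "Db j (\<lambda>k l x. S2_up k l x + Q_up k l x) = (\<lambda>k l x. Db j S2_up k l x + Db j Q_up k l x)"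
      by (intro ext) (simp add: Db_add)
    then show ?thesis
      using der_Om[of "\<lambda>k l x. S2_up k l x + Q_up k l x" v i j k l x] assms by (simp add: D_add)
  qed
  have 2: "(\<Oplus>m n. h m n x * (\<Oplus>p. R i n k p x * Om m j p l x))
    = (\<Oplus>m n p q. h m n x * g p q x * Om i n k q x * Om m j p l x)"
    by (simp add: R_def sum_distrib_left sum_distrib_right mult_ac)
  have 3: "(\<Oplus>n s. nablab j Tb n s l x * (\<Oplus>m p. h m n x * h p s x * nabla i T m p k x))
    = (\<Oplus>m n p s. h m n x * h p s x * nabla i T m p k x * nablab j Tb n s l x)"
  proof -
    have "(\<Oplus>n s. nablab j Tb n s l x * (\<Oplus>m p. h m n x * h p s x * nabla i T m p k x))
     = (\<Oplus>m p n s. h m n x * h p s x * nabla i T m p k x * nablab j Tb n s l x)"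
      unfolding sum_distrib_left by (subst sum_swap4) (simp add: mult_ac)
    also have "\<dots> = (\<Oplus>m n p s. h m n x * h p s x * nabla i T m p k x * nablab j Tb n s l x)"
      by (rule sum.cong[OF refl], rule sum.swap)
    finally show ?thesis .
  qed
  have 4: "1/2 * (\<Oplus>m n. h m n x * (N m (Nb n Om) i j k l x + Nb n (N m Om) i j k l x))
    = (\<Oplus>m n. h m n x * (Db n (D m (Om i j)) k l x + M m n i j k l x))
      + (\<Oplus>q. Rb i j l q x * S2_up k q x) - v_act i j k l x - v_actb i j k l x"
    by (simp only: distrib_left[of "h _ _ x" "N _ _ _ _ _ _ _"] sum.distrib contract_N_Nb contract_Nb_N S2_act_alt)
      simp
  show ?thesis
    unfolding 1 D_Db_F 2 3 4 by (simp only: algebra_simps)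
qed

end

section \<open>Smooth functions\<close>

lemma Ck_on_cong:
  assumes "\<And>x. x \<in> S \<Longrightarrow> f x = f' x"
  shows "Ck_on k S f \<longleftrightarrow> Ck_on k S f'"
proof (cases k)
  case 0
  then show ?thesis using assms by (simp cong: continuous_on_cong)
next
  case (Suc k)
  have "(f has_derivative D) (at x within S) \<longleftrightarrow> (f' has_derivative D) (at x within S)" if "x \<in> S" for x D
    using assms that by (metis has_derivative_transform)
  then show ?thesis unfolding Suc by simp
qed

lemma Ck_on_SucD: "Ck_on (Suc k) S f \<Longrightarrow> Ck_on k S f"
proof (induction k arbitrary: f)
  case 0
  then show ?case
    by (auto simp: continuous_on_eq_continuous_within intro: has_derivative_continuous)
next
  case (Suc k)
  from Suc.prems obtain f' where "\<forall>x\<in>S. (f has_derivative f' x) (at x within S)"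
    and "\<forall>v. Ck_on (Suc k) S (\<lambda>x. f' x v)" by (subst (asm) Ck_on.simps(2)) blast
  with Suc.IH show ?case by (subst Ck_on.simps(2)) blast
qed

lemma Ck_on_const: "Ck_on k S (\<lambda>_. c)"
proof (induction k arbitrary: c)
  case (Suc k)
  then show ?case by (auto intro!: exI[of _ "\<lambda>_ _. 0"])
qed simp

lemma Ck_on_bounded_linear:
  assumes "bounded_linear L"
  shows "Ck_on k S f \<Longrightarrow> Ck_on k S (\<lambda>x. L (f x))"
proof (induction k arbitrary: f)
  case 0
  then show ?case by (simp add: bounded_linear.continuous_on[OF assms])
next
  case (Suc k)
  then obtain f' where f': "\<forall>x\<in>S. (f has_derivative f' x) (at x within S)" "\<forall>v. Ck_on k S (\<lambda>x. f' x v)"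
    by auto
  then show ?case
    by (auto intro!: exI[of _ "\<lambda>x v. L (f' x v)"] Suc.IH bounded_linear.has_derivative[OF assms])
qed

lemma Ck_on_add: "Ck_on k S f \<Longrightarrow> Ck_on k S f' \<Longrightarrow> Ck_on k S (\<lambda>x. f x + f' x)"
proof (induction k arbitrary: f f')
  case 0
  then show ?case by (simp add: continuous_on_add)
next
  case (Suc k)
  from Suc.prems obtain d d' where
    "\<forall>x\<in>S. (f has_derivative d x) (at x within S)" "\<forall>v. Ck_on k S (\<lambda>x. d x v)"
    "\<forall>x\<in>S. (f' has_derivative d' x) (at x within S)" "\<forall>v. Ck_on k S (\<lambda>x. d' x v)"
    by auto
  then show ?case
    by (auto intro!: exI[of _ "\<lambda>x v. d x v + d' x v"] Suc.IH has_derivative_add)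
qed

lemma Ck_on_mult:
  fixes f f' :: "_ \<Rightarrow> 'b::real_normed_algebra"
  shows "Ck_on k S f \<Longrightarrow> Ck_on k S f' \<Longrightarrow> Ck_on k S (\<lambda>x. f x * f' x)"
proof (induction k arbitrary: f f')
  case 0
  then show ?case by (simp add: continuous_on_mult)
next
  case (Suc k)
  from Suc.prems have "Ck_on k S f" "Ck_on k S f'" by (auto intro: Ck_on_SucD simp del: Ck_on.simps)
  moreover from Suc.prems obtain d d' where
    "\<forall>x\<in>S. (f has_derivative d x) (at x within S)" "\<forall>v. Ck_on k S (\<lambda>x. d x v)"
    "\<forall>x\<in>S. (f' has_derivative d' x) (at x within S)" "\<forall>v. Ck_on k S (\<lambda>x. d' x v)"
    by auto
  ultimately show ?case
    by (auto intro!: exI[of _ "\<lambda>x v. f x * d' x v + d x v * f' x"] Ck_on_add Suc.IH has_derivative_mult)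
qed

lemma Ck_on_inverse:
  fixes f :: "_ \<Rightarrow> 'b::real_normed_field"
  assumes "\<And>x. x \<in> S \<Longrightarrow> f x \<noteq> 0"
  shows "Ck_on k S f \<Longrightarrow> Ck_on k S (\<lambda>x. inverse (f x))"
proof (induction k)
  case 0
  then show ?case using assms by (simp add: continuous_on_inverse)
next
  case (Suc k)
  from Suc.prems have "Ck_on k S f" by (rule Ck_on_SucD)
  with Suc.IH have inv: "Ck_on k S (\<lambda>x. inverse (f x))" by blast
  from Suc.prems obtain d where
    d: "\<forall>x\<in>S. (f has_derivative d x) (at x within S)" "\<forall>v. Ck_on k S (\<lambda>x. d x v)" by auto
  have "Ck_on k S (\<lambda>x. -1 * (inverse (f x) * d x v * inverse (f x)))" for v
    using inv d by (intro Ck_on_mult Ck_on_const) auto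
  moreover have "((\<lambda>x. inverse (f x)) has_derivative (\<lambda>v. -1 * (inverse (f x) * d x v * inverse (f x)))) (at x within S)"
    if "x \<in> S" for x using d that assms by (auto intro!: derivative_eq_intros)
  ultimately show ?case by (auto intro!: exI[of _ "\<lambda>x v. -1 * (inverse (f x) * d x v * inverse (f x))"])
qed

lemma smooth_on_cong: "(\<And>x. x \<in> S \<Longrightarrow> f x = f' x) \<Longrightarrow> smooth_on S f \<longleftrightarrow> smooth_on S f'"
  unfolding smooth_on_def using Ck_on_cong by blast

lemma smooth_on_const: "smooth_on S (\<lambda>_. c)"
  by (simp add: smooth_on_def Ck_on_const)

lemma smooth_on_bounded_linear: "bounded_linear L \<Longrightarrow> smooth_on S f \<Longrightarrow> smooth_on S (\<lambda>x. L (f x))"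
  by (simp add: smooth_on_def Ck_on_bounded_linear)

lemma smooth_on_add: "smooth_on S f \<Longrightarrow> smooth_on S f' \<Longrightarrow> smooth_on S (\<lambda>x. f x + f' x)"
  by (simp add: smooth_on_def Ck_on_add)

lemma smooth_on_mult:
  fixes f f' :: "_ \<Rightarrow> 'b::real_normed_algebra"
  shows "smooth_on S f \<Longrightarrow> smooth_on S f' \<Longrightarrow> smooth_on S (\<lambda>x. f x * f' x)"
  by (simp add: smooth_on_def Ck_on_mult)

lemma smooth_on_inverse:
  fixes f :: "_ \<Rightarrow> 'b::real_normed_field"
  shows "(\<And>x. x \<in> S \<Longrightarrow> f x \<noteq> 0) \<Longrightarrow> smooth_on S f \<Longrightarrow> smooth_on S (\<lambda>x. inverse (f x))"
  by (simp add: smooth_on_def Ck_on_inverse)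

lemma smooth_on_sum: "(\<And>i. i \<in> A \<Longrightarrow> smooth_on S (f i)) \<Longrightarrow> smooth_on S (\<lambda>x. \<Sum>i\<in>A. f i x)"
  by (induction A rule: infinite_finite_induct) (auto intro: smooth_on_const smooth_on_add)

lemma smooth_on_prod:
  fixes f :: "_ \<Rightarrow> _ \<Rightarrow> 'b::{real_normed_algebra,comm_monoid_mult}"
  shows "(\<And>i. i \<in> A \<Longrightarrow> smooth_on S (f i)) \<Longrightarrow> smooth_on S (\<lambda>x. \<Prod>i\<in>A. f i x)"
  by (induction A rule: infinite_finite_induct) (auto intro: smooth_on_const smooth_on_mult)

lemma smooth_on_has_derivative:
  assumes "smooth_on S f"
  obtains f' where "\<And>x. x \<in> S \<Longrightarrow> (f has_derivative f' x) (at x within S)"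
  using assms unfolding smooth_on_def by (metis Ck_on.simps(2))

section \<open>Smoothness of the inverse matrix\<close>

lemma smooth_on_det:
  fixes G :: "_ \<Rightarrow> complex^'n^'n"
  assumes "\<And>i j. smooth_on S (\<lambda>x. G x $ i $ j)"
  shows "smooth_on S (\<lambda>x. det (G x))"
  unfolding det_def by (intro smooth_on_sum smooth_on_mult smooth_on_const smooth_on_prod assms)

lemma matrix_inv_inverse:
  assumes "invertible A"
  shows "A ** matrix_inv A = mat 1" "matrix_inv A ** A = mat 1"
  using assms someI_ex[of "\<lambda>A'. A ** A' = mat 1 \<and> A' ** A = mat 1"]
  by (auto simp: invertible_def matrix_inv_def)

text \<open>Cramer's rule for the right-hand side \<open>axis j 1\<close>; it reduces smoothness of
  the inverse to that of determinants.\<close>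

lemma matrix_inv_eq_det:
  fixes A :: "complex^'n^'n"
  assumes "invertible A"
  shows "matrix_inv A $ k $ j = det (\<chi> i j'. if j' = k then axis j 1 $ i else A $ i $ j') * inverse (det A)"
proof -
  have "A *v (matrix_inv A *v axis j 1) = axis j 1"
    using matrix_inv_inverse(1)[OF assms] by (simp add: matrix_vector_mul_assoc)
  moreover have "det A \<noteq> 0" using assms by (simp add: invertible_det_nz)
  ultimately have "matrix_inv A *v axis j 1 = (\<chi> k. det (\<chi> i j'. if j' = k then axis j 1 $ i else A $ i $ j') / det A)"
    using cramer by blast
  moreover have "(matrix_inv A *v axis j 1) $ k = matrix_inv A $ k $ j"
    by (simp add: matrix_vector_mult_def axis_def if_distrib cong: if_cong)
  ultimately show ?thesis by (simp add: divide_inverse)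
qed

lemma smooth_on_matrix_inv:
  fixes G :: "_ \<Rightarrow> complex^'n^'n"
  assumes "\<And>i j. smooth_on S (\<lambda>x. G x $ i $ j)" and "\<And>x. x \<in> S \<Longrightarrow> invertible (G x)"
  shows "smooth_on S (\<lambda>x. matrix_inv (G x) $ k $ j)"
proof -
  have "smooth_on S (\<lambda>x. det (\<chi> i j'. if j' = k then axis j 1 $ i else G x $ i $ j') * inverse (det (G x)))"
  proof (intro smooth_on_mult smooth_on_inverse smooth_on_det assms(1))
    show "smooth_on S (\<lambda>x. (\<chi> i j'. if j' = k then axis j 1 $ i else G x $ i $ j') $ i $ j')" for i j'
      by (cases "j' = k") (simp_all add: smooth_on_const assms)
    show "det (G x) \<noteq> 0" if "x \<in> S" for x using assms(2)[OF that] by (simp add: invertible_det_nz)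
  qed
  then show ?thesis
    by (subst smooth_on_cong[OF matrix_inv_eq_det[OF assms(2)]])
qed

section \<open>Symmetry of second derivatives\<close>

text \<open>The mean value theorem twice: along v for the increment of \<open>f\<close> in direction
  \<open>s *\<^sub>R w\<close>, then along w for the derivative \<open>f'\<close> in direction
  v.\<close>

lemma second_difference:
  fixes f :: "'a::real_normed_vector \<Rightarrow> real"
  assumes f: "\<And>x. x \<in> S \<Longrightarrow> (f has_derivative f' x) (at x)"
    and fv: "\<And>x. x \<in> S \<Longrightarrow> ((\<lambda>y. f' y v) has_derivative fv x) (at x)"
    and S: "\<And>\<xi> \<eta>. 0 \<le> \<xi> \<Longrightarrow> \<xi> \<le> s \<Longrightarrow> 0 \<le> \<eta> \<Longrightarrow> \<eta> \<le> s \<Longrightarrow> p + \<xi> *\<^sub>R v + \<eta> *\<^sub>R w \<in> S"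
    and "0 < s"
  shows "\<exists>\<xi> \<eta>. 0 < \<xi> \<and> \<xi> < s \<and> 0 < \<eta> \<and> \<eta> < s \<and>
    f (p + s *\<^sub>R v + s *\<^sub>R w) - f (p + s *\<^sub>R v) - f (p + s *\<^sub>R w) + f p = s\<^sup>2 * fv (p + \<xi> *\<^sub>R v + \<eta> *\<^sub>R w) w"
proof -
  have line: "((\<lambda>\<tau>. h (q + \<tau> *\<^sub>R u)) has_real_derivative D u) (at \<tau>)"
    if "(h has_derivative D) (at (q + \<tau> *\<^sub>R u))" for h :: "'a \<Rightarrow> real" and D q u \<tau>
  proof -
    have "((\<lambda>\<tau>. h (q + \<tau> *\<^sub>R u)) has_derivative (\<lambda>e. D (e *\<^sub>R u))) (at \<tau>)"
      by (rule has_derivative_compose[where f = "\<lambda>\<tau>. q + \<tau> *\<^sub>R u" and g = h and g' = D and x = \<tau>, OF _ that]) (auto intro!: derivative_eq_intros)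
    moreover have "(\<lambda>e. D (e *\<^sub>R u)) = (*) (D u)"
      using has_derivative_bounded_linear[OF that] by (auto simp: linear_simps)
    ultimately show ?thesis by (simp add: has_field_derivative_def)
  qed
  define \<phi> where "\<phi> \<tau> = f (p + s *\<^sub>R w + \<tau> *\<^sub>R v) - f (p + \<tau> *\<^sub>R v)" for \<tau>
  have "\<exists>\<xi>. 0 < \<xi> \<and> \<xi> < s \<and> \<phi> s - \<phi> 0 = (s - 0) * (f' (p + s *\<^sub>R w + \<xi> *\<^sub>R v) v - f' (p + \<xi> *\<^sub>R v) v)"
    unfolding \<phi>_def using S[of _ s] S[of _ 0] \<open>0 < s\<close>
    by (intro MVT2 DERIV_diff line f) (auto simp: add_ac)
  then obtain \<xi> where \<xi>: "0 < \<xi>" "\<xi> < s"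
    and 1: "\<phi> s - \<phi> 0 = s * (f' (p + \<xi> *\<^sub>R v + s *\<^sub>R w) v - f' (p + \<xi> *\<^sub>R v) v)"
    by (auto simp: add_ac)
  have "\<exists>\<eta>. 0 < \<eta> \<and> \<eta> < s \<and> f' (p + \<xi> *\<^sub>R v + s *\<^sub>R w) v - f' (p + \<xi> *\<^sub>R v + 0 *\<^sub>R w) v
     = (s - 0) * fv (p + \<xi> *\<^sub>R v + \<eta> *\<^sub>R w) w"
    using S[of \<xi>] \<xi> \<open>0 < s\<close> by (intro MVT2 line fv) auto
  then obtain \<eta> where "0 < \<eta>" "\<eta> < s"
    "f' (p + \<xi> *\<^sub>R v + s *\<^sub>R w) v - f' (p + \<xi> *\<^sub>R v) v = s * fv (p + \<xi> *\<^sub>R v + \<eta> *\<^sub>R w) w"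
    by auto
  with \<xi> 1 show ?thesis
    by (intro exI[of _ \<xi>] exI[of _ \<eta>]) (simp add: \<phi>_def power2_eq_square add_ac)
qed

text \<open>The second difference is symmetric in v and w, so the two mixed derivatives agree at
  some pair of points near p; continuity carries this to p.\<close>

lemma second_derivative_symmetric_real:
  fixes f :: "'a::real_normed_vector \<Rightarrow> real"
  assumes "open S" "p \<in> S"
    and f: "\<And>x. x \<in> S \<Longrightarrow> (f has_derivative f' x) (at x)"
    and fv: "\<And>x. x \<in> S \<Longrightarrow> ((\<lambda>y. f' y v) has_derivative fv x) (at x)"
    and fw: "\<And>x. x \<in> S \<Longrightarrow> ((\<lambda>y. f' y w) has_derivative fw x) (at x)"
    and cont: "continuous_on S (\<lambda>x. fv x w)" "continuous_on S (\<lambda>x. fw x v)"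
  shows "fv p w = fw p v"
proof (rule ccontr)
  assume "fv p w \<noteq> fw p v"
  \<comment> \<open>Half the supposed gap: two values within \<open>e\<close> of its ends cannot
    coincide.\<close>
  define e where "e = \<bar>fv p w - fw p v\<bar> / 2"
  have "e > 0" using \<open>fv p w \<noteq> fw p v\<close> by (simp add: e_def)
  have c: "isCont (\<lambda>x. fv x w) p" "isCont (\<lambda>x. fw x v) p"
    using assms by (auto simp: continuous_on_eq_continuous_at)
  obtain d1 where d1: "d1 > 0" "\<And>x. dist x p < d1 \<Longrightarrow> dist (fv x w) (fv p w) < e"
    using c(1) \<open>e > 0\<close> unfolding continuous_at_eps_delta by metis
  obtain d2 where d2: "d2 > 0" "\<And>x. dist x p < d2 \<Longrightarrow> dist (fw x v) (fw p v) < e"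
    using c(2) \<open>e > 0\<close> unfolding continuous_at_eps_delta by metis
  obtain d3 where d3: "d3 > 0" "ball p d3 \<subseteq> S"
    using assms(1,2) open_contains_ball by blast
  define d where "d = min d1 (min d2 d3)"
  \<comment> \<open>Keeps the whole parallelogram within distance \<open>d\<close> of p; the summand
    1 prevents division by zero.\<close>
  define s where "s = d / (norm v + norm w + 1)"
  have "d > 0" using d1 d2 d3 by (simp add: d_def)
  have pos: "norm v + norm w + 1 > 0" by (simp add: add_nonneg_pos)
  have "s > 0" using \<open>d > 0\<close> pos by (simp add: s_def)
  have near: "dist (p + \<xi> *\<^sub>R v + \<eta> *\<^sub>R w) p < d" if "0 \<le> \<xi>" "\<xi> \<le> s" "0 \<le> \<eta>" "\<eta> \<le> s" for \<xi> \<eta>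
  proof -
    have "dist (p + \<xi> *\<^sub>R v + \<eta> *\<^sub>R w) p \<le> \<xi> * norm v + \<eta> * norm w"
      using that norm_triangle_ineq[of "\<xi> *\<^sub>R v" "\<eta> *\<^sub>R w"] by (simp add: dist_norm add.assoc)
    also have "\<dots> \<le> s * norm v + s * norm w" using that by (intro add_mono mult_right_mono) auto
    also have "\<dots> < s * (norm v + norm w + 1)" using \<open>s > 0\<close> by (simp add: algebra_simps)
    also have "\<dots> = d" using pos by (simp add: s_def)
    finally show ?thesis .
  qed
  have inS: "p + \<xi> *\<^sub>R v + \<eta> *\<^sub>R w \<in> S" if "0 \<le> \<xi>" "\<xi> \<le> s" "0 \<le> \<eta>" "\<eta> \<le> s" for \<xi> \<eta>
    using near[OF that] d3 by (auto simp: d_def dist_commute subset_iff)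
  obtain \<xi> \<eta> where 1: "0 < \<xi>" "\<xi> < s" "0 < \<eta>" "\<eta> < s"
    "f (p + s *\<^sub>R v + s *\<^sub>R w) - f (p + s *\<^sub>R v) - f (p + s *\<^sub>R w) + f p = s\<^sup>2 * fv (p + \<xi> *\<^sub>R v + \<eta> *\<^sub>R w) w"
    using second_difference[OF f fv inS \<open>s > 0\<close>] by auto
  have inS': "p + \<xi> *\<^sub>R w + \<eta> *\<^sub>R v \<in> S" if "0 \<le> \<xi>" "\<xi> \<le> s" "0 \<le> \<eta>" "\<eta> \<le> s" for \<xi> \<eta>
    using inS[OF that(3,4,1,2)] by (simp add: add_ac)
  obtain \<xi>' \<eta>' where 2: "0 < \<xi>'" "\<xi>' < s" "0 < \<eta>'" "\<eta>' < s"
    "f (p + s *\<^sub>R w + s *\<^sub>R v) - f (p + s *\<^sub>R w) - f (p + s *\<^sub>R v) + f p = s\<^sup>2 * fw (p + \<xi>' *\<^sub>R w + \<eta>' *\<^sub>R v) v"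
    using second_difference[OF f fw inS' \<open>s > 0\<close>] by auto
  have eq: "fv (p + \<xi> *\<^sub>R v + \<eta> *\<^sub>R w) w = fw (p + \<eta>' *\<^sub>R v + \<xi>' *\<^sub>R w) v"
  proof -
    have "s\<^sup>2 * fv (p + \<xi> *\<^sub>R v + \<eta> *\<^sub>R w) w = s\<^sup>2 * fw (p + \<eta>' *\<^sub>R v + \<xi>' *\<^sub>R w) v"
      using 1(5) 2(5) by (simp add: algebra_simps)
    then show ?thesis using \<open>s > 0\<close> by simp
  qed
  have "dist (fv (p + \<xi> *\<^sub>R v + \<eta> *\<^sub>R w) w) (fv p w) < e"
    using near[of \<xi> \<eta>] 1 by (intro d1) (auto simp: d_def)
  moreover have "dist (fw (p + \<eta>' *\<^sub>R v + \<xi>' *\<^sub>R w) v) (fw p v) < e"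
    using near[of \<eta>' \<xi>'] 2 by (intro d2) (auto simp: d_def)
  ultimately show False
    unfolding eq e_def dist_real_def by (simp add: abs_if field_simps split: if_splits)
qed

section \<open>Derivatives on the product of an interval and an open set\<close>

locale spacetime =
  fixes I :: "real set" and U :: "'e::euclidean_space set"
  assumes interval: "is_interval I" and nondegenerate: "interior I \<noteq> {}" and open_U: "open U"
begin

text \<open>
  Derivatives are set to zero outside the domain, so that the rules of calculus hold as equations between
  functions; directions are complexified, \<open>(v, w)\<close> standing for \<open>v + \<i> w\<close>.
\<close>

definition dir_deriv :: "real \<times> 'e \<Rightarrow> (real \<times> 'e \<Rightarrow> complex) \<Rightarrow> real \<times> 'e \<Rightarrow> complex" where
  "dir_deriv v f p = (if p \<in> I \<times> U then frechet_derivative f (at p within I \<times> U) v else 0)"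

definition der :: "(real \<times> 'e) \<times> (real \<times> 'e) \<Rightarrow> (real \<times> 'e \<Rightarrow> complex) \<Rightarrow> real \<times> 'e \<Rightarrow> complex" where
  "der v f p = dir_deriv (fst v) f p + \<i> * dir_deriv (snd v) f p"

lemma convex_I: "convex I"
  using interval by (simp add: is_interval_convex)

text \<open>It suffices to find arbitrarily small steps inside the domain along each basis
  direction. At an endpoint of \<open>I\<close> the time step is one-sided, towards another point of
  the convex set \<open>I\<close>.\<close>

lemma derivative_unique:
  assumes "(f has_derivative f') (at p within I \<times> U)" "(f has_derivative f'') (at p within I \<times> U)"
    and p: "p \<in> I \<times> U"
  shows "f' = f''"
proof (rule frechet_derivative_unique_within[OF assms(1,2)])
  fix i :: "real \<times> 'e" and e :: real assume i: "i \<in> Basis" and "e > 0"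
  obtain t x where tx: "p = (t, x)" "t \<in> I" "x \<in> U" using p by auto
  consider "i = (1, 0)" | b where "i = (0, b)" "b \<in> Basis"
    using i by (auto simp: Basis_prod_def)
  then show "\<exists>d. 0 < \<bar>d\<bar> \<and> \<bar>d\<bar> < e \<and> p + d *\<^sub>R i \<in> I \<times> U"
  proof cases
    case 1
    obtain c where "c \<in> interior I" using nondegenerate by auto
    then obtain r where r: "r > 0" "ball c r \<subseteq> I" by (meson mem_interior)
    \<comment> \<open>A point of \<open>I\<close> different from \<open>t\<close>, also when the
      interior point \<open>c\<close> happens to be \<open>t\<close>.\<close>
    define t0 where "t0 = (if c = t then c + r/2 else c)"
    have "t0 \<in> I" "t0 \<noteq> t" using r by (auto simp: t0_def subset_iff dist_real_def)
    \<comment> \<open>The 2 makes the step strictly shorter than \<open>e\<close>; the minimum with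
      1 keeps it on the segment to \<open>t0\<close>.\<close>
    define l where "l = min 1 (e / (2 * \<bar>t0 - t\<bar>))"
    have l: "0 < l" "l \<le> 1" using \<open>e > 0\<close> \<open>t0 \<noteq> t\<close> by (auto simp: l_def)
    have "l * \<bar>t0 - t\<bar> \<le> e / 2"
      using \<open>t0 \<noteq> t\<close> by (simp add: l_def min_def field_simps)
    moreover have "t + l * (t0 - t) \<in> I"
      using convexD_alt[OF convex_I \<open>t \<in> I\<close> \<open>t0 \<in> I\<close>, of l] l by (simp add: algebra_simps)
    ultimately show ?thesis
      using l \<open>t0 \<noteq> t\<close> \<open>e > 0\<close> tx 1 by (intro exI[of _ "l * (t0 - t)"]) (auto simp: abs_mult)
  next
    case 2
    obtain r where r: "r > 0" "ball x r \<subseteq> U" using open_U tx open_contains_ball by blast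
    define d where "d = min r e / 2"
    have "d > 0" "d < r" "d < e" using r \<open>e > 0\<close> by (auto simp: d_def)
    moreover have "x + d *\<^sub>R b \<in> U"
      using r \<open>d > 0\<close> \<open>d < r\<close> 2 by (auto simp: subset_iff dist_norm)
    ultimately show ?thesis using tx 2 by (intro exI[of _ d]) auto
  qed
qed

lemma dir_deriv_eq:
  assumes "(f has_derivative f') (at p within I \<times> U)" "p \<in> I \<times> U"
  shows "dir_deriv v f p = f' v"
proof -
  have "(f has_derivative frechet_derivative f (at p within I \<times> U)) (at p within I \<times> U)"
    using assms(1) by (metis differentiableI frechet_derivative_works)
  then show ?thesis using derivative_unique[OF _ assms(1)] assms(2) by (simp add: dir_deriv_def)
qed

lemma has_derivative_dir_deriv:
  assumes "smooth_on (I \<times> U) f" "p \<in> I \<times> U"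
  shows "(f has_derivative (\<lambda>v. dir_deriv v f p)) (at p within I \<times> U)"
proof -
  obtain f' where f': "(f has_derivative f') (at p within I \<times> U)"
    using smooth_on_has_derivative[OF assms(1)] assms(2) by metis
  then show ?thesis using dir_deriv_eq[OF f' assms(2)] by simp
qed

lemma smooth_dir_deriv:
  assumes "smooth_on (I \<times> U) f"
  shows "smooth_on (I \<times> U) (dir_deriv v f)"
  unfolding smooth_on_def
proof
  fix k
  have "Ck_on (Suc k) (I \<times> U) f" using assms by (simp add: smooth_on_def del: Ck_on.simps)
  then obtain f' where f': "\<forall>x\<in>I \<times> U. (f has_derivative f' x) (at x within I \<times> U)" "\<forall>v. Ck_on k (I \<times> U) (\<lambda>x. f' x v)"
    by (auto simp del: mem_Sigma_iff)
  have "Ck_on k (I \<times> U) (\<lambda>x. f' x v) \<longleftrightarrow> Ck_on k (I \<times> U) (dir_deriv v f)"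
    using f'(1) by (intro Ck_on_cong) (metis dir_deriv_eq)
  with f'(2) show "Ck_on k (I \<times> U) (dir_deriv v f)" by blast
qed

lemma dir_deriv_outside: "p \<notin> I \<times> U \<Longrightarrow> dir_deriv v f p = 0"
  unfolding dir_deriv_def by simp

lemma dir_deriv_const: "dir_deriv v (\<lambda>_. c) p = 0"
  using dir_deriv_eq[OF has_derivative_const] dir_deriv_outside by metis

lemma dir_deriv_add:
  assumes "smooth_on (I \<times> U) f" "smooth_on (I \<times> U) f'"
  shows "dir_deriv v (\<lambda>x. f x + f' x) p = dir_deriv v f p + dir_deriv v f' p"
  using dir_deriv_eq[OF has_derivative_add[OF has_derivative_dir_deriv[OF assms(1)] has_derivative_dir_deriv[OF assms(2)]]]
  by (cases "p \<in> I \<times> U") (auto simp: dir_deriv_outside simp del: mem_Sigma_iff)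

lemma dir_deriv_mult:
  assumes "smooth_on (I \<times> U) f" "smooth_on (I \<times> U) f'"
  shows "dir_deriv v (\<lambda>x. f x * f' x) p = dir_deriv v f p * f' p + f p * dir_deriv v f' p"
  using dir_deriv_eq[OF has_derivative_mult[OF has_derivative_dir_deriv[OF assms(1)] has_derivative_dir_deriv[OF assms(2)]]]
  by (cases "p \<in> I \<times> U") (auto simp: dir_deriv_outside simp del: mem_Sigma_iff)

lemma dir_deriv_linear:
  assumes "smooth_on (I \<times> U) f"
  shows "dir_deriv (v + w) f p = dir_deriv v f p + dir_deriv w f p" "dir_deriv (c *\<^sub>R v) f p = c *\<^sub>R dir_deriv v f p"
proof -
  have "dir_deriv (v + w) f p = dir_deriv v f p + dir_deriv w f p \<and> dir_deriv (c *\<^sub>R v) f p = c *\<^sub>R dir_deriv v f p"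
  proof (cases "p \<in> I \<times> U")
    case True
    then interpret bounded_linear "\<lambda>v. dir_deriv v f p"
      using has_derivative_dir_deriv[OF assms] has_derivative_bounded_linear by blast
    show ?thesis by (simp add: add scaleR)
  qed (simp add: dir_deriv_outside del: mem_Sigma_iff)
  then show "dir_deriv (v + w) f p = dir_deriv v f p + dir_deriv w f p" "dir_deriv (c *\<^sub>R v) f p = c *\<^sub>R dir_deriv v f p" by auto
qed

lemma smooth_continuous: "smooth_on (I \<times> U) f \<Longrightarrow> continuous_on (I \<times> U) f"
  unfolding smooth_on_def by (metis Ck_on.simps(1))

lemma dir_deriv_comm_interior:
  assumes f: "smooth_on (I \<times> U) f" and p: "p \<in> interior I \<times> U"
  shows "dir_deriv v (dir_deriv w f) p = dir_deriv w (dir_deriv v f) p"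
proof -
  have sub: "interior I \<times> U \<subseteq> I \<times> U" using interior_subset by blast
  have op: "open (interior I \<times> U)" by (simp add: open_Times open_U)
  have at: "at x within I \<times> U = at x" if "x \<in> interior I \<times> U" for x
    using at_within_open_subset[OF that op sub] .
  have hd: "(g has_derivative (\<lambda>v. dir_deriv v g x)) (at x)" if "x \<in> interior I \<times> U" "smooth_on (I \<times> U) g" for g x
    using has_derivative_dir_deriv[OF that(2)] sub that(1) at[OF that(1)] by (metis subsetD)
  have cont: "continuous_on (interior I \<times> U) (dir_deriv v (dir_deriv w f))" for v w
    using continuous_on_subset[OF smooth_continuous[OF smooth_dir_deriv[OF smooth_dir_deriv[OF f]]] sub] .
  \<comment> \<open>The symmetry lemma concerns real functions, so it is tested with real
    functionals, afterwards the real and imaginary part.\<close>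
  have "L (dir_deriv w (dir_deriv v f) p) = L (dir_deriv v (dir_deriv w f) p)" if L: "bounded_linear L" for L :: "complex \<Rightarrow> real"
  proof (rule second_derivative_symmetric_real[OF op p, where f = "\<lambda>x. L (f x)" and f' = "\<lambda>x v. L (dir_deriv v f x)"
        and fv = "\<lambda>x u. L (dir_deriv u (dir_deriv v f) x)" and fw = "\<lambda>x u. L (dir_deriv u (dir_deriv w f) x)"])
    fix x assume x: "x \<in> interior I \<times> U"
    show "((\<lambda>x. L (f x)) has_derivative (\<lambda>v. L (dir_deriv v f x))) (at x)"
      by (rule bounded_linear.has_derivative[OF L hd[OF x f]])
    have "((\<lambda>y. L (dir_deriv u f y)) has_derivative (\<lambda>v. L (dir_deriv v (dir_deriv u f) x))) (at x)" for u
      by (rule bounded_linear.has_derivative[OF L hd[OF x smooth_dir_deriv[OF f]]])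
    from this[of v] this[of w]
    show "((\<lambda>y. L (dir_deriv v f y)) has_derivative (\<lambda>u. L (dir_deriv u (dir_deriv v f) x))) (at x)"
      "((\<lambda>y. L (dir_deriv w f y)) has_derivative (\<lambda>u. L (dir_deriv u (dir_deriv w f) x))) (at x)" .
  qed (rule bounded_linear.continuous_on[OF L cont])+
  from this[OF bounded_linear_Re] this[OF bounded_linear_Im] show ?thesis
    by (simp add: complex_eq_iff)
qed

text \<open>At an endpoint of \<open>I\<close> symmetry follows by continuity from the interior.\<close>

lemma dir_deriv_comm:
  assumes f: "smooth_on (I \<times> U) f"
  shows "dir_deriv v (dir_deriv w f) p = dir_deriv w (dir_deriv v f) p"
proof (cases "p \<in> I \<times> U")
  case True
  then obtain t x where p: "p = (t, x)" "t \<in> I" "x \<in> U" by auto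
  obtain c where c: "c \<in> interior I" using nondegenerate by auto
  define q where "q \<tau> = (t + \<tau> * (c - t), x)" for \<tau> :: real
  define h where "h \<tau> = dir_deriv v (dir_deriv w f) (q \<tau>) - dir_deriv w (dir_deriv v f) (q \<tau>)" for \<tau>
  have q_int: "q \<tau> \<in> interior I \<times> U" if "0 < \<tau>" "\<tau> \<le> 1" for \<tau>
    using mem_interior_convex_shrink[OF convex_I c p(2) that] p by (simp add: q_def algebra_simps)
  have q: "q \<tau> \<in> I \<times> U" if "\<tau> \<in> {0..1}" for \<tau>
    using q_int[of \<tau>] that p interior_subset[of I] by (cases "\<tau> = 0") (auto simp: q_def)
  have "continuous_on {0..1} q" unfolding q_def by (intro continuous_intros)
  then have cq: "continuous_on {0..1} (\<lambda>\<tau>. k (q \<tau>))" if "smooth_on (I \<times> U) k" for k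
    by (rule continuous_on_compose2[OF smooth_continuous[OF that]]) (use q in blast)
  have "continuous_on {0..1} h"
    unfolding h_def by (intro continuous_on_diff cq smooth_dir_deriv f)
  moreover have "closure {0<..1::real} = {0..1}" by simp
  ultimately have "continuous_on (closure {0<..1}) h" by simp
  moreover have "\<forall>\<tau>\<in>{0<..1}. h \<tau> = 0"
    using q_int dir_deriv_comm_interior[OF f] by (auto simp: h_def)
  ultimately have "h 0 = 0"
    using continuous_constant_on_closure[of "{0<..1}" h 0 0] by auto
  then show ?thesis by (simp add: h_def q_def p)
qed (simp add: dir_deriv_outside del: mem_Sigma_iff)

sublocale derivation_algebra "smooth_on (I \<times> U)" der
proof
  fix f f' :: "real \<times> 'e \<Rightarrow> complex" and v w and c :: complex and x
  show "smooth_on (I \<times> U) (\<lambda>_. c)" by (rule smooth_on_const)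
  show "der v (\<lambda>_. c) x = 0" by (simp add: der_def dir_deriv_const)
  assume f: "smooth_on (I \<times> U) f"
  then show "smooth_on (I \<times> U) (der v f)" unfolding der_def
    by (intro smooth_on_add smooth_on_mult smooth_on_const smooth_dir_deriv)
  have *: "dir_deriv u (der v f) p = dir_deriv u (dir_deriv (fst v) f) p + \<i> * dir_deriv u (dir_deriv (snd v) f) p" for u v p
  proof -
    have s: "smooth_on (I \<times> U) (dir_deriv w f)" for w by (rule smooth_dir_deriv[OF f])
    have "dir_deriv u (\<lambda>p. \<i> * dir_deriv (snd v) f p) p = \<i> * dir_deriv u (dir_deriv (snd v) f) p"
      using dir_deriv_mult[OF smooth_on_const s, of u \<i> "snd v" p] by (simp add: dir_deriv_const)
    then show ?thesis
      unfolding der_def using dir_deriv_add[OF s smooth_on_mult[OF smooth_on_const s], of u "fst v" \<i> "snd v" p] by simp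
  qed
  show "der v (der w f) = der w (der v f)"
  proof
    fix p show "der v (der w f) p = der w (der v f) p"
      unfolding der_def[of v "der w f"] der_def[of w "der v f"] *
      by (simp add: dir_deriv_comm[OF f, of _ "fst v"] dir_deriv_comm[OF f, of _ "snd v"] algebra_simps)
  qed
  assume f': "smooth_on (I \<times> U) f'"
  show "smooth_on (I \<times> U) (\<lambda>x. f x + f' x)" "smooth_on (I \<times> U) (\<lambda>x. f x * f' x)"
    using f f' by (auto intro: smooth_on_add smooth_on_mult)
  show "der v (\<lambda>x. f x + f' x) x = der v f x + der v f' x"
    "der v (\<lambda>x. f x * f' x) x = der v f x * f' x + f x * der v f' x"
    using f f' by (simp_all add: der_def dir_deriv_add dir_deriv_mult algebra_simps)
qed

section \<open>Slices at fixed time and at a fixed point\<close>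

lemma has_derivative_space:
  assumes "smooth_on (I \<times> U) f" "t \<in> I" "x \<in> U"
  shows "((\<lambda>y. f (t, y)) has_derivative (\<lambda>v. dir_deriv (0, v) f (t, x))) (at x)"
proof -
  have "((\<lambda>y. f (t, y)) has_derivative (\<lambda>v. dir_deriv (0, v) f (t, x))) (at x within U)"
    using assms
    by (intro has_derivative_in_compose2[of "I \<times> U" f "\<lambda>p v. dir_deriv v f p" "\<lambda>y. (t, y)"])
       (auto intro!: has_derivative_dir_deriv derivative_eq_intros)
  then show ?thesis using at_within_open[OF assms(3) open_U] by simp
qed

lemma has_vector_derivative_time:
  assumes f: "smooth_on (I \<times> U) f" and "t \<in> I" "x \<in> U"
  shows "((\<lambda>s. f (s, x)) has_vector_derivative dir_deriv (1, 0) f (t, x)) (at t within I)"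
proof -
  have "((\<lambda>s. f (s, x)) has_derivative (\<lambda>e. dir_deriv (e, 0) f (t, x))) (at t within I)"
    using assms
    by (intro has_derivative_in_compose2[of "I \<times> U" f "\<lambda>p v. dir_deriv v f p" "\<lambda>s. (s, x)"])
       (auto intro!: has_derivative_dir_deriv derivative_eq_intros)
  moreover have "(\<lambda>e. dir_deriv (e, 0) f (t, x)) = (\<lambda>e. e *\<^sub>R dir_deriv (1, 0) f (t, x))"
  proof
    show "dir_deriv (e, 0) f (t, x) = e *\<^sub>R dir_deriv (1, 0) f (t, x)" for e
      using dir_deriv_linear(2)[OF f, of e "(1,0)"] by simp
  qed
  ultimately show ?thesis unfolding has_vector_derivative_def by simp
qed

end

section \<open>A family of Hermitian metrics in a chart\<close>

lemma Jst_axis: "Jst (axis i 1) = axis i \<i>"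
  by (simp add: Jst_def vec_eq_iff axis_def)

lemma Jst_Jst: "Jst (Jst v) = - v"
  by (simp add: Jst_def vec_eq_iff flip: mult.assoc)

lemma Jst_minus: "Jst (- v) = - Jst v"
  by (simp add: Jst_def vec_eq_iff)

text \<open>The Hermitian form whose real part is \<open>b\<close>, complex linear in the first
  argument when \<open>b\<close> is symmetric and \<open>J\<close>-invariant.\<close>

definition herm :: "(complex^'n \<Rightarrow> complex^'n \<Rightarrow> real) \<Rightarrow> complex^'n \<Rightarrow> complex^'n \<Rightarrow> complex" where
  "herm b u v = of_real (b u v) + \<i> * of_real (b u (Jst v))"

locale J_metric =
  fixes b :: "complex^'n::finite \<Rightarrow> complex^'n \<Rightarrow> real"
  assumes bilin: "bilinear b" and sym: "b u v = b v u" and pos: "u \<noteq> 0 \<Longrightarrow> b u u > 0"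
    and J: "b (Jst u) (Jst v) = b u v"
begin

lemma J_left: "b (Jst u) v = - b u (Jst v)"
  using J[of u "Jst v"] by (simp add: Jst_Jst bilinear_rneg[OF bilin])

lemma herm_cnj: "cnj (herm b u v) = herm b v u"
  using J_left[of u v] by (simp add: herm_def sym[of v u] sym[of v "Jst u"])

lemma herm_left: "herm b (u + u') v = herm b u v + herm b u' v" "herm b (c *s u) v = c * herm b u v"
proof -
  show "herm b (u + u') v = herm b u v + herm b u' v"
    by (simp add: herm_def bilinear_ladd[OF bilin] algebra_simps)
  have c: "c *s u = Re c *\<^sub>R u + Im c *\<^sub>R Jst u"
    by (simp add: Jst_def vec_eq_iff complex_eq_iff)
  show "herm b (c *s u) v = c * herm b u v"
    unfolding c herm_def
    by (simp add: bilinear_ladd[OF bilin] bilinear_lmul[OF bilin] J_left Jst_Jst bilinear_rneg[OF bilin] complex_eq_iff algebra_simps)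
qed

lemma herm_sum_left: "herm b (\<Sum>i\<in>A. f i) v = (\<Sum>i\<in>A. herm b (f i) v)"
  using herm_left(2)[of 0 0 v] by (induction A rule: infinite_finite_induct) (auto simp: herm_left)

lemma herm_right_scale: "herm b u (c *s v) = cnj c * herm b u v"
  using arg_cong[OF herm_left(2)[of c v u], of cnj] by (simp add: herm_cnj)

lemma herm_sum_right: "herm b v (\<Sum>i\<in>A. f i) = (\<Sum>i\<in>A. herm b v (f i))"
  using arg_cong[OF herm_sum_left[of f A v], of cnj] by (simp add: herm_cnj)

lemma vec_expand: "u = (\<Oplus>i. u $ i *s axis i (1::complex))"
  by (rule basis_expansion[symmetric])

lemma herm_expand: "herm b u v = (\<Oplus>i j. u $ i * cnj (v $ j) * herm b (axis i 1) (axis j 1))"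
  by (subst vec_expand[of u], subst vec_expand[of v])
    (simp add: herm_sum_left herm_sum_right herm_left(2) herm_right_scale sum_distrib_left mult_ac,
     rule sum.swap)

lemma herm_same: "herm b u u = of_real (b u u)"
proof -
  have "b u (Jst u) = 0" using J_left[of u u] sym[of u "Jst u"] by simp
  then show ?thesis by (simp add: herm_def)
qed

end

text \<open>By \<open>J\<close>-invariance the four terms of \<open>g_comp\<close> agree in pairs,
  which turns 1/4 into 1/2.\<close>

lemma g_comp_eq_herm:
  assumes "J_metric (H x)"
  shows "g_comp H x $ i $ j = herm (H x) (axis i 1) (axis j 1) / 2"
proof -
  interpret J_metric "H x" by fact
  show ?thesis by (simp add: g_comp_def herm_def J J_left Jst_Jst bilinear_rneg[OF bilin] Let_def)
qed

lemma g_comp_hermitian: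
  assumes "J_metric (H x)"
  shows "cnj (g_comp H x $ i $ j) = g_comp H x $ j $ i"
  using J_metric.herm_cnj[OF assms] by (simp add: g_comp_eq_herm[where H = H, OF assms])

lemma g_comp_form:
  assumes "J_metric (H x)"
  shows "(\<Oplus>i j. u $ i * cnj (v $ j) * g_comp H x $ i $ j) = herm (H x) u v / 2"
  by (simp add: g_comp_eq_herm[where H = H, OF assms] J_metric.herm_expand[OF assms, of u v] sum_divide_distrib)

text \<open>A kernel vector would make the metric vanish on its conjugate. The conjugate is needed
  because the matrix multiplies the index in which the form is antilinear.\<close>

lemma g_comp_invertible:
  assumes "J_metric (H x)"
  shows "invertible (g_comp H x)"
proof -
  interpret J_metric "H x" by fact
  have "u = 0" if "g_comp H x *v u = 0" for u
  proof (rule ccontr)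
    assume "u \<noteq> 0"
    have "(\<Oplus>j. g_comp H x $ i $ j * u $ j) = 0" for i
      using that by (simp add: matrix_vector_mult_def vec_eq_iff)
    then have "(\<Oplus>i. cnj (u $ i) * (\<Oplus>j. g_comp H x $ i $ j * u $ j)) = 0" by simp
    moreover have "(\<Oplus>i. cnj (u $ i) * (\<Oplus>j. g_comp H x $ i $ j * u $ j))
       = (\<Oplus>i j. (\<chi> k. cnj (u $ k)) $ i * cnj ((\<chi> k. cnj (u $ k)) $ j) * g_comp H x $ i $ j)"
      by (simp add: sum_distrib_left mult_ac)
    moreover note g_comp_form[where H = H, OF assms, of "\<chi> k. cnj (u $ k)" "\<chi> k. cnj (u $ k)"]
    ultimately have "H x (\<chi> k. cnj (u $ k)) (\<chi> k. cnj (u $ k)) = 0"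
      by (simp only: herm_same) simp
    moreover have "(\<chi> k. cnj (u $ k)) \<noteq> 0" using \<open>u \<noteq> 0\<close> by (simp add: vec_eq_iff)
    ultimately show False using pos by fastforce
  qed
  then show ?thesis
    by (simp add: invertible_left_inverse matrix_left_invertible_ker)
qed

lemma g_inv_contract:
  assumes "invertible (G x)"
  shows "(\<Oplus>q. g_inv G x k q * G x $ p $ q) = (if k = p then 1 else 0)"
    "(\<Oplus>p. g_inv G x p l * G x $ p $ q) = (if l = q then 1 else 0)"
proof -
  have "(G x ** matrix_inv (G x)) $ p $ k = (mat 1 :: complex^'a^'a) $ p $ k"
    "(matrix_inv (G x) ** G x) $ l $ q = (mat 1 :: complex^'a^'a) $ l $ q"
    by (simp_all add: matrix_inv_inverse[OF assms])
  then show "(\<Oplus>q. g_inv G x k q * G x $ p $ q) = (if k = p then 1 else 0)"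
    "(\<Oplus>p. g_inv G x p l * G x $ p $ q) = (if l = q then 1 else 0)"
    by (auto simp: matrix_matrix_mult_def g_inv_def mat_def mult.commute)
qed

text \<open>The conjugate transpose of \<open>h\<close> is again an inverse of \<open>g\<close>, and
  inverses are unique.\<close>

lemma inverse_hermitian:
  fixes h g :: "'n::finite \<Rightarrow> 'n \<Rightarrow> complex"
  assumes hg: "\<And>k p. (\<Oplus>q. h k q * g p q) = (if k = p then 1 else 0)"
    and gh: "\<And>l q. (\<Oplus>p. h p l * g p q) = (if l = q then 1 else 0)"
    and g: "\<And>p q. cnj (g p q) = g q p"
  shows "cnj (h k l) = h l k"
proof -
  have "cnj (h k l) = (\<Oplus>q. (if q = k then 1 else 0) * cnj (h q l))" 
    by (simp add: if_distrib[of "\<lambda>x. x * _"] cong: if_cong)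
  also have "\<dots> = (\<Oplus>q p. h p k * g p q * cnj (h q l))"
  proof -
    have "(if q = k then 1 else 0) = (\<Oplus>p. h p k * g p q)" for q
      using gh[of k q] by auto
    then show ?thesis by (simp add: sum_distrib_right)
  qed
  also have "\<dots> = (\<Oplus>p. h p k * cnj (\<Oplus>q. h q l * g q p))"
    by (subst sum.swap) (simp add: sum_distrib_left g mult_ac)
  also have "\<dots> = h l k"
    by (simp add: gh if_distrib cong: if_cong)
  finally show ?thesis .
qed

locale metric_chart = spacetime I U for I :: "real set" and U :: "(complex^'n::finite) set" +
  fixes H :: "real \<Rightarrow> 'n local_metric"
  assumes smooth_H: "smooth_on (I \<times> U) (\<lambda>(t, x). H t x u v)"
    and J_metric: "t \<in> I \<Longrightarrow> x \<in> U \<Longrightarrow> J_metric (H t x)"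
begin

text \<open>The identity matrix outside the domain lets the inverse relations hold at every point,
  as \<open>inverse_metric\<close> demands.\<close>

definition gmat :: "'n \<Rightarrow> 'n \<Rightarrow> real \<times> (complex^'n) \<Rightarrow> complex" where
  "gmat k l p = (if p \<in> I \<times> U then g_comp (H (fst p)) (snd p) $ k $ l else if k = l then 1 else 0)"

definition ginv :: "'n \<Rightarrow> 'n \<Rightarrow> real \<times> (complex^'n) \<Rightarrow> complex" where
  "ginv k l p = (if p \<in> I \<times> U then g_inv (g_comp (H (fst p))) (snd p) k l else if k = l then 1 else 0)"

definition dir_z :: "'n \<Rightarrow> (real \<times> (complex^'n)) \<times> (real \<times> (complex^'n))" where
  "dir_z i = ((0, (1/2) *\<^sub>R axis i 1), (0, - (1/2) *\<^sub>R Jst (axis i 1)))"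

definition dir_zbar :: "'n \<Rightarrow> (real \<times> (complex^'n)) \<times> (real \<times> (complex^'n))" where
  "dir_zbar i = ((0, (1/2) *\<^sub>R axis i 1), (0, (1/2) *\<^sub>R Jst (axis i 1)))"

lemma smooth_g_comp: "smooth_on (I \<times> U) (\<lambda>p. g_comp (H (fst p)) (snd p) $ k $ l)"
proof -
  have s: "smooth_on (I \<times> U) (\<lambda>p. complex_of_real (H (fst p) (snd p) u v))" for u v
    using smooth_on_bounded_linear[OF bounded_linear_of_real smooth_H[of u v]] by (simp add: case_prod_beta)
  have "smooth_on (I \<times> U) (\<lambda>p. (1/2) * (of_real (H (fst p) (snd p) (axis k 1) (axis l 1))
      + \<i> * of_real (H (fst p) (snd p) (axis k 1) (Jst (axis l 1)))))"
    by (intro smooth_on_mult smooth_on_add smooth_on_const s)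
  then show ?thesis
    by (subst smooth_on_cong[where f' = "\<lambda>p. (1/2) * (of_real (H (fst p) (snd p) (axis k 1) (axis l 1))
      + \<i> * of_real (H (fst p) (snd p) (axis k 1) (Jst (axis l 1))))"])
     (auto simp: g_comp_eq_herm[where H = "H _", OF J_metric] herm_def)
qed

sublocale inverse_metric "smooth_on (I \<times> U)" der dir_z dir_zbar ginv gmat
proof
  fix k l p q x
  have inv: "invertible (g_comp (H (fst p)) (snd p))" if "p \<in> I \<times> U" for p
    using that by (auto intro!: g_comp_invertible J_metric)
  show "smooth_on (I \<times> U) (gmat k l)"
    using smooth_g_comp[of k l] by (subst smooth_on_cong) (auto simp: gmat_def simp del: mem_Sigma_iff)
  have "smooth_on (I \<times> U) (\<lambda>p. matrix_inv (g_comp (H (fst p)) (snd p)) $ l $ k)"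
    by (rule smooth_on_matrix_inv[OF smooth_g_comp inv])
  then show "smooth_on (I \<times> U) (ginv k l)"
    by (subst smooth_on_cong) (auto simp: ginv_def g_inv_def simp del: mem_Sigma_iff)
  show "(\<Oplus>q. ginv k q x * gmat p q x) = (if k = p then 1 else 0)"
  proof (cases "x \<in> I \<times> U")
    case True
    then show ?thesis
      using g_inv_contract(1)[of "g_comp (H (fst x))" "snd x" k p] inv[of x]
      by (simp add: gmat_def ginv_def del: mem_Sigma_iff)
  next
    case False
    then show ?thesis
      by (simp add: gmat_def ginv_def if_distrib[of "\<lambda>x. x * _"] del: mem_Sigma_iff cong: if_cong)
  qed
  show "(\<Oplus>p. ginv p l x * gmat p q x) = (if l = q then 1 else 0)"
  proof (cases "x \<in> I \<times> U")
    case True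
    then show ?thesis
      using g_inv_contract(2)[of "g_comp (H (fst x))" "snd x" l q] inv[of x]
      by (simp add: gmat_def ginv_def del: mem_Sigma_iff)
  next
    case False
    then show ?thesis
      by (simp add: gmat_def ginv_def if_distrib[of "\<lambda>x. x * _"] del: mem_Sigma_iff cong: if_cong)
  qed
qed

lemma gmat_cnj: "cnj (gmat k l p) = gmat l k p"
  by (auto simp: gmat_def intro!: g_comp_hermitian J_metric)

lemma ginv_cnj: "cnj (ginv k l p) = ginv l k p"
  using inverse_hermitian[of "\<lambda>k l. ginv k l p" "\<lambda>k l. gmat k l p"] hg gh gmat_cnj by simp

lemma gmat_chart: "t \<in> I \<Longrightarrow> x \<in> U \<Longrightarrow> gmat k l (t, x) = g_comp (H t) x $ k $ l"
  by (simp add: gmat_def)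

lemma ginv_chart: "t \<in> I \<Longrightarrow> x \<in> U \<Longrightarrow> ginv k l (t, x) = g_inv (g_comp (H t)) x k l"
  by (simp add: ginv_def)

text \<open>Agreement on the open set \<open>U\<close> is enough, so the rule can be iterated:
  \<open>F\<close> may itself be a coordinate derivative that is known only there.\<close>

lemma dz_der:
  assumes "smooth_on (I \<times> U) f" "t \<in> I" "x \<in> U" and F: "\<And>y. y \<in> U \<Longrightarrow> F y = f (t, y)"
  shows "dz i F x = der (dir_z i) f (t, x)" "dzbar i F x = der (dir_zbar i) f (t, x)"
proof -
  have "(F has_derivative (\<lambda>v. dir_deriv (0, v) f (t, x))) (at x)"
    using has_derivative_space[OF assms(1-3)]
    by (rule has_derivative_transform_within_open[OF _ open_U assms(3)]) (simp add: F)
  then have fd: "frechet_derivative F (at x) v = dir_deriv (0, v) f (t, x)" for v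
    by (metis frechet_derivative_at)
  have *: "dir_deriv (0, c *\<^sub>R v) f (t, x) = c *\<^sub>R dir_deriv (0, v) f (t, x)" for c v
    using dir_deriv_linear(2)[OF assms(1), of c "(0, v)"] by simp
  show "dz i F x = der (dir_z i) f (t, x)" "dzbar i F x = der (dir_zbar i) f (t, x)"
    unfolding dz_def dzbar_def fd der_def dir_z_def dir_zbar_def fst_conv snd_conv *
    by (simp_all add: scaleR_conv_of_real field_simps)
qed

lemma cnj_der:
  assumes "smooth_on (I \<times> U) f"
  shows "cnj (der (v, w) f p) = der (v, - w) (\<lambda>q. cnj (f q)) p"
proof -
  have s: "smooth_on (I \<times> U) (\<lambda>q. cnj (f q))"
    by (rule smooth_on_bounded_linear[OF bounded_linear_cnj assms])
  have c: "dir_deriv v (\<lambda>q. cnj (f q)) p = cnj (dir_deriv v f p)" for v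
    using dir_deriv_eq[OF bounded_linear.has_derivative[OF bounded_linear_cnj has_derivative_dir_deriv[OF assms]]]
    by (cases "p \<in> I \<times> U") (auto simp: dir_deriv_outside simp del: mem_Sigma_iff)
  have "dir_deriv (- w) (\<lambda>q. cnj (f q)) p = - dir_deriv w (\<lambda>q. cnj (f q)) p"
    using dir_deriv_linear(2)[OF s, of "-1" w p] by simp
  then show ?thesis by (simp add: der_def c)
qed

lemma cnj_der_dir_z: "smooth_on (I \<times> U) f \<Longrightarrow> cnj (der (dir_z i) f p) = der (dir_zbar i) (\<lambda>q. cnj (f q)) p"
  and cnj_der_dir_zbar: "smooth_on (I \<times> U) f \<Longrightarrow> cnj (der (dir_zbar i) f p) = der (dir_z i) (\<lambda>q. cnj (f q)) p"
  by (simp_all add: dir_z_def dir_zbar_def cnj_der)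

text \<open>Here Hermitian symmetry enters: the formal duals become honest complex
  conjugates.\<close>

lemma B_cnj: "cnj (B m p k x) = Bb m p k x"
  by (simp add: B_def Bb_def cnj_der_dir_z gmat_cnj ginv_cnj)

lemma T_cnj: "cnj (T m p k x) = Tb m p k x"
  by (simp add: T_def Tb_def B_cnj)

lemma Om_cnj: "cnj (Om i j k l x) = Om j i l k x"
  by (simp add: Om_def[of i] Om_alt[of j] cnj_der_dir_z cnj_der_dir_zbar ginv_cnj B_cnj)

lemma nabla_cnj: "cnj (nabla i T m p k x) = nablab i Tb m p k x"
  by (simp add: nabla_def nablab_def B_cnj T_cnj cnj_der_dir_z)

end

section \<open>Comparison with the coordinate formulas in terms of the metric itself\<close>

context inverse_metric
begin

lemma B_alt: "B m p k x = - (\<Oplus>q. h k q x * der (a m) (g p q) x)"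
proof -
  have "(\<Oplus>q. h k q x * (\<Oplus>c. B m p c x * g c q x)) = (\<Oplus>c. B m p c x * (\<Oplus>q. h k q x * g c q x))"
    by (simp add: sum_distrib_left mult_ac) (rule sum.swap)
  then show ?thesis by (simp add: der_g sum_negf hg if_distrib cong: if_cong)
qed

lemma T_alt: "T i j k x = (\<Oplus>l. h k l x * (der (a i) (g j l) x - der (a j) (g i l) x))"
  by (simp add: T_def B_alt sum_subtractf algebra_simps)

text \<open>The left side is the coordinate formula for the Chern curvature. Differentiating
  \<open>derb_g\<close> gives the curvature through \<open>der_Bb\<close> and a product of
  Christoffel symbols, which the second sum removes.\<close>

lemma lower_Om: "- der (a i) (der (b j) (g k l)) x
    + (\<Oplus>p s. h p s x * der (b j) (g p l) x * der (a i) (g k s) x)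
   = (\<Oplus>c. Rb i j c l x * g k c x)"
proof -
  have 1: "der (a i) (der (b j) (g k l)) x = - (\<Oplus>c. Rb i j c l x * g k c x)
     + (\<Oplus>c. Bb j l c x * (\<Oplus>d. B i k d x * g d c x))"
    unfolding derb_g[abs_def] by (simp add: der_g der_Bb sum.distrib sum_subtractf)
  have "(\<Oplus>p s. h p s x * der (b j) (g p l) x * der (a i) (g k s) x)
    = - (\<Oplus>p. B i k p x * der (b j) (g p l) x)"
    unfolding B_alt by (simp add: sum_distrib_left sum_distrib_right sum_negf mult_ac)
  also have "\<dots> = (\<Oplus>c. Bb j l c x * (\<Oplus>d. B i k d x * g d c x))"
    by (simp add: derb_g sum_distrib_left sum_negf mult_ac) (rule sum.swap)
  finally show ?thesis unfolding 1 by simp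
qed

lemma raise_lower_Om: "(\<Oplus>m n. (\<Oplus>c. Rb i j c n x * g m c x) * h m l x * h k n x) = Om i j k l x"
proof -
  have 1: "(\<Oplus>m. (\<Oplus>c. Rb i j c n x * g m c x) * h m l x) = Rb i j l n x" for n
    by (rule hg_contract)
  have "(\<Oplus>m n. (\<Oplus>c. Rb i j c n x * g m c x) * h m l x * h k n x)
    = (\<Oplus>n. (\<Oplus>m. (\<Oplus>c. Rb i j c n x * g m c x) * h m l x) * h k n x)"
    unfolding sum_distrib_right[of _ _ "h k _ x"] by (rule sum.swap)
  then show ?thesis unfolding 1 by (simp add: contract_Rb mult.commute)
qed

text \<open>Identifies the trace in \<open>v_act\<close> with S4 after raising the second
  index.\<close>

lemma trace_lower_Om: "(\<Oplus>s. (\<Oplus>m n. h m n x * (\<Oplus>c. Rb i n c s x * g m c x)) * h k s x)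
    = (\<Oplus>n. Om i n k n x)"
proof -
  have 1: "(\<Oplus>m. h m n x * (\<Oplus>c. Rb i n c s x * g m c x)) = Rb i n n s x" for n s
    using hg_contract[of "\<lambda>c. Rb i n c s x" x n] by (simp add: mult.commute)
  have "(\<Oplus>s. (\<Oplus>m n. h m n x * (\<Oplus>c. Rb i n c s x * g m c x)) * h k s x)
    = (\<Oplus>s. (\<Oplus>n. Rb i n n s x) * h k s x)"
  proof -
    have "(\<Oplus>m n. h m n x * (\<Oplus>c. Rb i n c s x * g m c x)) = (\<Oplus>n. Rb i n n s x)" for s
      by (subst sum.swap) (simp add: 1)
    then show ?thesis by simp
  qed
  also have "\<dots> = (\<Oplus>n s. h k s x * Rb i n n s x)"
    unfolding sum_distrib_right by (subst sum.swap) (simp add: mult.commute)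
  finally show ?thesis by (simp add: contract_Rb)
qed

lemma der_h_general: "der v (h k l) x = - (\<Oplus>p q. h k q x * h p l x * der v (g p q) x)"
proof -
  have "(\<Oplus>q. h k q x * der v (g p q) x) = - (\<Oplus>q. der v (h k q) x * g p q x)" for p
  proof -
    have "der v (\<lambda>x. \<Oplus>q. h k q x * g p q x) x = 0" by (subst hg) simp
    then show ?thesis by (simp add: sum.distrib eq_neg_iff_add_eq_0 add.commute)
  qed
  then have "(\<Oplus>p. (\<Oplus>q. h k q x * der v (g p q) x) * h p l x)
     = - (\<Oplus>p. (\<Oplus>q. der v (h k q) x * g p q x) * h p l x)"
    by (simp add: sum_negf)
  also have "\<dots> = - der v (h k l) x" unfolding hg_contract ..
  finally have "der v (h k l) x = - (\<Oplus>p. (\<Oplus>q. h k q x * der v (g p q) x) * h p l x)"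
    by simp
  then show ?thesis by (simp add: sum_distrib_left sum_distrib_right mult_ac)
qed

lemma raise_S2: "(\<Oplus>p q. h k q x * h p l x *
    (\<Oplus>m n. h m n x * (\<Oplus>c. Rb m n c q x * g p c x))) = S2_up k l x"
proof -
  have "(\<Oplus>p q. h k q x * h p l x *
    (\<Oplus>m n. h m n x * (\<Oplus>c. Rb m n c q x * g p c x)))
   = (\<Oplus>m n. h m n x * (\<Oplus>p q. (\<Oplus>c. Rb m n c q x * g p c x) * h p l x * h k q x))"
    unfolding sum_distrib_left[of _ "\<lambda>m. \<Oplus>n. _ m n"] sum_distrib_left[of _ "\<lambda>n. h _ n x * _ n"]
      sum_distrib_left[of "h _ _ x" "\<lambda>p. \<Oplus>q. _ p q"] sum_distrib_left[of "h _ _ x" "\<lambda>q. _ q * h k q x"]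
    by (subst sum_swap4) (simp add: mult_ac)
  then show ?thesis by (simp add: raise_lower_Om S2_up_def)
qed

lemma raise_Q: "(\<Oplus>p q. h k q x * h p l x * (1/2 * (\<Oplus>m n r s. h m n x * h r s x * (\<Oplus>c. T m r c x * g c q x) * (\<Oplus>c. Tb n s c x * g p c x)))) = Q_up k l x"
proof -
  have 1: "(\<Oplus>q. h k q x * (\<Oplus>c. T m r c x * g c q x)) = T m r k x" for m r
  proof -
    have "(\<Oplus>q. h k q x * (\<Oplus>c. T m r c x * g c q x)) = (\<Oplus>c. T m r c x * (\<Oplus>q. h k q x * g c q x))"
      by (simp add: sum_distrib_left mult_ac) (rule sum.swap)
    then show ?thesis by (simp add: hg if_distrib cong: if_cong)
  qed
  have 2: "(\<Oplus>p. h p l x * (\<Oplus>c. Tb n s c x * g p c x)) = Tb n s l x" for n s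
    using hg_contract[of "\<lambda>c. Tb n s c x" x l] by (simp add: mult.commute)
  \<comment> \<open>With the summations abstracted, the free indices p and q factor, and each
    torsion is raised on its own.\<close>
  have 3: "(\<Oplus>p q. u q * w p * (\<Oplus>m n r s. K m n r s * X m r q * Y n s p))
     = (\<Oplus>m n r s. K m n r s * (\<Oplus>q. u q * X m r q) * (\<Oplus>p. w p * Y n s p))"
    for u w :: "'n \<Rightarrow> complex" and K :: "'n \<Rightarrow> 'n \<Rightarrow> 'n \<Rightarrow> 'n \<Rightarrow> complex" and X Y :: "'n \<Rightarrow> 'n \<Rightarrow> 'n \<Rightarrow> complex"
  proof -
    have "(\<Oplus>p q. u q * w p * (\<Oplus>m n r s. K m n r s * X m r q * Y n s p))
      = (\<Oplus>p q m n r s. u q * w p * (K m n r s * X m r q * Y n s p))"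
      by (simp only: sum_distrib_left)
    also have "\<dots> = (\<Oplus>m n p q r s. u q * w p * (K m n r s * X m r q * Y n s p))"
      by (rule sum_swap4)
    also have "\<dots> = (\<Oplus>m n r s p q. u q * w p * (K m n r s * X m r q * Y n s p))"
      by (intro sum.cong refl sum_swap4)
    also have "\<dots> = (\<Oplus>m n r s. K m n r s * (\<Oplus>q. u q * X m r q) * (\<Oplus>p. w p * Y n s p))"
      by (intro sum.cong refl) (simp add: sum_distrib_left sum_distrib_right mult_ac,
        rule sum.swap)
    finally show ?thesis .
  qed
  have "(\<Oplus>p q. h k q x * h p l x * (1/2 * Z p q)) = 1/2 * (\<Oplus>p q. h k q x * h p l x * Z p q)" for Z
    by (simp add: sum_distrib_left mult_ac)
  then show ?thesis
    unfolding Q_up_def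
    by (simp only: 3 1 2) (rule arg_cong[where f = "(*) (1/2)"], rule sum.cong[OF refl], rule sum.swap)
qed

end

context metric_chart
begin

abbreviation "G t \<equiv> g_comp (H t)"

lemma dz_G:
  assumes "t \<in> I" "x \<in> U"
  shows "dz i (\<lambda>y. G t y $ k $ l) x = der (dir_z i) (gmat k l) (t, x)"
    "dzbar i (\<lambda>y. G t y $ k $ l) x = der (dir_zbar i) (gmat k l) (t, x)"
  by (rule dz_der[OF sm_g assms], simp add: assms gmat_chart)+

lemma T_up_eq: "t \<in> I \<Longrightarrow> x \<in> U \<Longrightarrow> T_up (G t) x i j k = T i j k (t, x)"
  by (simp add: T_up_def T_alt dz_G ginv_chart)

lemma chern_curv_eq:
  assumes "t \<in> I" "x \<in> U"
  shows "chern_curv (G t) x i j k l = (\<Oplus>c. Rb i j c l (t, x) * gmat k c (t, x))"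
proof -
  have "dz i (dzbar j (\<lambda>y. G t y $ k $ l)) x = der (dir_z i) (der (dir_zbar j) (gmat k l)) (t, x)"
    by (rule dz_der(1)[OF sm_der[OF sm_g] assms]) (simp add: dz_G assms)
  then show ?thesis
    using assms by (simp add: chern_curv_def dz_G ginv_chart flip: lower_Om)
qed

lemma Omega_eq: "t \<in> I \<Longrightarrow> x \<in> U \<Longrightarrow> Omega (G t) x $ ((k, i), (l, j)) = Om i j k l (t, x)"
  by (simp add: Omega_def chern_curv_eq raise_lower_Om flip: ginv_chart)

lemma v_end_eq: "t \<in> I \<Longrightarrow> x \<in> U \<Longrightarrow> v_end (G t) x $ k $ i = 1/2 * (\<Oplus>n. Om i n k n (t, x))"
  by (simp add: v_end_def S4_def chern_curv_eq trace_lower_Om flip: ginv_chart)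

lemma S2_eq: "t \<in> I \<Longrightarrow> x \<in> U \<Longrightarrow> S2 (G t) x i j
    = (\<Oplus>m n. ginv m n (t, x) * (\<Oplus>c. Rb m n c j (t, x) * gmat i c (t, x)))"
  by (simp add: S2_def chern_curv_eq flip: ginv_chart)

lemma Q_eq: "t \<in> I \<Longrightarrow> x \<in> U \<Longrightarrow> Q (G t) x i j = 1/2 * (\<Oplus>m n r s. ginv m n (t, x) * ginv r s (t, x) * (\<Oplus>c. T m r c (t, x) * gmat c j (t, x)) * (\<Oplus>c. Tb n s c (t, x) * gmat i c (t, x)))"
  by (simp add: Q_def T_low_def T_up_eq T_cnj gmat_cnj flip: ginv_chart gmat_chart)

definition dir_t :: "(real \<times> (complex^'n)) \<times> (real \<times> (complex^'n))" where
  "dir_t = ((1, 0), (0, 0))"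

lemma dir_deriv_zero: "smooth_on (I \<times> U) f \<Longrightarrow> dir_deriv 0 f p = 0"
  using dir_deriv_linear(2)[of f 0 0 p] by simp

lemma der_dir_t: "smooth_on (I \<times> U) f \<Longrightarrow> der dir_t f p = dir_deriv (1, 0) f p"
  using dir_deriv_zero[of f p] by (simp add: der_def dir_t_def zero_prod_def)

lemma at_time_not_bot: "t \<in> I \<Longrightarrow> at t within I \<noteq> bot"
proof -
  assume "t \<in> I"
  have "connected I" using interval is_interval_connected by blast
  moreover have "\<nexists>a. I = {a}" using nondegenerate by fastforce
  ultimately have "t islimpt I" using \<open>t \<in> I\<close> connected_imp_perfect by metis
  then show "at t within I \<noteq> bot" by (simp add: trivial_limit_within)
qed

lemma der_eq_0_outside: "p \<notin> I \<times> U \<Longrightarrow> der v f p = 0"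
  by (simp add: der_def dir_deriv_outside del: mem_Sigma_iff)

text \<open>Raising indices in the derivative of an inverse reverses the sign, hence plus S2 and Q.
  The equation must hold between functions, since \<open>evolution\<close> differentiates it in
  space.\<close>

lemma der_dir_t_ginv:
  assumes HCF: "\<And>t x i j. t \<in> I \<Longrightarrow> x \<in> U \<Longrightarrow>
    ((\<lambda>s. G s x $ i $ j) has_vector_derivative - S2 (G t) x i j - Q (G t) x i j) (at t within I)"
  shows "der dir_t (ginv k l) = (\<lambda>p. S2_up k l p + Q_up k l p)"
proof
  fix p
  show "der dir_t (ginv k l) p = S2_up k l p + Q_up k l p"
  proof (cases "p \<in> I \<times> U")
    case True
    then obtain t x where p: "p = (t, x)" "t \<in> I" "x \<in> U" by auto
    have "der dir_t (gmat i j) p = - S2 (G t) x i j - Q (G t) x i j" for i j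
    proof -
      have "((\<lambda>s. gmat i j (s, x)) has_vector_derivative dir_deriv (1, 0) (gmat i j) (t, x)) (at t within I)"
        using p by (intro has_vector_derivative_time) auto
      then have "((\<lambda>s. G s x $ i $ j) has_vector_derivative dir_deriv (1, 0) (gmat i j) (t, x)) (at t within I)"
        by (rule has_vector_derivative_transform[rotated 2]) (use p in \<open>auto simp: gmat_chart\<close>)
      then have "dir_deriv (1, 0) (gmat i j) (t, x) = - S2 (G t) x i j - Q (G t) x i j"
        using vector_derivative_unique_within[OF at_time_not_bot] HCF p by blast
      then show ?thesis by (simp add: der_dir_t p)
    qed
    moreover have "S2_up k l p + Q_up k l p = (\<Oplus>r q. ginv k q p * ginv r l p * S2 (G t) x r q)
       + (\<Oplus>r q. ginv k q p * ginv r l p * Q (G t) x r q)"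
      using p by (simp only: S2_eq Q_eq raise_S2 raise_Q)
    ultimately show ?thesis
      by (simp add: der_h_general[of dir_t] right_diff_distrib distrib_left sum.distrib sum_negf sum_subtractf)
  next
    \<comment> \<open>Outside the domain every term contains a derivative, and those are zero by
      convention.\<close>
    case False
    then have "B m q k p = 0" "Bb m q k p = 0" "Om m n k l p = 0" for m n q k l
      by (simp_all add: B_def Bb_def Om_def der_eq_0_outside del: mem_Sigma_iff)
    with False show ?thesis
      by (simp add: S2_up_def Q_up_def T_def Tb_def der_eq_0_outside del: mem_Sigma_iff)
  qed
qed

end

section \<open>The Chern connection and the twisted Laplacian\<close>

lemma has_derivative_vec:
  fixes f :: "'b::real_normed_vector \<Rightarrow> 'c::euclidean_space^'a"
  assumes "\<And>i. ((\<lambda>x. f x $ i) has_derivative (\<lambda>h. f' h $ i)) (at x within S)"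
  shows "(f has_derivative f') (at x within S)"
  unfolding has_derivative_componentwise_within[of f]
proof
  fix b :: "'c^'a" assume "b \<in> Basis"
  then obtain i u where "b = axis i u" by (auto simp: Basis_vec_def)
  then show "((\<lambda>x. f x \<bullet> b) has_derivative (\<lambda>x. f' x \<bullet> b)) (at x within S)"
    using has_derivative_inner_left[OF assms[of i]] by (simp add: inner_axis)
qed

lemma frechet_derivative_vec_nth:
  fixes f :: "'b::real_normed_vector \<Rightarrow> complex^'a"
  assumes "f differentiable (at x)"
  shows "frechet_derivative f (at x) v $ i = frechet_derivative (\<lambda>y. f y $ i) (at x) v"
proof -
  have "((\<lambda>y. f y $ i) has_derivative (\<lambda>v. frechet_derivative f (at x) v $ i)) (at x)"
    using assms bounded_linear.has_derivative[OF bounded_linear_vec_nth] frechet_derivative_works by blast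
  then show ?thesis by (metis frechet_derivative_at)
qed

text \<open>The left sides are twice the complex linear and the complex antilinear part of the real
  linear map \<open>L\<close>.\<close>

lemma real_linear_axis_expand:
  fixes L :: "complex^'n \<Rightarrow> complex"
  assumes "linear L"
  shows "L u - \<i> * L (Jst u) = (\<Oplus>m. u $ m * (L (axis m 1) - \<i> * L (Jst (axis m 1))))"
    and "L u + \<i> * L (Jst u) = (\<Oplus>m. cnj (u $ m) * (L (axis m 1) + \<i> * L (Jst (axis m 1))))"
proof -
  have u: "u = (\<Oplus>m. Re (u $ m) *\<^sub>R axis m 1 + Im (u $ m) *\<^sub>R Jst (axis m 1))" for u :: "complex^'n"
  proof -
    have "u $ m *s axis m 1 = Re (u $ m) *\<^sub>R axis m 1 + Im (u $ m) *\<^sub>R Jst (axis m 1)" for m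
      by (simp add: Jst_def vec_eq_iff axis_def complex_eq_iff)
    then show ?thesis using basis_expansion[of u] by simp
  qed
  have Lu: "L u = (\<Oplus>m. Re (u $ m) *\<^sub>R L (axis m 1) + Im (u $ m) *\<^sub>R L (Jst (axis m 1)))" for u
    by (subst u) (simp only: linear_sum[OF assms] linear_add[OF assms] linear_scale[OF assms])
  have J: "Re (Jst u $ m) = - Im (u $ m)" "Im (Jst u $ m) = Re (u $ m)" for m
    by (simp_all add: Jst_def)
  show "L u - \<i> * L (Jst u) = (\<Oplus>m. u $ m * (L (axis m 1) - \<i> * L (Jst (axis m 1))))"
    "L u + \<i> * L (Jst u) = (\<Oplus>m. cnj (u $ m) * (L (axis m 1) + \<i> * L (Jst (axis m 1))))"
    unfolding Lu[of u] Lu[of "Jst u"] J sum_distrib_left sum_subtractf[symmetric] sum.distrib[symmetric]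
    by (rule sum.cong[OF refl], simp add: complex_eq_iff algebra_simps)+
qed

lemma holo_on_has_derivative:
  assumes "holo_on V e" "x \<in> V"
  obtains e' where "(e has_derivative e') (at x)" "\<And>v. e' (Jst v) = Jst (e' v)"
  using assms unfolding holo_on_def by blast

text \<open>Multiplying \<omega> by \<i> multiplies its action on k, i by \<i> and the conjugate
  action on l, j by -\<i>, so the two combinations isolate one half each.\<close>

lemma end_act_types:
  shows "end_act \<omega> A $ ((k,i),(l,j)) - \<i> * end_act (\<chi> a b. \<i> * \<omega> $ a $ b) A $ ((k,i),(l,j))
     = 2 * (\<Oplus>q. \<omega> $ k $ q * A $ ((q,i),(l,j)) - \<omega> $ q $ i * A $ ((k,q),(l,j)))"
    and "end_act \<omega> A $ ((k,i),(l,j)) + \<i> * end_act (\<chi> a b. \<i> * \<omega> $ a $ b) A $ ((k,i),(l,j))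
     = 2 * (\<Oplus>q. cnj (\<omega> $ l $ q) * A $ ((k,i),(q,j)) - cnj (\<omega> $ q $ j) * A $ ((k,i),(l,q)))"
  unfolding end_act_def vec_lambda_beta case_prod_conv sum_distrib_left sum_subtractf[symmetric] sum.distrib[symmetric]
  by (rule sum.cong[OF refl], simp add: algebra_simps)+

text \<open>The axioms of the Chern connection evaluated on constant fields, where all derivatives
  of the fields drop out. They already determine the coefficients.\<close>

locale chern_chart = metric_chart I U H for I :: "real set" and U :: "(complex^'n::finite) set" and H +
  fixes t :: real and \<Gamma> :: "'n coeffs"
  assumes t: "t \<in> I"
    and bilin: "x \<in> U \<Longrightarrow> bilinear (\<Gamma> x)"
    and metric: "x \<in> U \<Longrightarrow>
      frechet_derivative (\<lambda>y. H t y v w) (at x) u = H t x (\<Gamma> x u v) w + H t x v (\<Gamma> x u w)"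
    and J: "x \<in> U \<Longrightarrow> \<Gamma> x u (Jst v) = Jst (\<Gamma> x u v)"
    and tors: "x \<in> U \<Longrightarrow> \<Gamma> x u (Jst v) - \<Gamma> x (Jst v) u = \<Gamma> x (Jst u) v - \<Gamma> x v (Jst u)"
begin

text \<open>
  \<open>A(u, v) = J \<Gamma>(u, v) - \<Gamma>(J u, v)\<close> is antisymmetric by the torsion condition, \<open>J\<close>-linear in \<open>v\<close> and
  \<open>J\<close>-antilinear in \<open>u\<close>; hence it vanishes.
\<close>

lemma J_left:
  assumes x: "x \<in> U"
  shows "\<Gamma> x (Jst u) v = Jst (\<Gamma> x u v)"
proof -
  define A where "A u v = Jst (\<Gamma> x u v) - \<Gamma> x (Jst u) v" for u v
  have Jd: "Jst (u - v) = Jst u - Jst v" for u v :: "complex^'n"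
    by (simp add: Jst_def vec_eq_iff algebra_simps)
  have anti: "A u v = - A v u" for u v
    using tors[OF x, of u v] by (simp add: A_def J[OF x] algebra_simps)
  have R: "A u (Jst v) = Jst (A u v)" for u v by (simp add: A_def J[OF x] Jd)
  have L: "A (Jst u) v = - Jst (A u v)" for u v
    by (simp add: A_def Jd Jst_Jst bilinear_lneg[OF bilin[OF x]])
  have "Jst (A u v) = - Jst (A u v)"
    using anti[of u "Jst v"] L[of v u] anti[of v u] by (simp add: R Jst_minus)
  then have "Jst (A u v) = 0" by (simp add: vec_eq_iff)
  then have "A u v = 0" using Jst_Jst[of "A u v"] by (simp add: Jst_def)
  then show ?thesis by (simp add: A_def)
qed

text \<open>The axiom \<open>metric\<close> gives only the value of the Frechet derivative;
  differentiability comes from the smoothness of the family.\<close>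

lemma has_derivative_H:
  assumes x: "x \<in> U"
  shows "((\<lambda>y. H t y v w) has_derivative (\<lambda>u. H t x (\<Gamma> x u v) w + H t x v (\<Gamma> x u w))) (at x)"
proof -
  have "smooth_on (I \<times> U) (\<lambda>p. complex_of_real (H (fst p) (snd p) v w))"
    using smooth_on_bounded_linear[OF bounded_linear_of_real smooth_H[of v w]] by (simp add: case_prod_beta)
  from has_derivative_space[OF this t x]
  have "((\<lambda>y. Re (complex_of_real (H t y v w))) has_derivative
      (\<lambda>u. Re (dir_deriv (0, u) (\<lambda>p. complex_of_real (H (fst p) (snd p) v w)) (t, x)))) (at x)"
    by (intro bounded_linear.has_derivative[OF bounded_linear_Re]) simp
  then have "(\<lambda>y. H t y v w) differentiable at x" by (auto intro: differentiableI)
  then have "((\<lambda>y. H t y v w) has_derivative frechet_derivative (\<lambda>y. H t y v w) (at x)) (at x)"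
    by (simp add: frechet_derivative_works)
  moreover have "frechet_derivative (\<lambda>y. H t y v w) (at x) = (\<lambda>u. H t x (\<Gamma> x u v) w + H t x v (\<Gamma> x u w))"
    by (intro ext metric x)
  ultimately show ?thesis by simp
qed

lemma dir_deriv_gmat:
  assumes x: "x \<in> U"
  shows "dir_deriv (0, u) (gmat p q) (t, x) =
    (herm (H t x) (\<Gamma> x u (axis p 1)) (axis q 1) + herm (H t x) (axis p 1) (\<Gamma> x u (axis q 1))) / 2"
proof -
  have "((\<lambda>y. herm (H t y) v w) has_derivative
     (\<lambda>u. of_real (H t x (\<Gamma> x u v) w + H t x v (\<Gamma> x u w))
       + \<i> * of_real (H t x (\<Gamma> x u v) (Jst w) + H t x v (\<Gamma> x u (Jst w))))) (at x)" for v w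
    unfolding herm_def using has_derivative_H[OF x]
    by (intro has_derivative_add has_derivative_mult_right bounded_linear.has_derivative[OF bounded_linear_of_real])
  then have "((\<lambda>y. herm (H t y) v w) has_derivative
     (\<lambda>u. herm (H t x) (\<Gamma> x u v) w + herm (H t x) v (\<Gamma> x u w))) (at x)" for v w
    by (simp add: herm_def J[OF x] algebra_simps)
  then have "((\<lambda>y. herm (H t y) (axis p 1) (axis q 1) * (1/2)) has_derivative
     (\<lambda>u. (herm (H t x) (\<Gamma> x u (axis p 1)) (axis q 1) + herm (H t x) (axis p 1) (\<Gamma> x u (axis q 1))) * (1/2))) (at x)"
    by (rule has_derivative_mult_left)
  then have 1: "((\<lambda>y. gmat p q (t, y)) has_derivative
     (\<lambda>u. (herm (H t x) (\<Gamma> x u (axis p 1)) (axis q 1) + herm (H t x) (axis p 1) (\<Gamma> x u (axis q 1))) * (1/2))) (at x)"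
    by (rule has_derivative_transform_within_open[OF _ open_U x])
       (simp add: gmat_chart[OF t] g_comp_eq_herm[where H = "H t", OF J_metric[OF t]])
  show ?thesis
    using fun_cong[OF has_derivative_unique[OF 1 has_derivative_space[OF sm_g t x]], of u] by simp
qed

text \<open>Since the coefficients are complex linear in the direction, the part where the
  connection hits the second, antilinear argument cancels in the (1,0) combination.\<close>

lemma der_gmat:
  assumes x: "x \<in> U"
  shows "der (dir_z m) (gmat p q) (t, x) = (\<Oplus>c. \<Gamma> x (axis m 1) (axis p 1) $ c * gmat c q (t, x))"
proof -
  interpret J: J_metric "H t x" by (rule J_metric[OF t x])
  have hJ: "herm (H t x) (Jst u) v = \<i> * herm (H t x) u v" "herm (H t x) u (Jst v) = - \<i> * herm (H t x) u v" for u v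
    by (simp_all add: Jst_def J.herm_left J.herm_right_scale)
  have dir_deriv: "dir_deriv (0, c *\<^sub>R u) (gmat p q) (t, x) = c *\<^sub>R dir_deriv (0, u) (gmat p q) (t, x)" for c u
    using dir_deriv_linear(2)[OF sm_g, of c "(0, u)"] by simp
  have ddm: "dir_deriv (0, - (c *\<^sub>R u)) (gmat p q) (t, x) = (- c) *\<^sub>R dir_deriv (0, u) (gmat p q) (t, x)" for c u
    using dir_deriv[of "- c" u] by simp
  have "der (dir_z m) (gmat p q) (t, x) = herm (H t x) (\<Gamma> x (axis m 1) (axis p 1)) (axis q 1) / 2"
    unfolding der_def dir_z_def fst_conv snd_conv dir_deriv ddm
    unfolding dir_deriv_gmat[OF x] J_left[OF x] hJ
    by (simp add: scaleR_conv_of_real field_simps)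
  also have "\<dots> = (\<Oplus>c. \<Gamma> x (axis m 1) (axis p 1) $ c * gmat c q (t, x))"
    using g_comp_form[where H = "H t", OF J_metric[OF t x], of "\<Gamma> x (axis m 1) (axis p 1)" "axis q 1"]
    by (simp add: gmat_chart[OF t x] axis_def if_distrib[of cnj] if_distrib[of "\<lambda>x. _ * x"] if_distrib[of "\<lambda>x. x * _"] cong: if_cong)
  finally show ?thesis .
qed

lemma Gamma_axis:
  assumes x: "x \<in> U"
  shows "\<Gamma> x (axis m 1) (axis p 1) $ k = - B m p k (t, x)"
proof -
  have "- B m p k (t, x) = (\<Oplus>q. ginv k q (t, x) * (\<Oplus>c. \<Gamma> x (axis m 1) (axis p 1) $ c * gmat c q (t, x)))"
    by (simp add: B_alt der_gmat[OF x])
  also have "\<dots> = (\<Oplus>c. \<Gamma> x (axis m 1) (axis p 1) $ c * (\<Oplus>q. ginv k q (t, x) * gmat c q (t, x)))"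
    by (simp add: sum_distrib_left mult_ac) (rule sum.swap)
  finally show ?thesis by (simp add: hg if_distrib cong: if_cong)
qed

lemma Gamma_left:
  assumes x: "x \<in> U"
  shows "\<Gamma> x u (axis p 1) $ k = - (\<Oplus>m. u $ m * B m p k (t, x))"
proof -
  have 1: "linear (\<lambda>u. \<Gamma> x u (axis p 1) $ k)"
    by (rule linearI) (simp_all add: bilinear_ladd[OF bilin[OF x]] bilinear_lmul[OF bilin[OF x]])
  have "Jst v $ k = \<i> * v $ k" for v :: "complex^'n" by (simp add: Jst_def)
  then have "2 * \<Gamma> x u (axis p 1) $ k = - (\<Oplus>m. 2 * (u $ m * B m p k (t, x)))"
    using real_linear_axis_expand(1)[OF 1, of u]
    by (simp add: J_left[OF x] Gamma_axis[OF x] sum_negf mult_ac flip: mult.assoc[of \<i> \<i>])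
  then have "2 * \<Gamma> x u (axis p 1) $ k = 2 * - (\<Oplus>m. u $ m * B m p k (t, x))"
    by (simp add: sum_distrib_left)
  then show ?thesis unfolding mult_cancel_left by simp
qed

lemma Gamma_right:
  assumes x: "x \<in> U"
  shows "\<Gamma> x (axis p 1) u $ k = - (\<Oplus>m. u $ m * B p m k (t, x))"
proof -
  have 1: "linear (\<lambda>u. \<Gamma> x (axis p 1) u $ k)"
    by (rule linearI) (simp_all add: bilinear_radd[OF bilin[OF x]] bilinear_rmul[OF bilin[OF x]])
  have "Jst v $ k = \<i> * v $ k" for v :: "complex^'n" by (simp add: Jst_def)
  then have "2 * \<Gamma> x (axis p 1) u $ k = - (\<Oplus>m. 2 * (u $ m * B p m k (t, x)))"
    using real_linear_axis_expand(1)[OF 1, of u]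
    by (simp add: J[OF x] Gamma_axis[OF x] sum_negf mult_ac flip: mult.assoc[of \<i> \<i>])
  then have "2 * \<Gamma> x (axis p 1) u $ k = 2 * - (\<Oplus>m. u $ m * B p m k (t, x))"
    by (simp add: sum_distrib_left)
  then show ?thesis unfolding mult_cancel_left by simp
qed

lemma conn_matrix_chern:
  assumes "x \<in> U"
  shows "conn_matrix (cov_deriv \<Gamma>) x u $ k $ j = - (\<Oplus>m. u $ m * B m j k (t, x))"
  by (simp add: conn_matrix_def cov_deriv_def Gamma_left[OF assms])

text \<open>For constant fields \<nabla>_u v - T(u, v) = \<nabla>_v u, so twisting swaps the two
  arguments of \<open>\<Gamma>\<close>.\<close>

lemma conn_matrix_twisted:
  assumes "x \<in> U"
  shows "conn_matrix (twisted_deriv \<Gamma>) x u $ k $ j = - (\<Oplus>m. u $ m * B j m k (t, x))"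
  by (simp add: conn_matrix_def twisted_deriv_def torsion_def lie_bracket_def cov_deriv_def Gamma_right[OF assms])

lemma conn_matrix_twisted_Jst:
  assumes "x \<in> U"
  shows "conn_matrix (twisted_deriv \<Gamma>) x (Jst u) = (\<chi> a b. \<i> * conn_matrix (twisted_deriv \<Gamma>) x u $ a $ b)"
  by (simp add: vec_eq_iff conn_matrix_twisted[OF assms] Jst_def sum_distrib_left mult_ac)

lemma nabla_T_eq:
  assumes x: "x \<in> U"
  shows "nabla_T (G t) \<Gamma> x i m p k = nabla i T m p k (t, x)"
proof -
  have cm: "conn_matrix (cov_deriv \<Gamma>) x (axis i 1) $ k $ j = - B i j k (t, x)"
    "conn_matrix (cov_deriv \<Gamma>) x (Jst (axis i 1)) $ k $ j = - \<i> * B i j k (t, x)" for k j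
    unfolding conn_matrix_chern[OF x] Jst_axis
    by (simp_all add: axis_def if_distrib[of "\<lambda>x. x * _"] cong: if_cong)
  have "dz i (\<lambda>y. T_up (G t) y m p k) x = der (dir_z i) (T m p k) (t, x)"
    by (rule dz_der(1)[OF sm_T t x]) (simp add: T_up_eq t)
  then have d: "frechet_derivative (\<lambda>y. T_up (G t) y m p k) (at x) (axis i 1)
      - \<i> * frechet_derivative (\<lambda>y. T_up (G t) y m p k) (at x) (Jst (axis i 1)) = 2 * der (dir_z i) (T m p k) (t, x)"
    by (simp add: dz_def)
  define S where "S = (\<Oplus>q. - B i q k (t, x) * T m p q (t, x)
    + B i m q (t, x) * T q p k (t, x) + B i p q (t, x) * T m q k (t, x))"
  have S: "(\<Oplus>q. - B i q k (t, x) * T m p q (t, x) - - B i m q (t, x) * T q p k (t, x)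
      - - B i p q (t, x) * T m q k (t, x)) = S"
    "(\<Oplus>q. - \<i> * B i q k (t, x) * T m p q (t, x) - - \<i> * B i m q (t, x) * T q p k (t, x)
      - - \<i> * B i p q (t, x) * T m q k (t, x)) = \<i> * S"
    unfolding S_def sum_distrib_left by (rule sum.cong[OF refl], simp add: algebra_simps)+
  have "2 * nabla_T (G t) \<Gamma> x i m p k = 2 * der (dir_z i) (T m p k) (t, x) + 2 * S"
    unfolding nabla_T_def nabla_T_real_def Let_def cm T_up_eq[OF t x] d[symmetric] S
    by (simp add: field_simps)
  then have "2 * nabla_T (G t) \<Gamma> x i m p k = 2 * nabla i T m p k (t, x)"
    by (simp only: nabla_def S_def distrib_left)
  then show ?thesis unfolding mult_cancel_left by simp
qed

text \<open>The connection matrix is complex linear in the direction, hence a (1,0) derivative sees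
  only k and i, and a (0,1) derivative only l and j. This identifies the two with \<open>N\<close>
  and \<open>Nb\<close>.\<close>

lemma tens_deriv_types:
  assumes x: "x \<in> U" and A: "A differentiable (at x)"
  shows "tens_deriv10 (twisted_deriv \<Gamma>) E A x $ ((k,i),(l,j)) = (\<Oplus>m. E x $ m *
      (dz m (\<lambda>y. A y $ ((k,i),(l,j))) x
       + (\<Oplus>p. - B p m k (t, x) * A x $ ((p,i),(l,j)) + B i m p (t, x) * A x $ ((k,p),(l,j)))))"
    (is ?A)
    and "tens_deriv01 (twisted_deriv \<Gamma>) E A x $ ((k,i),(l,j)) = (\<Oplus>m. cnj (E x $ m) *
      (dzbar m (\<lambda>y. A y $ ((k,i),(l,j))) x
       + (\<Oplus>p. - Bb p m l (t, x) * A x $ ((k,i),(p,j)) + Bb j m p (t, x) * A x $ ((k,i),(l,p)))))"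
    (is ?B)
proof -
  define f where "f = frechet_derivative (\<lambda>y. A y $ ((k,i),(l,j))) (at x)"
  define u where "u = E x"
  define \<omega> where "\<omega> = conn_matrix (twisted_deriv \<Gamma>) x u"
  have "(\<lambda>y. A y $ ((k,i),(l,j))) differentiable (at x)"
    using A bounded_linear.has_derivative[OF bounded_linear_vec_nth] unfolding differentiable_def by blast
  then have "linear f" unfolding f_def by (rule linear_frechet_derivative)
  note L = real_linear_axis_expand[OF this, of u]
  have \<omega>: "\<omega> $ k $ q = - (\<Oplus>m. u $ m * B q m k (t, x))" for k q
    unfolding \<omega>_def by (rule conn_matrix_twisted[OF x])
  have d10: "(\<Oplus>m. u $ m * dz m (\<lambda>y. A y $ ((k,i),(l,j))) x) = (f u - \<i> * f (Jst u)) / 2"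
    unfolding L by (simp add: dz_def f_def[symmetric] sum_divide_distrib)
  have d01: "(\<Oplus>m. cnj (u $ m) * dzbar m (\<lambda>y. A y $ ((k,i),(l,j))) x) = (f u + \<i> * f (Jst u)) / 2"
    unfolding L by (simp add: dzbar_def f_def[symmetric] sum_divide_distrib)
  have c10: "(\<Oplus>q. \<omega> $ k $ q * A x $ ((q,i),(l,j)) - \<omega> $ q $ i * A x $ ((k,q),(l,j)))
     = (\<Oplus>m. u $ m * (\<Oplus>p. - B p m k (t, x) * A x $ ((p,i),(l,j)) + B i m p (t, x) * A x $ ((k,p),(l,j))))"
    unfolding \<omega> sum_distrib_left
    by (rule trans[OF _ sum.swap]) (simp add: sum_distrib_left sum_distrib_right sum_negf sum.distrib sum_subtractf algebra_simps)
  have c01: "(\<Oplus>q. cnj (\<omega> $ l $ q) * A x $ ((k,i),(q,j)) - cnj (\<omega> $ q $ j) * A x $ ((k,i),(l,q)))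
     = (\<Oplus>m. cnj (u $ m) * (\<Oplus>p. - Bb p m l (t, x) * A x $ ((k,i),(p,j)) + Bb j m p (t, x) * A x $ ((k,i),(l,p))))"
    unfolding \<omega> sum_distrib_left
    by (rule trans[OF _ sum.swap]) (simp add: B_cnj sum_distrib_left sum_distrib_right sum_negf sum.distrib sum_subtractf algebra_simps)
  have td: "tens_deriv (twisted_deriv \<Gamma>) X A x $ ((k,i),(l,j))
      = f (X x) + end_act (conn_matrix (twisted_deriv \<Gamma>) x (X x)) (A x) $ ((k,i),(l,j))" for X
    by (simp add: tens_deriv_def f_def frechet_derivative_vec_nth[OF A])
  have "tens_deriv10 (twisted_deriv \<Gamma>) E A x $ ((k,i),(l,j)) = (f u - \<i> * f (Jst u)) / 2
     + (end_act \<omega> (A x) $ ((k,i),(l,j)) - \<i> * end_act (\<chi> a b. \<i> * \<omega> $ a $ b) (A x) $ ((k,i),(l,j))) / 2"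
    by (simp add: tens_deriv10_def td conn_matrix_twisted_Jst[OF x] u_def[symmetric] \<omega>_def[symmetric] field_simps)
  then show ?A
    unfolding end_act_types d10[symmetric]
    by (simp add: c10 distrib_left sum.distrib u_def)
  have "tens_deriv01 (twisted_deriv \<Gamma>) E A x $ ((k,i),(l,j)) = (f u + \<i> * f (Jst u)) / 2
     + (end_act \<omega> (A x) $ ((k,i),(l,j)) + \<i> * end_act (\<chi> a b. \<i> * \<omega> $ a $ b) (A x) $ ((k,i),(l,j))) / 2"
    by (simp add: tens_deriv01_def td conn_matrix_twisted_Jst[OF x] u_def[symmetric] \<omega>_def[symmetric] field_simps)
  then show ?B
    unfolding end_act_types d01[symmetric]
    by (simp add: c01 distrib_left sum.distrib u_def)
qed

lemma smooth_tens_has_derivative: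
  fixes X :: "'n \<Rightarrow> 'n \<Rightarrow> 'n \<Rightarrow> 'n \<Rightarrow> real \<times> (complex^'n) \<Rightarrow> complex" and A :: "complex^'n \<Rightarrow> 'n tens"
  assumes x: "x \<in> U" and X: "\<And>i j k l. smooth_on (I \<times> U) (X i j k l)"
    and A: "\<And>y i j k l. y \<in> U \<Longrightarrow> A y $ ((k,i),(l,j)) = X i j k l (t, y)"
  shows "A differentiable (at x)"
proof -
  have "(A has_derivative (\<lambda>u. \<chi> a. case a of ((k,i),(l,j)) \<Rightarrow> dir_deriv (0, u) (X i j k l) (t, x))) (at x)"
  proof (rule has_derivative_vec)
    fix a :: "('n \<times> 'n) \<times> ('n \<times> 'n)"
    obtain k i l j where a: "a = ((k,i),(l,j))" by (metis prod.exhaust)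
    have "((\<lambda>y. A y $ ((k,i),(l,j))) has_derivative (\<lambda>u. dir_deriv (0, u) (X i j k l) (t, x))) (at x)"
      by (rule has_derivative_transform_within_open[OF has_derivative_space[OF X t x] open_U x])
         (simp add: A)
    then show "((\<lambda>y. A y $ a) has_derivative (\<lambda>u. (\<chi> a. case a of ((k,i),(l,j)) \<Rightarrow> dir_deriv (0, u) (X i j k l) (t, x)) $ a)) (at x)"
      by (simp add: a)
  qed
  then show ?thesis by (auto simp: differentiable_def)
qed

lemma tens_deriv_smooth:
  fixes X :: "'n \<Rightarrow> 'n \<Rightarrow> 'n \<Rightarrow> 'n \<Rightarrow> real \<times> (complex^'n) \<Rightarrow> complex" and A :: "complex^'n \<Rightarrow> 'n tens"
  assumes x: "x \<in> U" and X: "\<And>i j k l. smooth_on (I \<times> U) (X i j k l)"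
    and A: "\<And>y i j k l. y \<in> U \<Longrightarrow> A y $ ((k,i),(l,j)) = X i j k l (t, y)"
  shows "tens_deriv10 (twisted_deriv \<Gamma>) E A x $ ((k,i),(l,j)) = (\<Oplus>m. E x $ m * N m X i j k l (t, x))"
    and "tens_deriv01 (twisted_deriv \<Gamma>) E A x $ ((k,i),(l,j)) = (\<Oplus>m. cnj (E x $ m) * Nb m X i j k l (t, x))"
proof -
  have d: "dz m (\<lambda>y. A y $ ((k,i),(l,j))) x = der (dir_z m) (X i j k l) (t, x)"
     "dzbar m (\<lambda>y. A y $ ((k,i),(l,j))) x = der (dir_zbar m) (X i j k l) (t, x)" for m
    by (rule dz_der[OF X t x], simp add: A)+
  have diff: "A differentiable (at x)"
    using X A by (rule smooth_tens_has_derivative[OF x])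
  show "tens_deriv10 (twisted_deriv \<Gamma>) E A x $ ((k,i),(l,j)) = (\<Oplus>m. E x $ m * N m X i j k l (t, x))"
    "tens_deriv01 (twisted_deriv \<Gamma>) E A x $ ((k,i),(l,j)) = (\<Oplus>m. cnj (E x $ m) * Nb m X i j k l (t, x))"
    unfolding tens_deriv_types[OF x diff] d
    by (simp_all add: A x N_def Nb_def)
qed

text \<open>
  The components of a holomorphic vector field (or their conjugates) are annihilated by the
  derivatives of the opposite type, so the second derivative does not see the field.
\<close>

lemma tens_deriv_holo:
  fixes X :: "'n \<Rightarrow> 'n \<Rightarrow> 'n \<Rightarrow> 'n \<Rightarrow> real \<times> (complex^'n) \<Rightarrow> complex" and A :: "complex^'n \<Rightarrow> 'n tens"
  assumes x: "x \<in> U" and X: "\<And>i j k l. smooth_on (I \<times> U) (X i j k l)"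
    and A: "\<And>y i j k l. y \<in> U \<Longrightarrow> A y $ ((k,i),(l,j)) = X i j k l (t, y)"
    and V: "open V" "x \<in> V" and E: "holo_on V E"
  shows "tens_deriv10 (twisted_deriv \<Gamma>) E (tens_deriv01 (twisted_deriv \<Gamma>) E A) x $ ((k,i),(l,j))
      = (\<Oplus>m n. E x $ m * cnj (E x $ n) * N m (Nb n X) i j k l (t, x))" (is ?A)
    and "tens_deriv01 (twisted_deriv \<Gamma>) E (tens_deriv10 (twisted_deriv \<Gamma>) E A) x $ ((k,i),(l,j))
      = (\<Oplus>m n. E x $ m * cnj (E x $ n) * Nb n (N m X) i j k l (t, x))" (is ?B)
proof -
  let ?W = "U \<inter> V"
  have W: "open ?W" "x \<in> ?W" using open_U V x by auto
  obtain e' where e': "(E has_derivative e') (at x)" "\<And>v. e' (Jst v) = Jst (e' v)"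
    using holo_on_has_derivative[OF E V(2)] by metis
  have Jn: "Jst v $ m = \<i> * v $ m" for v :: "complex^'n" and m by (simp add: Jst_def)
  have e1: "((\<lambda>y. E y $ m) has_derivative (\<lambda>v. e' v $ m)) (at x)" for m
    by (rule bounded_linear.has_derivative[OF bounded_linear_vec_nth e'(1)])
  have e2: "((\<lambda>y. cnj (E y $ m)) has_derivative (\<lambda>v. cnj (e' v $ m))) (at x)" for m
    by (rule bounded_linear.has_derivative[OF bounded_linear_cnj e1])
  have comp: "((\<lambda>y. \<Oplus>m. c m y * Y m (t, y)) has_derivative
      (\<lambda>v. \<Oplus>m. c m x * dir_deriv (0, v) (Y m) (t, x) + c' m v * Y m (t, x))) (at x)"
    if "\<And>m. (c m has_derivative c' m) (at x)" "\<And>m. smooth_on (I \<times> U) (Y m)"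
    for c :: "'n \<Rightarrow> complex^'n \<Rightarrow> complex" and c' Y
    by (intro has_derivative_sum has_derivative_mult that has_derivative_space t x)
  have wirt: "dir_deriv (0, axis p 1) f (t, x) - \<i> * dir_deriv (0, Jst (axis p 1)) f (t, x) = 2 * der (dir_z p) f (t, x)"
     "dir_deriv (0, axis p 1) f (t, x) + \<i> * dir_deriv (0, Jst (axis p 1)) f (t, x) = 2 * der (dir_zbar p) f (t, x)"
     if "smooth_on (I \<times> U) f" for f p
  proof -
    have fd: "frechet_derivative (\<lambda>y. f (t, y)) (at x) = (\<lambda>v. dir_deriv (0, v) f (t, x))"
      using has_derivative_space[OF that t x] by (metis frechet_derivative_at)
    have "dz p (\<lambda>y. f (t, y)) x = der (dir_z p) f (t, x)" "dzbar p (\<lambda>y. f (t, y)) x = der (dir_zbar p) f (t, x)"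
      by (rule dz_der[OF that t x], simp)+
    then show "dir_deriv (0, axis p 1) f (t, x) - \<i> * dir_deriv (0, Jst (axis p 1)) f (t, x) = 2 * der (dir_z p) f (t, x)"
     "dir_deriv (0, axis p 1) f (t, x) + \<i> * dir_deriv (0, Jst (axis p 1)) f (t, x) = 2 * der (dir_zbar p) f (t, x)"
      unfolding dz_def dzbar_def fd by simp_all
  qed
  define Y where "Y = tens_deriv01 (twisted_deriv \<Gamma>) E A"
  have Y: "Y y $ ((k,i),(l,j)) = (\<Oplus>n. cnj (E y $ n) * Nb n X i j k l (t, y))" if "y \<in> ?W" for y i j k l
    unfolding Y_def using that by (intro tens_deriv_smooth X A) auto
  define Y' where "Y' = tens_deriv10 (twisted_deriv \<Gamma>) E A"
  have Y': "Y' y $ ((k,i),(l,j)) = (\<Oplus>n. E y $ n * N n X i j k l (t, y))" if "y \<in> ?W" for y i j k l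
    unfolding Y'_def using that by (intro tens_deriv_smooth X A) auto
  have dY: "((\<lambda>y. Y y $ ((k,i),(l,j))) has_derivative (\<lambda>v. \<Oplus>n. cnj (E x $ n) * dir_deriv (0, v) (Nb n X i j k l) (t, x) + cnj (e' v $ n) * Nb n X i j k l (t, x))) (at x)" for i j k l
    by (rule has_derivative_transform_within_open[OF comp[OF e2] W]) (simp_all add: X Y)
  have dY': "((\<lambda>y. Y' y $ ((k,i),(l,j))) has_derivative (\<lambda>v. \<Oplus>n. E x $ n * dir_deriv (0, v) (N n X i j k l) (t, x) + e' v $ n * N n X i j k l (t, x))) (at x)" for i j k l
    by (rule has_derivative_transform_within_open[OF comp[OF e1] W]) (simp_all add: X Y')
  have diff: "Z differentiable (at x)" if "\<And>i j k l. ((\<lambda>y. Z y $ ((k,i),(l,j))) has_derivative D i j k l) (at x)"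
    for Z :: "complex^'n \<Rightarrow> 'n tens" and D
  proof -
    have "(Z has_derivative (\<lambda>u. \<chi> a. case a of ((k,i),(l,j)) \<Rightarrow> D i j k l u)) (at x)"
    proof (rule has_derivative_vec)
      fix a :: "('n \<times> 'n) \<times> ('n \<times> 'n)"
      obtain k i l j where a: "a = ((k,i),(l,j))" by (metis prod.exhaust)
      show "((\<lambda>y. Z y $ a) has_derivative (\<lambda>u. (\<chi> a. case a of ((k,i),(l,j)) \<Rightarrow> D i j k l u) $ a)) (at x)"
        using that by (simp add: a)
    qed
    then show ?thesis by (auto simp: differentiable_def)
  qed
  have half: "2 * (c / 2) = c" for c :: complex by simp
  have dzY: "dz p (\<lambda>y. Y y $ ((k,i),(l,j))) x = (\<Oplus>n. cnj (E x $ n) * der (dir_z p) (Nb n X i j k l) (t, x))" for p i j k l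
  proof -
    have "2 * dz p (\<lambda>y. Y y $ ((k,i),(l,j))) x = (\<Oplus>n. cnj (E x $ n) *
       (dir_deriv (0, axis p 1) (Nb n X i j k l) (t, x) - \<i> * dir_deriv (0, Jst (axis p 1)) (Nb n X i j k l) (t, x)))"
      unfolding dz_def frechet_derivative_at[OF dY, symmetric]
      by (simp only: sum_distrib_left[of \<i>] half e'(2) Jn flip: sum_subtractf) (rule sum.cong[OF refl], simp add: algebra_simps)
    also have "\<dots> = 2 * (\<Oplus>n. cnj (E x $ n) * der (dir_z p) (Nb n X i j k l) (t, x))"
      by (simp add: wirt X sum_distrib_left mult_ac)
    finally show ?thesis by simp
  qed
  have dzY': "dzbar p (\<lambda>y. Y' y $ ((k,i),(l,j))) x = (\<Oplus>n. E x $ n * der (dir_zbar p) (N n X i j k l) (t, x))" for p i j k l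
  proof -
    have "2 * dzbar p (\<lambda>y. Y' y $ ((k,i),(l,j))) x = (\<Oplus>n. E x $ n *
       (dir_deriv (0, axis p 1) (N n X i j k l) (t, x) + \<i> * dir_deriv (0, Jst (axis p 1)) (N n X i j k l) (t, x)))"
      unfolding dzbar_def frechet_derivative_at[OF dY', symmetric]
      by (simp only: sum_distrib_left[of \<i>] half e'(2) Jn flip: sum.distrib) (rule sum.cong[OF refl], simp add: algebra_simps)
    also have "\<dots> = 2 * (\<Oplus>n. E x $ n * der (dir_zbar p) (N n X i j k l) (t, x))"
      by (simp add: wirt X sum_distrib_left mult_ac)
    finally show ?thesis by simp
  qed
  have swap: "(\<Oplus>p. u p * (\<Oplus>n. c n * F n p) + w p * (\<Oplus>n. c n * F' n p))
      = (\<Oplus>n. c n * (\<Oplus>p. u p * F n p + w p * F' n p))"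
    for u w c :: "'n \<Rightarrow> complex" and F F'
    unfolding sum_distrib_left sum.distrib[symmetric] by (subst sum.swap) (simp add: algebra_simps)
  have "tens_deriv10 (twisted_deriv \<Gamma>) E Y x $ ((k,i),(l,j))
    = (\<Oplus>m. E x $ m * (\<Oplus>n. cnj (E x $ n) * N m (Nb n X) i j k l (t, x)))"
    unfolding tens_deriv_types(1)[OF x diff[OF dY]] dzY Y[OF W(2)] N_def
    by (simp only: swap sum.distrib[symmetric] distrib_left[symmetric])
  then show ?A unfolding Y_def by (simp add: sum_distrib_left mult_ac)
  have "tens_deriv01 (twisted_deriv \<Gamma>) E Y' x $ ((k,i),(l,j))
    = (\<Oplus>n. cnj (E x $ n) * (\<Oplus>m. E x $ m * Nb n (N m X) i j k l (t, x)))"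
    unfolding tens_deriv_types(2)[OF x diff[OF dY']] dzY' Y'[OF W(2)] Nb_def
    by (simp only: swap sum.distrib[symmetric] distrib_left[symmetric])
  also have "\<dots> = (\<Oplus>m n. E x $ m * cnj (E x $ n) * Nb n (N m X) i j k l (t, x))"
    unfolding sum_distrib_left by (subst sum.swap) (simp add: mult_ac)
  finally show ?B unfolding Y'_def .
qed

end

section \<open>Operations on tensors\<close>

lemma tensor_conj_nth: "tensor_conj v w $ ((k,i),(l,j)) = v $ k $ i * cnj (w $ l $ j)"
  by (simp add: tensor_conj_def)

lemma tens_eqI:
  fixes A B :: "'n::finite tens"
  assumes "\<And>k i l j. A $ ((k,i),(l,j)) = B $ ((k,i),(l,j))"
  shows "A = B"
  using assms by (auto simp: vec_eq_iff)

lemma commutator_nth: "commutator v u $ k $ i = (\<Oplus>p. v $ k $ p * u $ p $ i - u $ k $ p * v $ p $ i)"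
  by (simp add: commutator_def matrix_matrix_mult_def sum_subtractf)

lemma end_act_nth: "end_act v A $ ((k,i),(l,j)) =
    (\<Oplus>q. v $ k $ q * A $ ((q,i),(l,j)) - v $ q $ i * A $ ((k,q),(l,j))
        + cnj (v $ l $ q) * A $ ((k,i),(q,j)) - cnj (v $ q $ j) * A $ ((k,i),(l,q)))"
  by (simp add: end_act_def)

lemma linear_end_act: "linear (end_act v)"
  by (rule linearI; rule tens_eqI)
    (simp_all add: end_act_nth algebra_simps sum.distrib sum_subtractf scaleR_sum_right)

lemma end_act_tensor_conj:
  "end_act v (tensor_conj u u) = tensor_conj (commutator v u) u + tensor_conj u (commutator v u)"
  by (rule tens_eqI)
    (simp add: end_act_nth tensor_conj_nth commutator_nth sum_distrib_left sum_distrib_right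
      flip: sum.distrib, rule sum.cong, simp_all add: algebra_simps)

text \<open>A real linear map is determined on \<open>Sym11\<close> by its values on the spanning
  elements, and \<open>end_act v\<close> has the prescribed ones.\<close>

lemma ad_sym_eq:
  assumes "A \<in> Sym11"
  shows "ad_sym v A = end_act v A"
  unfolding ad_sym_def
proof (rule the_equality)
  show "\<exists>L. linear L \<and> (\<forall>u. L (tensor_conj u u) = tensor_conj (commutator v u) u + tensor_conj u (commutator v u)) \<and>
     end_act v A = L A"
    using linear_end_act end_act_tensor_conj by blast
  fix B assume "\<exists>L. linear L \<and> (\<forall>u. L (tensor_conj u u) = tensor_conj (commutator v u) u + tensor_conj u (commutator v u)) \<and> B = L A"
  then obtain L where L: "linear L" "\<And>u. L (tensor_conj u u) = tensor_conj (commutator v u) u + tensor_conj u (commutator v u)" "B = L A"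
    by blast
  have "L A = end_act v A"
    by (rule linear_eq_on_span[OF L(1) linear_end_act, of "range (\<lambda>w. tensor_conj w w)"])
       (use assms in \<open>auto simp: Sym11_def L(2) end_act_tensor_conj\<close>)
  then show "B = end_act v A" using L by simp
qed

text \<open>The four products come from multiplying out one commutator and one conjugated
  commutator.\<close>

definition sharp_fun :: "'n::finite tens \<Rightarrow> 'n tens \<Rightarrow> 'n tens" where
  "sharp_fun A B = (\<chi> a. case a of ((k,i),(l,j)) \<Rightarrow> \<Oplus>p q. A $ ((k,p),(l,q)) * B $ ((p,i),(q,j)) - A $ ((k,p),(q,j)) * B $ ((p,i),(l,q))
     - A $ ((p,i),(l,q)) * B $ ((k,p),(q,j)) + A $ ((p,i),(q,j)) * B $ ((k,p),(l,q)))"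

lemma sharp_fun_nth: "sharp_fun A B $ ((k,i),(l,j)) = (\<Oplus>p q. A $ ((k,p),(l,q)) * B $ ((p,i),(q,j)) - A $ ((k,p),(q,j)) * B $ ((p,i),(l,q))
     - A $ ((p,i),(l,q)) * B $ ((k,p),(q,j)) + A $ ((p,i),(q,j)) * B $ ((k,p),(l,q)))"
  by (simp add: sharp_fun_def)

lemma bilinear_sharp_fun: "bilinear (sharp_fun :: 'n::finite tens \<Rightarrow> _)"
proof -
  have "linear (sharp_fun A)" for A :: "'n tens"
    by (rule linearI; rule tens_eqI) (simp_all only: sharp_fun_nth vector_add_component vector_scaleR_component
      distrib_left distrib_right scaleR_sum_right mult_scaleR_right scaleR_add_right scaleR_diff_right
      sum.distrib sum_subtractf, simp_all)
  moreover have "linear (\<lambda>A. sharp_fun A B)" for B :: "'n tens"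
    by (rule linearI; rule tens_eqI) (simp_all only: sharp_fun_nth vector_add_component vector_scaleR_component
      distrib_left distrib_right scaleR_sum_right mult_scaleR_left scaleR_add_right scaleR_diff_right
      sum.distrib sum_subtractf, simp_all)
  ultimately show ?thesis by (simp add: bilinear_def)
qed

lemma sharp_fun_tensor_conj:
  "sharp_fun (tensor_conj v1 w1) (tensor_conj v2 w2) = tensor_conj (commutator v1 v2) (commutator w1 w2)"
  by (rule tens_eqI)
    (simp add: sharp_fun_nth tensor_conj_nth commutator_nth sum_product,
     intro sum.cong refl, simp add: algebra_simps)

text \<open>Real combinations suffice because a complex coefficient can be absorbed into the first
  factor. This makes \<open>sharp_prod\<close> unique.\<close>

lemma span_tensor_conj: "span (range (\<lambda>(v, w). tensor_conj v w)) = (UNIV :: 'n::finite tens set)"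
proof -
  have "A \<in> span (range (\<lambda>(v, w). tensor_conj v w))" for A :: "'n tens"
  proof -
    define E :: "'n \<Rightarrow> 'n \<Rightarrow> complex^'n^'n" where "E k i = (\<chi> k' i'. if k' = k \<and> i' = i then 1 else 0)" for k i
    define Z where "Z b = (case b of ((k,i),(l,j)) \<Rightarrow> tensor_conj (\<chi> r. A $ b *s (E k i $ r)) (E l j))" for b
    have "A = (\<Oplus>b. Z b)"
    proof (rule tens_eqI)
      fix k i l j
      have "Z b $ ((k,i),(l,j)) = (if b = ((k,i),(l,j)) then A $ b else 0)" for b
        by (cases b) (auto simp: Z_def tensor_conj_nth E_def split: if_splits)
      then show "A $ ((k,i),(l,j)) = (\<Oplus>b. Z b) $ ((k,i),(l,j))"
        by simp
    qed
    also have "\<dots> \<in> span (range (\<lambda>(v, w). tensor_conj v w))"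
      by (intro span_sum span_base) (auto simp: Z_def image_iff split: prod.splits)
    finally show ?thesis .
  qed
  then show ?thesis by auto
qed

lemma sharp_prod_eq: "sharp_prod = sharp_fun"
  unfolding sharp_prod_def
proof (rule the_equality)
  show "bilinear sharp_fun \<and> (\<forall>v1 w1 v2 w2. sharp_fun (tensor_conj v1 w1) (tensor_conj v2 w2) =
        tensor_conj (commutator v1 v2) (commutator w1 w2))"
    by (simp add: bilinear_sharp_fun sharp_fun_tensor_conj)
  fix F :: "'a tens \<Rightarrow> 'a tens \<Rightarrow> 'a tens"
  assume F: "bilinear F \<and> (\<forall>v1 w1 v2 w2. F (tensor_conj v1 w1) (tensor_conj v2 w2) =
        tensor_conj (commutator v1 v2) (commutator w1 w2))"
  show "F = sharp_fun"
  proof (intro ext)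
    fix A B
    show "F A B = sharp_fun A B"
      by (rule bilinear_eq[of F sharp_fun UNIV "range (\<lambda>(v, w). tensor_conj v w)" UNIV "range (\<lambda>(v, w). tensor_conj v w)"])
         (use F in \<open>auto simp: bilinear_sharp_fun sharp_fun_tensor_conj span_tensor_conj\<close>)
  qed
qed

text \<open>On the diagonal the four products agree in pairs, which cancels the 1/2.\<close>

lemma sharp_nth: "sharp A $ ((k,i),(l,j)) = (\<Oplus>p q. A $ ((k,p),(l,q)) * A $ ((p,i),(q,j)) - A $ ((k,p),(q,j)) * A $ ((p,i),(l,q)))"
proof -
  have "sharp_fun A A $ ((k,i),(l,j)) = 2 * (\<Oplus>p q. A $ ((k,p),(l,q)) * A $ ((p,i),(q,j)) - A $ ((k,p),(q,j)) * A $ ((p,i),(l,q)))"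
    unfolding sharp_fun_nth sum_distrib_left by (intro sum.cong refl) (simp add: algebra_simps)
  then show ?thesis
    unfolding sharp_def sharp_prod_eq vector_scaleR_component by (simp only: scaleR_conv_of_real) simp
qed

section \<open>Simultaneous diagonalisation of Hermitian forms\<close>

definition sesquilinear :: "(complex^'a \<Rightarrow> complex^'a \<Rightarrow> complex) \<Rightarrow> bool" where
  "sesquilinear f \<longleftrightarrow> (\<forall>u u' w. f (u + u') w = f u w + f u' w) \<and> (\<forall>c u w. f (c *s u) w = c * f u w)
     \<and> (\<forall>u w. f w u = cnj (f u w))"

lemma sesquilinearD:
  assumes "sesquilinear f"
  shows "f (u + u') w = f u w + f u' w" "f (c *s u) w = c * f u w" "cnj (f u w) = f w u"
    "f w (u + u') = f w u + f w u'" "f w (c *s u) = cnj c * f w u" "f 0 w = 0" "f w 0 = 0"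
    "f (- u) w = - f u w" "f (u - u') w = f u w - f u' w" "f w (u - u') = f w u - f w u'"
proof -
  have a: "f (u + u') w = f u w + f u' w" "f (c *s u) w = c * f u w" "f w u = cnj (f u w)" for u u' w c
    using assms unfolding sesquilinear_def by blast+
  show "f (u + u') w = f u w + f u' w" by (rule a(1))
  show "f (c *s u) w = c * f u w" by (rule a(2))
  show "cnj (f u w) = f w u" by (rule a(3)[symmetric])
  show r: "f w (u + u') = f w u + f w u'" for u u' w
    using a(1)[of u u' w] a(3)[where u = "u + u'" and w = w] a(3)[where u = u and w = w] a(3)[where u = u' and w = w]
    by simp
  show "f w (c *s u) = cnj c * f w u"
    using a(2)[of c u w] a(3)[where u = "c *s u" and w = w] a(3)[where u = u and w = w] by simp
  show z: "f 0 w = 0" for w using a(2)[of 0 0 w] by simp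
  show "f w 0 = 0" using z[of w] a(3)[where u = 0 and w = w] by simp
  have n: "- u = (-1) *s u" for u :: "complex^'a" by (simp add: vec_eq_iff)
  show m: "f (- u) w = - f u w" for u w unfolding n a(2) by simp
  have m': "f w (- u) = - f w u" for u w
    using m[of u w] a(3)[where u = "- u" and w = w] a(3)[where u = u and w = w] by simp
  show "f (u - u') w = f u w - f u' w" using a(1)[of u "- u'" w] m[of u' w] by simp
  show "f w (u - u') = f w u - f w u'" using r[of w u "- u'"] m'[of w u'] by simp
qed

lemma sesquilinear_sum:
  assumes "sesquilinear f"
  shows "f (\<Sum>i\<in>A. g i) w = (\<Sum>i\<in>A. f (g i) w)"
  by (induction A rule: infinite_finite_induct) (simp_all add: sesquilinearD[OF assms])

lemma scaleR_eq_vector_mult: "c *\<^sub>R u = complex_of_real c *s u"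
  by (simp add: vec_eq_iff) (simp add: scaleR_conv_of_real)

lemma sesquilinear_scaleR:
  assumes "sesquilinear f"
  shows "f (c *\<^sub>R u) w = c *\<^sub>R f u w" "f u (c *\<^sub>R w) = c *\<^sub>R f u w"
  unfolding scaleR_eq_vector_mult sesquilinearD(2,5)[OF assms] by (simp_all add: scaleR_conv_of_real)

lemma sesquilinear_continuous:
  fixes f :: "complex^'a \<Rightarrow> complex^'a \<Rightarrow> complex"
  assumes "sesquilinear f"
  shows "continuous_on S (\<lambda>u. Re (f u u))"
proof -
  have "bilinear f"
    unfolding bilinear_def
    by (auto intro!: linearI simp: sesquilinearD(1,4)[OF assms] sesquilinear_scaleR[OF assms])
  then have "bounded_bilinear f" by (simp add: bilinear_conv_bounded_bilinear)
  then show ?thesis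
    by (intro continuous_on_Re bounded_bilinear.continuous_on[of f] continuous_on_id)
qed

lemma sesquilinear_diag_real:
  assumes "sesquilinear f"
  shows "f u u = of_real (Re (f u u))"
  using sesquilinearD(3)[OF assms, of u u] by (simp add: complex_eq_iff)

text \<open>The Rayleigh quotient attains its maximum on \<open>W\<close> at an eigenvector.\<close>

lemma form_eigenvector:
  fixes f h :: "complex^'a \<Rightarrow> complex^'a \<Rightarrow> complex"
  assumes f: "sesquilinear f" and h: "sesquilinear h" and pos: "\<And>u. u \<noteq> 0 \<Longrightarrow> Re (f u u) > 0"
    and W: "closed W" "\<And>u w. u \<in> W \<Longrightarrow> w \<in> W \<Longrightarrow> u + w \<in> W" "\<And>c u. u \<in> W \<Longrightarrow> c *s u \<in> W"
    and nz: "u1 \<in> W" "u1 \<noteq> 0"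
  shows "\<exists>u r. u \<in> W \<and> f u u = 1 \<and> (\<forall>w\<in>W. h u w = of_real r * f u w)"
proof -
  define C where "C = W \<inter> sphere 0 1"
  have "compact C" unfolding C_def using W(1) by (simp add: closed_Int_compact)
  have Cnz: "u \<noteq> 0" if "u \<in> C" for u using that by (auto simp: C_def)
  have scale: "c *\<^sub>R u \<in> W" if "u \<in> W" for c u
    unfolding scaleR_eq_vector_mult using W(3) that by blast
  have "(1 / norm u1) *\<^sub>R u1 \<in> C"
    using nz scale by (simp add: C_def)
  then have "C \<noteq> {}" by auto
  have "continuous_on C (\<lambda>u. Re (h u u) / Re (f u u))"
    by (intro continuous_on_divide sesquilinear_continuous f h ballI) (use pos Cnz in \<open>force\<close>)
  then obtain u0 where u0: "u0 \<in> C" "\<And>u. u \<in> C \<Longrightarrow> Re (h u u) / Re (f u u) \<le> Re (h u0 u0) / Re (f u0 u0)"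
    using continuous_attains_sup[OF \<open>compact C\<close> \<open>C \<noteq> {}\<close>] by blast
  define r where "r = Re (h u0 u0) / Re (f u0 u0)"
  have u0W: "u0 \<in> W" "u0 \<noteq> 0" using u0(1) Cnz by (auto simp: C_def)
  define \<phi> where "\<phi> u w = of_real r * f u w - h u w" for u w
  have \<phi>: "sesquilinear \<phi>"
    unfolding sesquilinear_def \<phi>_def by (simp add: sesquilinearD[OF f] sesquilinearD[OF h] algebra_simps)
  have nonneg: "Re (\<phi> u u) \<ge> 0" if "u \<in> W" for u
  proof (cases "u = 0")
    case True
    then show ?thesis by (simp add: sesquilinearD[OF \<phi>])
  next
    case False
    define s where "s = 1 / norm u"
    have s: "s > 0" using False by (simp add: s_def)
    have "s *\<^sub>R u \<in> C"
      using that scale False by (simp add: C_def s_def)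
    from u0(2)[OF this] have "s\<^sup>2 * Re (h u u) / (s\<^sup>2 * Re (f u u)) \<le> r"
      by (simp add: r_def sesquilinear_scaleR[OF f] sesquilinear_scaleR[OF h] power2_eq_square mult.assoc)
    then have "Re (h u u) / Re (f u u) \<le> r" using s by simp
    then show ?thesis using pos[OF False] by (simp add: \<phi>_def field_simps)
  qed
  have zero: "Re (\<phi> u0 u0) = 0" using pos[OF u0W(2)] by (simp add: \<phi>_def r_def)
  have re0: "Re (\<phi> u0 w) = 0" if w: "w \<in> W" for w
  proof (rule ccontr)
    assume ne: "Re (\<phi> u0 w) \<noteq> 0"
    have q: "0 \<le> 2 * s * Re (\<phi> u0 w) + s\<^sup>2 * Re (\<phi> w w)" for s :: real
    proof -
      have "u0 + s *\<^sub>R w \<in> W" using u0W w W(2) scale by simp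
      then have "0 \<le> Re (\<phi> (u0 + s *\<^sub>R w) (u0 + s *\<^sub>R w))" by (rule nonneg)
      moreover have "Re (\<phi> w u0) = Re (\<phi> u0 w)"
        using arg_cong[OF sesquilinearD(3)[OF \<phi>, of u0 w], of Re] by simp
      then have "Re (\<phi> (u0 + s *\<^sub>R w) (u0 + s *\<^sub>R w)) = 2 * s * Re (\<phi> u0 w) + s\<^sup>2 * Re (\<phi> w w)"
        using zero by (simp add: sesquilinearD[OF \<phi>] sesquilinear_scaleR[OF \<phi>] power2_eq_square algebra_simps)
      ultimately show ?thesis by simp
    qed
    define a where "a = Re (\<phi> u0 w)"
    define c where "c = Re (\<phi> w w)"
    have "c \<ge> 0" using nonneg[OF w] by (simp add: c_def)
    \<comment> \<open>For this step the linear term outweighs the quadratic one;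
      \<open>c + 1\<close> is used because \<open>c\<close> may be zero.\<close>
    define s where "s = - a / (c + 1)"
    have "2 * s * a + s\<^sup>2 * c = - (a\<^sup>2 * (c + 2)) / (c + 1)\<^sup>2"
      using \<open>c \<ge> 0\<close> by (simp add: s_def field_simps power2_eq_square add_nonneg_eq_0_iff)
    also have "\<dots> < 0" using ne \<open>c \<ge> 0\<close> by (simp add: a_def)
    finally show False using q[of s] by (simp add: a_def c_def)
  qed
  \<comment> \<open>Replacing w by \<i> w yields the imaginary part.\<close>
  have phi0: "\<phi> u0 w = 0" if w: "w \<in> W" for w
    using re0[OF w] re0[OF W(3)[OF w, of \<i>]] by (simp add: sesquilinearD[OF \<phi>] complex_eq_iff)
  define c where "c = 1 / sqrt (Re (f u0 u0))"
  have "f (c *\<^sub>R u0) (c *\<^sub>R u0) = 1"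
    using pos[OF u0W(2)] sesquilinear_diag_real[OF f, of u0]
    by (simp add: sesquilinear_scaleR[OF f] c_def) (simp flip: of_real_mult mult.assoc add: complex_eq_iff)
  moreover have "c *\<^sub>R u0 \<in> W" using u0W scale by simp
  moreover have "h (c *\<^sub>R u0) w = of_real r * f (c *\<^sub>R u0) w" if "w \<in> W" for w
    using phi0[OF that] by (simp add: sesquilinear_scaleR[OF f] sesquilinear_scaleR[OF h] \<phi>_def)
  ultimately show ?thesis by blast
qed

text \<open>Induction over the index set: each new vector is an eigenvector in the orthogonal
  complement \<open>W\<close> of those already chosen.\<close>

lemma simultaneous_diagonalisation:
  fixes f h :: "complex^'a::finite \<Rightarrow> complex^'a \<Rightarrow> complex"
  assumes f: "sesquilinear f" and h: "sesquilinear h" and pos: "\<And>u. u \<noteq> 0 \<Longrightarrow> Re (f u u) > 0"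
  obtains v :: "'a \<Rightarrow> complex^'a" and r :: "'a \<Rightarrow> real"
  where "\<And>a b. f (v a) (v b) = (if a = b then 1 else 0)" "\<And>a w. h (v a) w = of_real (r a) * f (v a) w"
proof -
  have "\<exists>v r. (\<forall>a\<in>F. \<forall>b\<in>F. f (v a) (v b) = (if a = b then 1 else 0)) \<and>
      (\<forall>a\<in>F. \<forall>w. h (v a) w = of_real (r a) * f (v a) w)" for F :: "'a set"
  proof (induction F rule: finite_induct[OF finite])
    case 1
    then show ?case by simp
  next
    case (2 x F)
    then obtain v and r :: "'a \<Rightarrow> real" where v: "\<And>a b. a \<in> F \<Longrightarrow> b \<in> F \<Longrightarrow> f (v a) (v b) = (if a = b then 1 else 0)"
      "\<And>a w. a \<in> F \<Longrightarrow> h (v a) w = of_real (r a) * f (v a) w" by blast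
    \<comment> \<open>The products with the chosen vectors. As \<open>x\<close> is not in
      \<open>F\<close>, this map misses \<open>axis x 1\<close>, so by dimension its kernel
      \<open>W\<close> is nonzero.\<close>
    define P :: "complex^'a \<Rightarrow> complex^'a" where "P u = (\<chi> a. if a \<in> F then f u (v a) else 0)" for u
    define W where "W = {u. P u = 0}"
    have linP: "linear P"
      by (rule linearI) (simp_all add: P_def vec_eq_iff sesquilinearD[OF f] sesquilinear_scaleR[OF f])
    have W_iff: "u \<in> W \<longleftrightarrow> (\<forall>a\<in>F. f u (v a) = 0)" for u
      by (auto simp: W_def P_def vec_eq_iff)
    have "\<not> surj P"
    proof
      assume "surj P"
      then obtain u where "P u = axis x 1" by (metis surjD)
      then have "P u $ x = 1" by simp
      then show False using 2 by (simp add: P_def)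
    qed
    then have "\<not> inj P" using linear_injective_imp_surjective[OF linP] by blast
    then obtain u1 where u1: "u1 \<noteq> 0" "P u1 = 0"
      using linear_injective_0[OF linP] by blast
    have "closed W"
      unfolding W_def using linP by (intro closed_Collect_eq continuous_intros linear_continuous_on)
        (simp_all add: linear_conv_bounded_linear)
    have Wadd: "u + w \<in> W" if "u \<in> W" "w \<in> W" for u w
      using that by (simp add: W_iff sesquilinearD(1)[OF f])
    have Wmult: "c *s u \<in> W" if "u \<in> W" for c u
      using that by (simp add: W_iff sesquilinearD(2)[OF f])
    have "u1 \<in> W" using u1 by (simp add: W_def)
    from form_eigenvector[OF f h pos \<open>closed W\<close> Wadd Wmult this u1(1)]
    obtain u s where u: "u \<in> W" "f u u = 1" "\<And>w. w \<in> W \<Longrightarrow> h u w = of_real s * f u w" by blast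
    have uv: "f u (v a) = 0" "f (v a) u = 0" if "a \<in> F" for a
      using u(1) that sesquilinearD(3)[OF f, of u "v a"] by (auto simp: W_iff)
    have eig: "h u w = of_real s * f u w" for w
    proof -
      \<comment> \<open>The eigenvalue equation is known only against \<open>W\<close>. The chosen
        vectors are orthogonal to \<open>u\<close> for both forms, so projecting \<open>w\<close> to
        \<open>W\<close> changes neither side.\<close>
      define w' where "w' = w - (\<Sum>a\<in>F. f w (v a) *s v a)"
      have "w' \<in> W"
        unfolding W_iff
      proof
        fix b assume "b \<in> F"
        have "f (\<Sum>a\<in>F. f w (v a) *s v a) (v b) = (\<Sum>a\<in>F. f w (v a) * (if a = b then 1 else 0))"
          unfolding sesquilinear_sum[OF f] using v(1) \<open>b \<in> F\<close>
          by (intro sum.cong refl) (simp add: sesquilinearD[OF f])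
        also have "\<dots> = f w (v b)" using \<open>b \<in> F\<close> 2 by (simp add: if_distrib cong: if_cong)
        finally show "f w' (v b) = 0" by (simp add: w'_def sesquilinearD[OF f])
      qed
      have sumz: "g u (\<Sum>a\<in>F. c a *s v a) = 0" if g: "sesquilinear g" and z: "\<And>a. a \<in> F \<Longrightarrow> g (v a) u = 0" for g c
      proof -
        have "g (\<Sum>a\<in>F. c a *s v a) u = 0"
          unfolding sesquilinear_sum[OF g] using z by (simp add: sesquilinearD[OF g])
        then show ?thesis using sesquilinearD(3)[OF g, of "\<Sum>a\<in>F. c a *s v a" u] by simp
      qed
      have "h (v a) u = 0" if "a \<in> F" for a using v(2)[OF that] uv(2)[OF that] by simp
      then have "h u w = h u w'" "f u w = f u w'"
        using sumz[OF h] sumz[OF f uv(2)] by (simp_all add: w'_def sesquilinearD[OF f] sesquilinearD[OF h])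
      then show ?thesis using u(3)[OF \<open>w' \<in> W\<close>] by simp
    qed
    show ?case
      using 2 v u(2) uv eig
      by (intro exI[of _ "v(x := u)"] exI[of _ "r(x := s)"]) auto
  qed
  from this[of UNIV] show thesis using that by auto
qed

text \<open>Orthonormality says \<open>P ** Q = mat 1\<close>; for square matrices this gives
  \<open>Q ** P = mat 1\<close>, which is completeness.\<close>

lemma orthonormal_complete:
  fixes f :: "complex^'a::finite \<Rightarrow> complex^'a \<Rightarrow> complex" and v :: "'a \<Rightarrow> complex^'a"
  assumes f: "sesquilinear f" and v: "\<And>c d. f (v c) (v d) = (if c = d then 1 else 0)"
  shows "(\<Oplus>c. cnj (v c $ b') * f (v c) (axis b 1)) = (if b' = b then 1 else 0)"
proof -
  define P :: "complex^'a^'a" where "P = (\<chi> c b. f (v c) (axis b 1))"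
  define Q :: "complex^'a^'a" where "Q = (\<chi> b c. cnj (v c $ b))"
  have "(P ** Q) $ c $ d = (if c = d then 1 else 0)" for c d
  proof -
    have "(if c = d then 1 else 0) = cnj (f (\<Oplus>b. v d $ b *s axis b 1) (v c))"
      using v[of c d] sesquilinearD(3)[OF f, of "v d" "v c"] by (simp add: basis_expansion)
    also have "\<dots> = (\<Oplus>b. f (v c) (axis b 1) * cnj (v d $ b))"
      unfolding sesquilinear_sum[OF f] by (simp add: sesquilinearD[OF f] mult.commute)
    finally show ?thesis by (simp add: matrix_matrix_mult_def P_def Q_def)
  qed
  then have "P ** Q = mat 1" by (simp add: vec_eq_iff mat_def)
  then have "Q ** P = mat 1" by (simp add: matrix_left_right_inverse)
  then have "(Q ** P) $ b' $ b = (if b' = b then 1 else 0)" by (simp add: mat_def)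
  then show ?thesis by (simp add: matrix_matrix_mult_def P_def Q_def)
qed

text \<open>\<open>A\<close> has upper indices, so it is lowered with \<open>f\<close> to a form
  \<open>h\<close> before diagonalising; completeness of the eigenbasis recovers
  \<open>A\<close>.\<close>

lemma hermitian_diagonalisation:
  fixes f :: "complex^'a::finite \<Rightarrow> complex^'a \<Rightarrow> complex" and A :: "'a \<Rightarrow> 'a \<Rightarrow> complex"
  assumes f: "sesquilinear f" and pos: "\<And>u. u \<noteq> 0 \<Longrightarrow> Re (f u u) > 0"
    and A: "\<And>a b. cnj (A a b) = A b a"
  obtains v :: "'a \<Rightarrow> complex^'a" and r :: "'a \<Rightarrow> real"
  where "\<And>a b. f (v a) (v b) = (if a = b then 1 else 0)"
    "\<And>a b. A a b = (\<Oplus>c. of_real (r c) * v c $ a * cnj (v c $ b))"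
proof -
  define X where "X u b = f u (axis b 1)" for u b
  have X: "X (u + u') b = X u b + X u' b" "X (c *s u) b = c * X u b" for u u' c b
    by (simp_all add: X_def sesquilinearD[OF f])
  define h where "h u w = (\<Oplus>a b. A a b * X u b * cnj (X w a))" for u w
  have "h w u = cnj (h u w)" for u w
    unfolding h_def by (subst sum.swap) (simp add: A mult_ac)
  moreover have "h (u + u') w = h u w + h u' w" "h (c *s u) w = c * h u w" for u u' w c
    by (simp_all add: h_def X algebra_simps sum.distrib sum_distrib_left)
  ultimately have h: "sesquilinear h"
    unfolding sesquilinear_def by blast
  from simultaneous_diagonalisation[OF f h pos] obtain v and r :: "'a \<Rightarrow> real" where
    v: "\<And>a b. f (v a) (v b) = (if a = b then 1 else 0)" and
    r: "\<And>a w. h (v a) w = of_real (r a) * f (v a) w" by metis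
  have eig: "(\<Oplus>b. A a b * X (v c) b) = of_real (r c) * v c $ a" for a c
  proof -
    \<comment> \<open>The vector representing \<open>h (v c)\<close> with respect to
      \<open>f\<close>; definiteness of \<open>f\<close> turns the eigenvalue equation for forms
      into one for vectors.\<close>
    define y where "y = (\<Oplus>a. (\<Oplus>b. A a b * X (v c) b) *s axis a (1::complex))"
    define z where "z = y - of_real (r c) *s v c"
    have "f y w = h (v c) w" for w
      unfolding y_def sesquilinear_sum[OF f] h_def
      by (simp add: sesquilinearD[OF f] X_def sum_distrib_right)
    then have "f z w = 0" for w
      by (simp add: z_def sesquilinearD[OF f] r)
    then have "z = 0" using pos[of z] by auto
    then have "y $ a = of_real (r c) * v c $ a" by (simp add: z_def)
    moreover have "y $ a = (\<Oplus>b. A a b * X (v c) b)"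
      unfolding y_def basis_expansion[of "\<chi> a. \<Oplus>b. A a b * X (v c) b", simplified] by simp
    ultimately show ?thesis by simp
  qed
  have "A a b' = (\<Oplus>c. of_real (r c) * v c $ a * cnj (v c $ b'))" for a b'
  proof -
    have "A a b' = (\<Oplus>b. A a b * (\<Oplus>c. cnj (v c $ b') * X (v c) b))"
      unfolding X_def orthonormal_complete[OF f v] by (simp add: if_distrib cong: if_cong)
    also have "\<dots> = (\<Oplus>c. (\<Oplus>b. A a b * X (v c) b) * cnj (v c $ b'))"
      by (simp add: sum_distrib_left sum_distrib_right mult_ac) (rule sum.swap)
    finally show ?thesis unfolding eig .
  qed
  with v show thesis using that by blast
qed

lemma sum_swap5: "(\<Sum>a\<in>A. \<Sum>k\<in>K. \<Sum>l\<in>L. \<Sum>i\<in>I. \<Sum>j\<in>J. F a k l i j)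
    = (\<Sum>k\<in>K. \<Sum>l\<in>L. \<Sum>i\<in>I. \<Sum>j\<in>J. \<Sum>a\<in>A. F a k l i j :: complex)"
  by (simp only: sum.swap[of _ K A] sum.swap[of _ L A] sum.swap[of _ I A] sum.swap[of _ J A])

section \<open>The Hermitian product on endomorphisms and the square\<close>

locale hermitian_pair =
  fixes g h :: "'n::finite \<Rightarrow> 'n \<Rightarrow> complex"
  assumes hg: "(\<Oplus>q. h k q * g p q) = (if k = p then 1 else 0)"
    and gh: "(\<Oplus>p. h p l * g p q) = (if l = q then 1 else 0)"
    and g_cnj: "cnj (g p q) = g q p"
    and g_pos: "u \<noteq> 0 \<Longrightarrow> Re (\<Oplus>k l. g k l * u $ k * cnj (u $ l)) > 0"
begin

lemma h_cnj: "cnj (h k l) = h l k"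
  by (rule inverse_hermitian[OF hg gh g_cnj])

definition form :: "complex^'n \<Rightarrow> complex^'n \<Rightarrow> complex" where
  "form u w = (\<Oplus>k l. g k l * u $ k * cnj (w $ l))"

lemma form_sesquilinear: "sesquilinear form"
proof -
  have "form w u = cnj (form u w)" for u w
    unfolding form_def by (subst sum.swap) (simp add: g_cnj mult_ac)
  moreover have "form (u + u') w = form u w + form u' w" "form (c *s u) w = c * form u w" for u u' w c
    by (simp_all add: form_def algebra_simps sum.distrib sum_distrib_left)
  ultimately show ?thesis unfolding sesquilinear_def by blast
qed

lemma form_pos: "u \<noteq> 0 \<Longrightarrow> Re (form u u) > 0"
  using g_pos by (simp add: form_def)

text \<open>A unitary frame resolves the inverse metric. This makes frame sums, such as the one in
  the Laplacian, independent of the frame.\<close>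

lemma frame_sum:
  fixes v :: "'n \<Rightarrow> complex^'n"
  assumes v: "\<And>a b. form (v a) (v b) = (if a = b then 1 else 0)"
  shows "(\<Oplus>a. v a $ k * cnj (v a $ l)) = h k l"
proof -
  have X: "form u (axis b 1) = (\<Oplus>p. g p b * u $ p)" for u b
    by (simp add: form_def axis_def if_distrib[of cnj] if_distrib[of "\<lambda>x. _ * x"] cong: if_cong)
  have "(\<Oplus>b. h k b * (\<Oplus>c. cnj (v c $ l) * form (v c) (axis b 1)))
     = (\<Oplus>c. cnj (v c $ l) * (\<Oplus>p. v c $ p * (\<Oplus>b. h k b * g p b)))"
  proof -
    have "(\<Oplus>b. h k b * (\<Oplus>c. cnj (v c $ l) * form (v c) (axis b 1)))
      = (\<Oplus>c b. h k b * (cnj (v c $ l) * form (v c) (axis b 1)))"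
      unfolding sum_distrib_left by (rule sum.swap)
    also have "\<dots> = (\<Oplus>c. cnj (v c $ l) * (\<Oplus>p. v c $ p * (\<Oplus>b. h k b * g p b)))"
      unfolding X sum_distrib_left by (rule sum.cong[OF refl], subst sum.swap) (simp add: mult_ac)
    finally show ?thesis .
  qed
  then show ?thesis
    unfolding orthonormal_complete[OF form_sesquilinear v] hg
    by (simp add: if_distrib[of "\<lambda>x. _ * x"] mult.commute cong: if_cong)
qed

lemma frame_exists:
  obtains v :: "'n \<Rightarrow> complex^'n" where "\<And>a b. form (v a) (v b) = (if a = b then 1 else 0)"
  by (rule simultaneous_diagonalisation[OF form_sesquilinear form_sesquilinear form_pos], assumption, rule that, assumption)

text \<open>Endomorphisms are flattened to vectors indexed by pairs so that the diagonalisation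
  lemmas apply.\<close>

definition end_form :: "complex^('n \<times> 'n) \<Rightarrow> complex^('n \<times> 'n) \<Rightarrow> complex" where
  "end_form u w = (\<Oplus>k l i j. g k l * h i j * u $ (k, i) * cnj (w $ (l, j)))"

lemma end_form_sesquilinear: "sesquilinear end_form"
proof -
  have "end_form w u = cnj (end_form u w)" for u w
  proof -
    have "end_form w u = (\<Oplus>l k j i. g k l * h i j * w $ (k, i) * cnj (u $ (l, j)))"
      unfolding end_form_def by (rule trans[OF sum.swap], rule sum.cong[OF refl], rule sum.cong[OF refl], rule sum.swap)
    then show ?thesis by (simp add: end_form_def g_cnj h_cnj mult_ac)
  qed
  moreover have "end_form (u + u') w = end_form u w + end_form u' w" "end_form (c *s u) w = c * end_form u w"
    for u u' w c
    by (simp_all add: end_form_def algebra_simps sum.distrib sum_distrib_left)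
  ultimately show ?thesis unfolding sesquilinear_def by blast
qed

text \<open>In a unitary frame \<open>e\<close>, the value on \<open>u\<close> is the sum of the
  squared lengths of the vectors obtained by applying \<open>u\<close> to each
  \<open>e a\<close>.\<close>

lemma end_form_pos:
  assumes "u \<noteq> 0"
  shows "Re (end_form u u) > 0"
proof -
  obtain e :: "'n \<Rightarrow> complex^'n" where e: "\<And>a b. form (e a) (e b) = (if a = b then 1 else 0)"
    by (rule frame_exists, rule that)
  define y where "y a = (\<chi> k. \<Oplus>i. u $ (k, i) * e a $ i)" for a
  have "form (y a) (y a) = (\<Oplus>k l i j. g k l * (e a $ i * cnj (e a $ j)) * u $ (k, i) * cnj (u $ (l, j)))" for a
    unfolding form_def y_def
    by (intro sum.cong refl) (simp add: sum_distrib_left sum_distrib_right mult_ac)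
  then have "(\<Oplus>a. form (y a) (y a)) = (\<Oplus>k l i j a. g k l * (e a $ i * cnj (e a $ j)) * u $ (k, i) * cnj (u $ (l, j)))"
    by (simp only:) (rule sum_swap5)
  also have "\<dots> = end_form u u"
    unfolding end_form_def frame_sum[OF e, symmetric] sum_distrib_left sum_distrib_right by (rule refl)
  finally have eq: "Re (end_form u u) = (\<Oplus>a. Re (form (y a) (y a)))" by (simp flip: Re_sum)
  have nonneg: "Re (form (y a) (y a)) \<ge> 0" for a
    using form_pos[of "y a"] by (cases "y a = 0") (auto simp: sesquilinearD[OF form_sesquilinear])
  have "\<exists>a. y a \<noteq> 0"
  proof (rule ccontr)
    assume "\<not> ?thesis"
    then have z: "(\<Oplus>i. u $ (k, i) * e a $ i) = 0" for k a
      by (auto simp: y_def vec_eq_iff)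
    have "u $ (k, m) = 0" for k m
    proof -
      have "0 = (\<Oplus>b. g m b * (\<Oplus>a. (\<Oplus>i. u $ (k, i) * e a $ i) * cnj (e a $ b)))" by (simp add: z)
      also have "\<dots> = (\<Oplus>b. g m b * (\<Oplus>i. u $ (k, i) * h i b))"
        unfolding frame_sum[OF e, symmetric] sum_distrib_right sum_distrib_left
        by (subst (2) sum.swap) (simp add: mult_ac)
      also have "\<dots> = (\<Oplus>i. u $ (k, i) * (\<Oplus>b. h i b * g m b))"
        unfolding sum_distrib_left by (subst sum.swap) (simp add: mult_ac)
      also have "\<dots> = u $ (k, m)" by (simp add: hg if_distrib cong: if_cong)
      finally show ?thesis by simp
    qed
    then show False using assms by (auto simp: vec_eq_iff)
  qed
  then obtain a where "Re (form (y a) (y a)) > 0" using form_pos by blast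
  then show ?thesis unfolding eq using nonneg by (intro sum_pos2[of _ a]) auto
qed

text \<open>The composition of \<open>A\<close> with itself through the Hermitian product on
  endomorphisms, written without a basis.\<close>

definition square_fun :: "'n tens \<Rightarrow> 'n tens" where
  "square_fun A = (\<chi> a. case a of ((k,i),(l,j)) \<Rightarrow> \<Oplus>m n p q. h m n * g p q * A $ ((k,i),(q,n)) * A $ ((p,m),(l,j)))"

lemma square_fun_nth: "square_fun A $ ((k,i),(l,j)) = (\<Oplus>m n p q. h m n * g p q * A $ ((k,i),(q,n)) * A $ ((p,m),(l,j)))"
  by (simp add: square_fun_def)

text \<open>Orthonormality collapses the double sum. As the result does not involve the basis, every
  spectral decomposition gives the same square.\<close>

lemma square_fun_diagonal:
  fixes v :: "'n \<times> 'n \<Rightarrow> complex^'n^'n" and r :: "'n \<times> 'n \<Rightarrow> real"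
  assumes v: "\<And>a b. (\<Oplus>p q m n. g p q * h m n * (v a $ p $ m) * cnj (v b $ q $ n))
      = (if a = b then 1 else 0)"
    and A: "A = (\<Oplus>a. r a *\<^sub>R tensor_conj (v a) (v a))"
  shows "(\<Oplus>a. (r a)\<^sup>2 *\<^sub>R tensor_conj (v a) (v a)) = square_fun A"
proof (rule tens_eqI)
  fix k i l j
  have An: "A $ ((k,i),(l,j)) = (\<Oplus>a. of_real (r a) * (v a $ k $ i * cnj (v a $ l $ j)))" for k i l j
    by (simp add: A tensor_conj_nth) (simp add: scaleR_conv_of_real)
  have "square_fun A $ ((k,i),(l,j)) = (\<Oplus>m n p q a b. of_real (r a) * of_real (r b) * v a $ k $ i * cnj (v b $ l $ j) *
      (g p q * h m n * v b $ p $ m * cnj (v a $ q $ n)))"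
    unfolding square_fun_nth An
    by (intro sum.cong refl) (simp add: mult.assoc sum_product, simp add: sum_distrib_left mult_ac)
  also have "\<dots> = (\<Oplus>a b m n p q. of_real (r a) * of_real (r b) * v a $ k $ i * cnj (v b $ l $ j) *
      (g p q * h m n * v b $ p $ m * cnj (v a $ q $ n)))"
    by (simp only: sum.swap[of _ "UNIV :: ('n \<times> 'n) set" "UNIV :: 'n set"])
  also have "\<dots> = (\<Oplus>a b. of_real (r a) * of_real (r b) * v a $ k $ i * cnj (v b $ l $ j) *
      (\<Oplus>m n p q. g p q * h m n * v b $ p $ m * cnj (v a $ q $ n)))"
    by (simp only: sum_distrib_left)
  also have "\<dots> = (\<Oplus>a b. of_real (r a) * of_real (r b) * v a $ k $ i * cnj (v b $ l $ j) *
      (if b = a then 1 else 0))"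
  proof -
    have "(\<Oplus>m n p q. g p q * h m n * v b $ p $ m * cnj (v a $ q $ n))
      = (if b = a then 1 else 0)" for a b
    proof -
      have "(\<Oplus>m n p q. g p q * h m n * v b $ p $ m * cnj (v a $ q $ n))
        = (\<Oplus>p q m n. g p q * h m n * v b $ p $ m * cnj (v a $ q $ n))"
      proof -
        have "(\<Oplus>m n. Z m n) = (\<Oplus>c. Z (fst c) (snd c))" for Z :: "'n \<Rightarrow> 'n \<Rightarrow> complex"
          by (simp add: sum.cartesian_product case_prod_beta UNIV_Times_UNIV[symmetric] del: UNIV_Times_UNIV)
        then show ?thesis by (simp only: ) (rule sum.swap)
      qed
      then show ?thesis using v by simp
    qed
    then show ?thesis by simp
  qed
  also have "\<dots> = (\<Oplus>a. (r a)\<^sup>2 *\<^sub>R tensor_conj (v a) (v a)) $ ((k,i),(l,j))"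
    by (simp add: tensor_conj_nth if_distrib[of "\<lambda>x. _ * x"] cong: if_cong)
      (simp add: scaleR_conv_of_real power2_eq_square mult_ac)
  finally show "(\<Oplus>a. (r a)\<^sup>2 *\<^sub>R tensor_conj (v a) (v a)) $ ((k,i),(l,j)) = square_fun A $ ((k,i),(l,j))" by simp
qed

lemma spectral_decomposition:
  fixes A :: "'n tens"
  assumes A: "\<And>k i l j. cnj (A $ ((k,i),(l,j))) = A $ ((l,j),(k,i))"
  obtains v :: "'n \<times> 'n \<Rightarrow> complex^'n^'n" and r :: "'n \<times> 'n \<Rightarrow> real"
  where "\<And>a b. (\<Oplus>p q m n. g p q * h m n * (v a $ p $ m) * cnj (v b $ q $ n))
      = (if a = b then 1 else 0)"
    "A = (\<Oplus>a. r a *\<^sub>R tensor_conj (v a) (v a))"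
proof -
  have herm: "cnj (A $ (a, b)) = A $ (b, a)" for a b using A by (cases a, cases b) auto
  obtain v :: "'n \<times> 'n \<Rightarrow> complex^('n \<times> 'n)" and r :: "'n \<times> 'n \<Rightarrow> real" where v: "\<And>a b. end_form (v a) (v b) = (if a = b then 1 else 0)"
    and r: "\<And>a b. A $ (a, b) = (\<Oplus>c. of_real (r c) * v c $ a * cnj (v c $ b))"
    by (rule hermitian_diagonalisation[where A = "\<lambda>a b. A $ (a, b)",
          OF end_form_sesquilinear end_form_pos herm], assumption, rule that)
  define V :: "'n \<times> 'n \<Rightarrow> complex^'n^'n" where "V a = (\<chi> k i. v a $ (k, i))" for a
  have "A = (\<Oplus>a. r a *\<^sub>R tensor_conj (V a) (V a))"
    by (rule tens_eqI) (simp add: r tensor_conj_nth V_def, simp add: scaleR_conv_of_real mult_ac)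
  moreover have "(\<Oplus>p q m n. g p q * h m n * (V a $ p $ m) * cnj (V b $ q $ n))
      = (if a = b then 1 else 0)" for a b
    using v[of a b] by (simp add: end_form_def V_def)
  ultimately show thesis using that by blast
qed

lemma square_eq:
  fixes A :: "'n tens"
  assumes G: "\<And>k l. G x $ k $ l = g k l" and h: "\<And>i j. g_inv G x i j = h i j"
    and A: "\<And>k i l j. cnj (A $ ((k,i),(l,j))) = A $ ((l,j),(k,i))"
  shows "square G x A = square_fun A" and "A \<in> Sym11"
proof -
  obtain v :: "'n \<times> 'n \<Rightarrow> complex^'n^'n" and r :: "'n \<times> 'n \<Rightarrow> real"
    where v: "\<And>a b. (\<Oplus>p q m n. g p q * h m n * (v a $ p $ m) * cnj (v b $ q $ n))
      = (if a = b then 1 else 0)" and Av: "A = (\<Oplus>a. r a *\<^sub>R tensor_conj (v a) (v a))"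
    by (rule spectral_decomposition[OF A], rule that)
  show "A \<in> Sym11"
    unfolding Av Sym11_def by (intro span_sum span_scale span_base) auto
  have orth: "end_orthonormal G x v \<longleftrightarrow> (\<forall>a b. (\<Oplus>p q m n. g p q * h m n * (v a $ p $ m) * cnj (v b $ q $ n)) = (if a = b then 1 else 0))" for v
    by (simp add: end_orthonormal_def end_inner_def G h)
  show "square G x A = square_fun A"
    unfolding square_def
  proof (rule the_equality)
    show "\<exists>v r. end_orthonormal G x v \<and> A = (\<Oplus>a. r a *\<^sub>R tensor_conj (v a) (v a)) \<and>
      square_fun A = (\<Oplus>a. (r a)\<^sup>2 *\<^sub>R tensor_conj (v a) (v a))"
      unfolding orth
      by (intro exI[of _ v] exI[of _ r] conjI allI v Av square_fun_diagonal[OF v Av, symmetric])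
  next
    fix B
    assume "\<exists>v r. end_orthonormal G x v \<and> A = (\<Oplus>a. r a *\<^sub>R tensor_conj (v a) (v a)) \<and>
      B = (\<Oplus>a. (r a)\<^sup>2 *\<^sub>R tensor_conj (v a) (v a))"
    then show "B = square_fun A" unfolding orth using square_fun_diagonal by blast
  qed
qed

end

section \<open>The evolution equation\<close>

context metric_chart
begin

lemma hermitian_pair_chart:
  assumes "t \<in> I" "x \<in> U"
  shows "hermitian_pair (\<lambda>k l. G t x $ k $ l) (g_inv (G t) x)"
proof
  have J: "J_metric (H t x)" by (rule J_metric[OF assms])
  have inv: "invertible (G t x)" using g_comp_invertible[where H = "H t", OF J] .
  fix k l p q :: 'n and u :: "complex^'n"
  show "(\<Oplus>q. g_inv (G t) x k q * G t x $ p $ q) = (if k = p then 1 else 0)"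
    "(\<Oplus>p. g_inv (G t) x p l * G t x $ p $ q) = (if l = q then 1 else 0)"
    using g_inv_contract[where G = "G t" and x = x, OF inv] by auto
  show "cnj (G t x $ p $ q) = G t x $ q $ p"
    by (rule g_comp_hermitian[where H = "H t", OF J])
  assume "u \<noteq> 0"
  then have "H t x u u > 0" by (rule J_metric.pos[OF J])
  moreover have "(\<Oplus>k l. G t x $ k $ l * u $ k * cnj (u $ l)) = of_real (H t x u u) / 2"
    using g_comp_form[where H = "H t", OF J, of u u] J_metric.herm_same[OF J, of u] by (simp add: mult_ac)
  ultimately show "Re (\<Oplus>k l. G t x $ k $ l * u $ k * cnj (u $ l)) > 0"
    by (simp only:) simp
qed

lemma Omega_cnj:
  assumes "t \<in> I" "x \<in> U"
  shows "cnj (Omega (G t) x $ ((k,i),(l,j))) = Omega (G t) x $ ((l,j),(k,i))"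
  by (simp add: Omega_eq[OF assms] Om_cnj)

lemma has_vector_derivative_Omega:
  assumes tx: "t \<in> I" "x \<in> U" and V: "\<And>k i l j. V $ ((k,i),(l,j)) = der dir_t (Om i j k l) (t, x)"
  shows "((\<lambda>s. Omega (G s) x) has_vector_derivative V) (at t within I)"
  unfolding has_vector_derivative_def
proof (rule has_derivative_vec)
  fix a :: "('n \<times> 'n) \<times> ('n \<times> 'n)"
  obtain k i l j where a: "a = ((k,i),(l,j))" by (metis prod.exhaust)
  have "((\<lambda>s. Om i j k l (s, x)) has_vector_derivative dir_deriv (1, 0) (Om i j k l) (t, x)) (at t within I)"
    by (rule has_vector_derivative_time[OF sm_Om tx])
  then have "((\<lambda>s. Om i j k l (s, x)) has_vector_derivative V $ a) (at t within I)"
    by (simp add: a V der_dir_t)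
  then have "((\<lambda>s. Omega (G s) x $ a) has_vector_derivative V $ a) (at t within I)"
    by (rule has_vector_derivative_transform[OF tx(1), rotated]) (simp add: a Omega_eq tx)
  then show "((\<lambda>s. Omega (G s) x $ a) has_derivative (\<lambda>s. (s *\<^sub>R V) $ a)) (at t within I)"
    by (simp add: has_vector_derivative_def)
qed

end

context chern_chart
begin

text \<open>\<open>tens_deriv_holo\<close> removes the derivatives of the frame, and
  \<open>frame_sum\<close> replaces its values at x by the inverse metric; hence the description by
  an arbitrary frame is unique.\<close>

lemma twisted_laplacian_eq:
  assumes x: "x \<in> U"
  shows "twisted_laplacian (G t) \<Gamma> (Omega (G t)) x $ ((k,i),(l,j)) = 1/2 * (\<Oplus>m n. ginv m n (t, x) * (N m (Nb n Om) i j k l (t, x) + Nb n (N m Om) i j k l (t, x)))"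
proof -
  interpret P: hermitian_pair "\<lambda>k l. G t x $ k $ l" "g_inv (G t) x"
    by (rule hermitian_pair_chart[OF t x])
  define nab where "nab = twisted_deriv \<Gamma>"
  define \<Omega> where "\<Omega> = Omega (G t)"
  define L :: "'n tens" where "L = (\<chi> a. case a of ((k,i),(l,j)) \<Rightarrow> 1/2 * (\<Oplus>m n. ginv m n (t, x) * (N m (Nb n Om) i j k l (t, x) + Nb n (N m Om) i j k l (t, x))))"
  define lap where "lap e = (1/2) *s (\<Oplus>i. tens_deriv10 nab (e i) (tens_deriv01 nab (e i) \<Omega>) x
      + tens_deriv01 nab (e i) (tens_deriv10 nab (e i) \<Omega>) x)" for e :: "'n \<Rightarrow> 'n local_field"
  have frame: "holo_unitary_frame (G t) x e \<longleftrightarrow> (\<exists>V. open V \<and> x \<in> V \<and> (\<forall>i. holo_on V (e i))) \<and>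
      (\<forall>i j. P.form (e i x) (e j x) = (if i = j then 1 else 0))" for e
    by (simp add: holo_unitary_frame_def P.form_def)
  have val: "lap e = L" if e: "holo_unitary_frame (G t) x e" for e
  proof (rule tens_eqI)
    fix k i l j
    obtain V where V: "open V" "x \<in> V" "\<And>i. holo_on V (e i)" using e unfolding frame by blast
    have orth: "P.form (e a x) (e b x) = (if a = b then 1 else 0)" for a b
      using e unfolding frame by blast
    have h: "ginv m n (t, x) = (\<Oplus>a. e a x $ m * cnj (e a x $ n))" for m n
      using P.frame_sum[of "\<lambda>a. e a x" m n, OF orth] by (simp add: ginv_chart[OF t x])
    have \<Omega>: "\<Omega> y $ ((k,i),(l,j)) = Om i j k l (t, y)" if "y \<in> U" for y k i l j
      using that by (simp add: \<Omega>_def Omega_eq t)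
    have th: "tens_deriv10 nab (e a) (tens_deriv01 nab (e a) \<Omega>) x $ ((k,i),(l,j))
        = (\<Oplus>m n. e a x $ m * cnj (e a x $ n) * N m (Nb n Om) i j k l (t, x))"
      "tens_deriv01 nab (e a) (tens_deriv10 nab (e a) \<Omega>) x $ ((k,i),(l,j))
        = (\<Oplus>m n. e a x $ m * cnj (e a x $ n) * Nb n (N m Om) i j k l (t, x))" for a
      unfolding nab_def
      by (rule tens_deriv_holo[where X = Om and A = \<Omega> and V = V]; use x V in \<open>simp add: \<Omega>\<close>)+
    have "lap e $ ((k,i),(l,j))
      = 1/2 * (\<Oplus>a m n. e a x $ m * cnj (e a x $ n) *
         (N m (Nb n Om) i j k l (t, x) + Nb n (N m Om) i j k l (t, x)))"
      unfolding lap_def vector_smult_component sum_component vector_add_component th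
      by (simp only: sum.distrib distrib_left)
    also have "(\<Oplus>a m n. e a x $ m * cnj (e a x $ n) *
         (N m (Nb n Om) i j k l (t, x) + Nb n (N m Om) i j k l (t, x)))
      = (\<Oplus>m a n. e a x $ m * cnj (e a x $ n) *
         (N m (Nb n Om) i j k l (t, x) + Nb n (N m Om) i j k l (t, x)))"
      by (rule sum.swap)
    also have "\<dots> = (\<Oplus>m n a. e a x $ m * cnj (e a x $ n) *
         (N m (Nb n Om) i j k l (t, x) + Nb n (N m Om) i j k l (t, x)))"
      by (rule sum.cong[OF refl], rule sum.swap)
    finally show "lap e $ ((k,i),(l,j)) = L $ ((k,i),(l,j))"
      by (simp add: L_def h sum_distrib_right)
  qed
  have "twisted_laplacian (G t) \<Gamma> \<Omega> x = L"
    unfolding twisted_laplacian_def Let_def nab_def[symmetric] lap_def[symmetric]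
  proof (rule the_equality)
    obtain v :: "'n \<Rightarrow> complex^'n" where v: "\<And>a b. P.form (v a) (v b) = (if a = b then 1 else 0)"
      by (rule P.frame_exists, rule that)
    \<comment> \<open>A frame unitary at x, extended by constant coefficients, is
      holomorphic.\<close>
    have "holo_on UNIV (\<lambda>_. v a)" for a
      unfolding holo_on_def by (auto intro!: exI[of _ "\<lambda>_. 0"] simp: Jst_def)
    then have fr: "holo_unitary_frame (G t) x (\<lambda>a _. v a)"
      unfolding frame using v by (auto intro!: exI[of _ UNIV])
    show "\<exists>e. holo_unitary_frame (G t) x e \<and> L = lap e"
      by (rule exI[of _ "\<lambda>a _. v a"], rule conjI[OF fr val[OF fr, symmetric]])
  next
    fix B
    assume "\<exists>e. holo_unitary_frame (G t) x e \<and> B = lap e"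
    with val show "B = L" by auto
  qed
  then show ?thesis by (simp add: \<Omega>_def L_def)
qed

lemma D_nabla_T_eq:
  assumes x: "x \<in> U"
  shows "D_nabla_T (G t) \<Gamma> x $ ((k,i),(l,j)) = 1/2 * (\<Oplus>m n p s. ginv m n (t, x) * ginv p s (t, x) * nabla i T m p k (t, x) * nablab j Tb n s l (t, x))"
  by (simp add: D_nabla_T_def nabla_T_eq[OF x] nabla_cnj ginv_chart[OF t x])

lemma ad_sym_Omega:
  assumes x: "x \<in> U" and "Omega (G t) x \<in> Sym11"
  shows "ad_sym (v_end (G t) x) (Omega (G t) x) $ ((k,i),(l,j)) = v_act i j k l (t, x) + v_actb i j k l (t, x)"
  by (simp add: ad_sym_eq[OF assms(2)] end_act_nth v_end_eq[OF t x] Omega_eq[OF t x] Om_cnj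
      v_act_def v_actb_def algebra_simps flip: sum.distrib)

theorem evolution_chart:
  assumes HCF: "\<And>t x i j. t \<in> I \<Longrightarrow> x \<in> U \<Longrightarrow>
      ((\<lambda>s. G s x $ i $ j) has_vector_derivative - S2 (G t) x i j - Q (G t) x i j) (at t within I)"
    and x: "x \<in> U"
  shows "Omega (G t) x \<in> Sym11"
    and "((\<lambda>s. Omega (G s) x) has_vector_derivative
          twisted_laplacian (G t) \<Gamma> (Omega (G t)) x + square (G t) x (Omega (G t) x) + sharp (Omega (G t) x)
          + D_nabla_T (G t) \<Gamma> x + ad_sym (v_end (G t) x) (Omega (G t) x)) (at t within I)"
proof -
  interpret P: hermitian_pair "\<lambda>k l. G t x $ k $ l" "g_inv (G t) x"
    by (rule hermitian_pair_chart[OF t x])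
  note sq = P.square_eq[where G = "G t" and x = x and A = "Omega (G t) x", OF refl refl Omega_cnj[OF t x]]
  show S: "Omega (G t) x \<in> Sym11" by (rule sq(2))
  show "((\<lambda>s. Omega (G s) x) has_vector_derivative
          twisted_laplacian (G t) \<Gamma> (Omega (G t)) x + square (G t) x (Omega (G t) x) + sharp (Omega (G t) x)
          + D_nabla_T (G t) \<Gamma> x + ad_sym (v_end (G t) x) (Omega (G t) x)) (at t within I)"
  proof (rule has_vector_derivative_Omega[OF t x])
    fix k i l j
    have dh: "der dir_t (ginv k l) = (\<lambda>p. S2_up k l p + Q_up k l p)" for k l
      by (rule der_dir_t_ginv, rule HCF)
    have "square (G t) x (Omega (G t) x) $ ((k,i),(l,j))
      = (\<Oplus>m n p q. ginv m n (t, x) * gmat p q (t, x) * Om i n k q (t, x) * Om m j p l (t, x))"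
      by (simp add: sq(1) P.square_fun_nth Omega_eq[OF t x] ginv_chart[OF t x] gmat_chart[OF t x])
    moreover have "sharp (Omega (G t) x) $ ((k,i),(l,j)) = (\<Oplus>m n. Om i j m n (t, x) * Om m n k l (t, x))
       - (\<Oplus>m q. Om m j k q (t, x) * Om i q m l (t, x))"
      by (simp add: sharp_nth Omega_eq[OF t x] sum_subtractf mult.commute)
    ultimately show "(twisted_laplacian (G t) \<Gamma> (Omega (G t)) x + square (G t) x (Omega (G t) x) + sharp (Omega (G t) x)
          + D_nabla_T (G t) \<Gamma> x + ad_sym (v_end (G t) x) (Omega (G t) x)) $ ((k,i),(l,j)) = der dir_t (Om i j k l) (t, x)"
      unfolding evolution[OF dh]
      by (simp only: vector_add_component twisted_laplacian_eq[OF x] D_nabla_T_eq[OF x] ad_sym_Omega[OF x S])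
  qed
qed

end

section \<open>From a chart to the manifold\<close>

lemma chern_connection_coeffs:
  assumes "chern_connection \<A> g \<Gamma>" "c \<in> \<A>" "x \<in> coords c"
  shows "bilinear (\<Gamma> c x)"
    and "frechet_derivative (\<lambda>y. g c y v w) (at x) u = g c x (\<Gamma> c x u v) w + g c x v (\<Gamma> c x u w)"
    and "\<Gamma> c x u (Jst v) = Jst (\<Gamma> c x u v)"
    and "\<Gamma> c x u (Jst v) - \<Gamma> c x (Jst v) u = \<Gamma> c x (Jst u) v - \<Gamma> c x v (Jst u)"
proof -
  show "bilinear (\<Gamma> c x)"
    using assms unfolding chern_connection_def tm_connection_def by blast
  have "frechet_derivative (\<lambda>y. g c y ((\<lambda>_. v) y) ((\<lambda>_. w) y)) (at x) ((\<lambda>_. u) x) =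
       g c x (cov_deriv (\<Gamma> c) (\<lambda>_. u) (\<lambda>_. v) x) ((\<lambda>_. w) x) + g c x ((\<lambda>_. v) x) (cov_deriv (\<Gamma> c) (\<lambda>_. u) (\<lambda>_. w) x) \<and>
     cov_deriv (\<Gamma> c) (\<lambda>_. u) (\<lambda>y. Jst ((\<lambda>_. v) y)) x = Jst (cov_deriv (\<Gamma> c) (\<lambda>_. u) (\<lambda>_. v) x) \<and>
     torsion (\<Gamma> c) (\<lambda>_. u) (\<lambda>y. Jst ((\<lambda>_. v) y)) x = torsion (\<Gamma> c) (\<lambda>y. Jst ((\<lambda>_. u) y)) (\<lambda>_. v) x"
    using assms unfolding chern_connection_def using smooth_on_const by blast
  then show "frechet_derivative (\<lambda>y. g c y v w) (at x) u = g c x (\<Gamma> c x u v) w + g c x v (\<Gamma> c x u w)"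
    "\<Gamma> c x u (Jst v) = Jst (\<Gamma> c x u v)"
    "\<Gamma> c x u (Jst v) - \<Gamma> c x (Jst v) u = \<Gamma> c x (Jst u) v - \<Gamma> c x v (Jst u)"
    by (auto simp: cov_deriv_def torsion_def lie_bracket_def)
qed

theorem proposition1p10:
  fixes \<A> :: "('m::t2_space, 'n::finite) chart set"
    and I :: "real set"
    and g :: "real \<Rightarrow> ('m, 'n) chart \<Rightarrow> 'n local_metric"
    and \<Gamma> :: "real \<Rightarrow> ('m, 'n) chart \<Rightarrow> 'n coeffs"
  assumes "compact (UNIV :: 'm set)"
    and "complex_atlas \<A>"
    and "is_interval I" and "interior I \<noteq> {}"
    and "HCF_solution \<A> I g"
    and "\<forall>t\<in>I. chern_connection \<A> (g t) (\<Gamma> t)"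
  shows "\<forall>c\<in>\<A>. \<forall>t\<in>I. \<forall>x\<in>coords c.
    (let G = g_comp (g t c); \<Omega> = Omega G in
       \<Omega> x \<in> Sym11 \<and>
       ((\<lambda>s. Omega (g_comp (g s c)) x) has_vector_derivative
          twisted_laplacian G (\<Gamma> t c) \<Omega> x + square G x (\<Omega> x) + sharp (\<Omega> x)
          + D_nabla_T G (\<Gamma> t c) x + ad_sym (v_end G x) (\<Omega> x)) (at t within I))"
proof (intro ballI)
  fix c t x assume c: "c \<in> \<A>" and t: "t \<in> I" and x: "x \<in> coords c"
  have fam: "smooth_metric_family \<A> I g" using assms(5) by (simp add: HCF_solution_def)
  \<comment> \<open>All terms are given by their expressions in a single chart, so the claim is
    proved chart by chart.\<close>
  interpret chern_chart I "coords c" "\<lambda>s. g s c" t "\<Gamma> t c"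
  proof
    show "is_interval I" "interior I \<noteq> {}" "t \<in> I" by fact+
    show "open (coords c)" using assms(2) c by (simp add: complex_atlas_def)
    show "smooth_on (I \<times> coords c) (\<lambda>(t, x). g t c x u v)" for u v
      using fam c by (simp add: smooth_metric_family_def)
    fix s y u v and w :: "complex^'n" assume "s \<in> I" "y \<in> coords c"
    then have herm: "bilinear (g s c y) \<and> (\<forall>u v. g s c y u v = g s c y v u) \<and>
       (\<forall>u. u \<noteq> 0 \<longrightarrow> g s c y u u > 0) \<and> (\<forall>u v. g s c y (Jst u) (Jst v) = g s c y u v)"
      using fam c unfolding smooth_metric_family_def hermitian_metric_def by blast
    show "bilinear (g s c y)" using herm by blast
    show "g s c y u v = g s c y v u" using herm by blast
    show "u \<noteq> 0 \<Longrightarrow> g s c y u u > 0" using herm by blast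
    show "g s c y (Jst u) (Jst v) = g s c y u v" using herm by blast
  next
    have chern: "chern_connection \<A> (g t) (\<Gamma> t)" using assms(6) t by blast
    fix y u v w assume y: "y \<in> coords c"
    show "bilinear (\<Gamma> t c y)"
      and "frechet_derivative (\<lambda>y. g t c y v w) (at y) u = g t c y (\<Gamma> t c y u v) w + g t c y v (\<Gamma> t c y u w)"
      and "\<Gamma> t c y u (Jst v) = Jst (\<Gamma> t c y u v)"
      and "\<Gamma> t c y u (Jst v) - \<Gamma> t c y (Jst v) u = \<Gamma> t c y (Jst u) v - \<Gamma> t c y v (Jst u)"
      by (rule chern_connection_coeffs[OF chern c y])+
  qed
  show "let G = g_comp (g t c); \<Omega> = Omega G in
       \<Omega> x \<in> Sym11 \<and>
       ((\<lambda>s. Omega (g_comp (g s c)) x) has_vector_derivative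
          twisted_laplacian G (\<Gamma> t c) \<Omega> x + square G x (\<Omega> x) + sharp (\<Omega> x)
          + D_nabla_T G (\<Gamma> t c) x + ad_sym (v_end G x) (\<Omega> x)) (at t within I)"
    unfolding Let_def using evolution_chart[OF _ x] assms(5) c
    by (auto simp: HCF_solution_def)
qed

end
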